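(* Let $M=\mathbb S^1$, let $V:M\to\mathbb R$ be a Lipschitz function, and let $\lambda_V$ be the largest eigenvalue of $L+V$, where $L=\frac12\frac{\partial^2}{\partial x^2}$. Let $\mathbf P(V)$ be the pressure of $V$ and let $\mathbb P^V_{\mu_V}$ be the Gibbs probability for the potential $V$ (both defined in the context). Then $$\mathbf P(V)=H(\mathbb P^V_{\mu_V}\,|\,\mathbb P_{\mu_V})+\int_M V\,d\mu_V=\lambda_V .$$ Therefore, the continuous-time equilibrium state for $V$ is the Gibbs state for $V$; that is, $\mathbb P^V_{\mu_V}$ is the admissible probability attaining the supremum that defines $\mathbf P(V)$.
   Context: $M=\mathbb S^1$ is the interval $[0,1]$ with $0\equiv1$, with the Euclidean metric. $\mathcal C$ is the space of continuous paths $w:[0,\infty)\to M$, $X_t(w)=w_t$ is the coordinate process, and $\{\mathcal F_t\}$ is its canonical filtration. $\mathbb P_x$ is the law on $\mathcal C$ of Brownian motion on $M$ started at $x$, i.e. of the diffusion with generator $L=\frac12\frac{\partial^2}{\partial x^2}$. For a family $(\mathbb Q_x)_{x\in M}$ of probabilities on $\mathcal C$ and a probability $\mu$ on $M$, write $\mathbb Q_\mu[A]=\int_M\mathbb Q_x[A]\,d\mu(x)$ for measurable $A\subset\mathcal C$; this defines in particular $\mathbb P_\mu$. Gibbs probability. It is a classical fact that $L+V$ (acting by $f\mapsto\frac12f''+Vf$) has a largest eigenvalue $\lambda_V$ with a strictly positive eigenfunction $F\in C^2(M)$, $(L+V)F=\lambda_VF$. Let $\mathcal L_V f=\frac12 f''+(\log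 F)'f'$ for $f\in C^2(M)$. Let $d\mu_V(x)=\frac{F^2(x)}{\gamma_V}\,dx$ with $\gamma_V=\int_M F^2(x)\,dx$; this is an invariant probability for $\mathcal L_V$. $\mathbb P^V_x$ is the law on $\mathcal C$ of the Markov process with generator $\mathcal L_V$ started at $x$, and the Gibbs probability (Gibbs state) for $V$ is $\mathbb P^V_{\mu_V}$. Admissible probabilities. For $g\in C^2(M)$ let $(\tilde{\mathbb P}_x)_{x\in M}$ be the probabilities on $\mathcal C$ such that for all $T\ge0$ $$\frac{d\tilde{\mathbb P}_x}{d\mathbb P_x}\Big|_{\mathcal F_T}=\exp\Big\{g(X_T)-g(X_0)-\frac12\int_0^T\big[g''(X_r)+(g'(X_r))^2\big]\,dr\Big\}.$$ Under $\tilde{\mathbb P}_x$ the coordinate process is the diffusion started at $x$ with generator $\tilde Lf=\frac12f''+g'f'$, and its stationary probability is $d\tilde\mu(x)=\frac{e^{2g(x)}}{\tilde\gamma}\,dx$ with $\tilde\gamma=\int_M e^{2g(x)}\,dx$. A probability on $\mathcal C$ is called admissible if it is of the form $\tilde{\mathbb P}_{\tilde\mu}$ for some $g\in C^2(M)$, with $\tilde{\mathbb P}_x$ and $\tilde\mu$ as just described. (The Gibbs probability $\mathbb P^V_{\mu_V}$ is of this form with $g=\log F$.) Relative entropy. For an admissible $\tilde{\mathbb P}_{\tilde\mu}$ and $T\ge0$, $$H_T(\tilde{\mathbb P}_{\tilde\mu}|\mathbb P_{\tilde\mu})=-\int_M\int_{\mathcal C}\log\Big(\frac{d\tilde{\mathbb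 P}_x}{d\mathbb P_x}\Big|_{\mathcal F_T}\Big)(w)\,d\tilde{\mathbb P}_x(w)\,d\tilde\mu(x),$$ (note the minus sign, so $H_T\le0$), and $H(\tilde{\mathbb P}_{\tilde\mu}|\mathbb P_{\tilde\mu})=\lim_{T\to\infty}\frac1T H_T(\tilde{\mathbb P}_{\tilde\mu}|\mathbb P_{\tilde\mu})$. Pressure and equilibrium states. $$\mathbf P(V)=\sup_{\tilde{\mathbb P}_{\tilde\mu}\ \text{admissible}}\Big\{H(\tilde{\mathbb P}_{\tilde\mu}|\mathbb P_{\tilde\mu})+\int_M V\,d\tilde\mu\Big\},$$ and any admissible $\tilde{\mathbb P}_{\tilde\mu}$ attaining this supremum is called a continuous-time equilibrium state for $V$. *)

theory Defs
  imports "HOL-Probability.Probability"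
begin

section \<open>The circle of length one\<close>

text \<open>
  A point of \<open>M\<close> is represented by its representative in \<open>{0..<1}\<close>, and a function on \<open>M\<close> by a
  1-periodic function on the reals. Under this identification \<open>C\<^sup>2(M)\<close> consists of the periodic
  \<open>C\<^sup>2\<close> functions, a function on \<open>M\<close> is Lipschitz for the circle metric iff the periodic function
  is Lipschitz on the reals (with the same constant), and the Borel sets of \<open>M\<close> are those
  of \<open>{0..<1}\<close>.
\<close>

abbreviation circle :: "real set" where
  "circle \<equiv> {0..<1}"

abbreviation circle_borel :: "real measure" where
  "circle_borel \<equiv> restrict_space borel circle"

abbreviation circle_lebesgue :: "real measure" where
  "circle_lebesgue \<equiv> restrict_space lborel circle"

definition periodic1 :: "(real \<Rightarrow> 'a) \<Rightarrow> bool" where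
  "periodic1 f \<longleftrightarrow> (\<forall>x. f (x + 1) = f x)"

definition C2_circle :: "(real \<Rightarrow> real) \<Rightarrow> bool" where
  "C2_circle f \<longleftrightarrow> periodic1 f \<and>
     (\<forall>x. f differentiable (at x)) \<and>
     (\<forall>x. deriv f differentiable (at x)) \<and>
     continuous_on UNIV (deriv (deriv f))"

definition lipschitz_circle :: "(real \<Rightarrow> real) \<Rightarrow> bool" where
  "lipschitz_circle f \<longleftrightarrow> periodic1 f \<and> (\<exists>K. K-lipschitz_on UNIV f)"


section \<open>Path space and canonical filtration\<close>

text \<open>
  \<open>x \<mapsto> cis (2 * pi * x)\<close> is a homeomorphism from \<open>[0,1]\<close> with \<open>0 \<equiv> 1\<close> onto the unit circle of
  the complex plane, so the condition below is continuity of a path in \<open>M\<close>; the real-valued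
  representative \<open>w\<close> itself jumps when the path crosses \<open>0\<close>. Paths are \<open>undefined\<close> at
  negative times.
\<close>

definition circle_paths :: "(real \<Rightarrow> real) set" where
  "circle_paths = {w \<in> {0..} \<rightarrow>\<^sub>E circle. continuous_on {0..} (\<lambda>t. cis (2 * pi * w t))}"

definition coordinate_algebra :: "real set \<Rightarrow> (real \<Rightarrow> real) measure" where
  "coordinate_algebra I =
     sigma circle_paths {(\<lambda>w. w t) -` B \<inter> circle_paths | t B. t \<in> I \<and> B \<in> sets borel}"

definition path_space :: "(real \<Rightarrow> real) measure" where
  "path_space = coordinate_algebra {0..}"

definition path_filtration :: "real \<Rightarrow> (real \<Rightarrow> real) measure" where
  "path_filtration T = coordinate_algebra {0..T}"

lemma space_coordinate_algebra [simp]: "space (coordinate_algebra I) = circle_paths"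
  unfolding coordinate_algebra_def by (rule space_measure_of) auto

lemma sets_coordinate_algebra:
  "sets (coordinate_algebra I) = sigma_sets circle_paths
     {(\<lambda>w. w t) -` B \<inter> circle_paths | t B. t \<in> I \<and> B \<in> sets borel}"
  unfolding coordinate_algebra_def by (rule sets_measure_of) auto

lemma subalgebra_path_filtration: "subalgebra path_space (path_filtration T)"
  unfolding subalgebra_def path_space_def path_filtration_def sets_coordinate_algebra
  by (auto intro!: sigma_sets_mono')

lemma measurable_coordinate:
  assumes "t \<in> I" "I \<subseteq> {0..}"
  shows "(\<lambda>w. w t) \<in> coordinate_algebra I \<rightarrow>\<^sub>M circle_borel"
proof (rule measurable_restrict_space2)
  show "(\<lambda>w. w t) \<in> space (coordinate_algebra I) \<rightarrow> circle"
    using assms by (auto simp: circle_paths_def PiE_def Pi_def)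
  show "(\<lambda>w. w t) \<in> borel_measurable (coordinate_algebra I)"
    using assms by (intro measurableI) (auto simp: sets_coordinate_algebra)
qed


section \<open>Markov laws with a given generator\<close>

text \<open>
  \<open>Q\<close> is the family of laws on path space of the Markov process whose generator acts on
  \<open>C\<^sup>2(M)\<close> as \<open>A\<close>: a measurable family of probabilities, \<open>Q x\<close> started at \<open>x\<close>, with the Markov
  property with respect to the canonical filtration, and with
  \<open>(E\<^sub>x[f(X\<^sub>t)] - f(x)) / t \<longlonglongrightarrow> (A f)(x)\<close> uniformly in \<open>x\<close> as \<open>t\<close> decreases to 0,
  for every \<open>f\<close> in \<open>C\<^sup>2(M)\<close>. For the elliptic operators on the circle used below, \<open>C\<^sup>2(M)\<close> is the
  whole domain of the generator in \<open>C(M)\<close>, so these conditions determine the family on \<open>M\<close>.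
\<close>

definition markov_laws ::
  "((real \<Rightarrow> real) \<Rightarrow> real \<Rightarrow> real) \<Rightarrow> (real \<Rightarrow> (real \<Rightarrow> real) measure) \<Rightarrow> bool" where
  "markov_laws A Q \<longleftrightarrow>
     Q \<in> circle_borel \<rightarrow>\<^sub>M prob_algebra path_space \<and>
     (\<forall>x\<in>circle. AE w in Q x. w 0 = x) \<and>
     (\<forall>x\<in>circle. \<forall>s\<ge>0. \<forall>t\<ge>0. \<forall>B\<in>sets (path_filtration s). \<forall>D\<in>sets circle_borel.
        measure (Q x) {w \<in> B. w (s + t) \<in> D}
          = (LINT w:B|Q x. measure (Q (w s)) {v \<in> circle_paths. v t \<in> D})) \<and>
     (\<forall>f. C2_circle f \<longrightarrow>
        uniform_limit circle (\<lambda>t x. ((LINT w|Q x. f (w t)) - f x) / t) (A f) (at_right 0))"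

definition half_laplacian :: "(real \<Rightarrow> real) \<Rightarrow> real \<Rightarrow> real" where
  "half_laplacian f x = 1 / 2 * deriv (deriv f) x"

definition brownian_laws :: "(real \<Rightarrow> (real \<Rightarrow> real) measure) \<Rightarrow> bool" where
  "brownian_laws P \<longleftrightarrow> markov_laws half_laplacian P"


section \<open>Principal eigenvalue and Gibbs probability\<close>

definition eigenfunction :: "(real \<Rightarrow> real) \<Rightarrow> real \<Rightarrow> (real \<Rightarrow> real) \<Rightarrow> bool" where
  "eigenfunction V l f \<longleftrightarrow> C2_circle f \<and> (\<exists>x. f x \<noteq> 0) \<and>
     (\<forall>x. half_laplacian f x + V x * f x = l * f x)"

definition largest_eigenvalue :: "(real \<Rightarrow> real) \<Rightarrow> real \<Rightarrow> bool" where
  "largest_eigenvalue V l \<longleftrightarrow>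
     (\<exists>f. eigenfunction V l f) \<and> (\<forall>l' f. eigenfunction V l' f \<longrightarrow> l' \<le> l)"

definition gibbs_generator :: "(real \<Rightarrow> real) \<Rightarrow> (real \<Rightarrow> real) \<Rightarrow> real \<Rightarrow> real" where
  "gibbs_generator F f x = half_laplacian f x + deriv (\<lambda>y. ln (F y)) x * deriv f x"

definition normalized_density :: "(real \<Rightarrow> real) \<Rightarrow> real measure" where
  "normalized_density h =
     density circle_lebesgue (\<lambda>x. ennreal (h x / (LINT y|circle_lebesgue. h y)))"

definition gibbs_marginal :: "(real \<Rightarrow> real) \<Rightarrow> real measure" where
  "gibbs_marginal F = normalized_density (\<lambda>x. (F x)\<^sup>2)"

text \<open>The mixture \<open>Q\<^sub>\<mu>[A] = \<integral> Q\<^sub>x[A] d\<mu>(x)\<close> is the monadic bind.\<close>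

definition mixture ::
  "real measure \<Rightarrow> (real \<Rightarrow> (real \<Rightarrow> real) measure) \<Rightarrow> (real \<Rightarrow> real) measure" where
  "mixture \<mu> Q = bind \<mu> Q"


section \<open>Admissible probabilities\<close>

definition tilting_exponent :: "(real \<Rightarrow> real) \<Rightarrow> real \<Rightarrow> (real \<Rightarrow> real) \<Rightarrow> real" where
  "tilting_exponent g T w = g (w T) - g (w 0)
     - 1 / 2 * (LINT r:{0..T}|lborel. deriv (deriv g) (w r) + (deriv g (w r))\<^sup>2)"

definition tilted_laws ::
  "(real \<Rightarrow> (real \<Rightarrow> real) measure) \<Rightarrow> (real \<Rightarrow> real) \<Rightarrow> (real \<Rightarrow> (real \<Rightarrow> real) measure) \<Rightarrow> bool" where
  "tilted_laws P g Q \<longleftrightarrow> C2_circle g \<and>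
     (\<forall>x\<in>circle. prob_space (Q x) \<and> sets (Q x) = sets path_space \<and>
        (\<forall>T\<ge>0. restr_to_subalg (Q x) (path_filtration T) =
           density (restr_to_subalg (P x) (path_filtration T))
             (\<lambda>w. ennreal (exp (tilting_exponent g T w)))))"

definition tilted_marginal :: "(real \<Rightarrow> real) \<Rightarrow> real measure" where
  "tilted_marginal g = normalized_density (\<lambda>x. exp (2 * g x))"

text \<open>
  The admissible probabilities on path space are the mixtures \<open>mixture \<mu> Q\<close> of admissible pairs.
  Pairs are kept because the entropy of \<open>mixture \<mu> Q\<close> is expressed through its disintegration \<open>Q\<close>.
\<close>

definition admissible_pair ::
  "(real \<Rightarrow> (real \<Rightarrow> real) measure) \<Rightarrow> (real \<Rightarrow> (real \<Rightarrow> real) measure) \<Rightarrow> real measure \<Rightarrow> bool" where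
  "admissible_pair P Q \<mu> \<longleftrightarrow> (\<exists>g. tilted_laws P g Q \<and> \<mu> = tilted_marginal g)"


section \<open>Relative entropy, pressure and equilibrium states\<close>

text \<open>Note the sign: these entropies are nonpositive.\<close>

definition relative_entropy_upto ::
  "(real \<Rightarrow> (real \<Rightarrow> real) measure) \<Rightarrow> (real \<Rightarrow> (real \<Rightarrow> real) measure) \<Rightarrow> real measure \<Rightarrow> real \<Rightarrow> real" where
  "relative_entropy_upto P Q \<mu> T =
     - (LINT x|\<mu>. LINT w|Q x. ln (enn2real (RN_deriv
          (restr_to_subalg (P x) (path_filtration T))
          (restr_to_subalg (Q x) (path_filtration T)) w)))"

definition relative_entropy ::
  "(real \<Rightarrow> (real \<Rightarrow> real) measure) \<Rightarrow> (real \<Rightarrow> (real \<Rightarrow> real) measure) \<Rightarrow> real measure \<Rightarrow> real" where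
  "relative_entropy P Q \<mu> = Lim at_top (\<lambda>T. 1 / T * relative_entropy_upto P Q \<mu> T)"

definition free_energy ::
  "(real \<Rightarrow> (real \<Rightarrow> real) measure) \<Rightarrow> (real \<Rightarrow> real) \<Rightarrow>
   (real \<Rightarrow> (real \<Rightarrow> real) measure) \<Rightarrow> real measure \<Rightarrow> real" where
  "free_energy P V Q \<mu> = relative_entropy P Q \<mu> + (LINT x|\<mu>. V x)"

text \<open>The supremum is taken in the extended reals, so that its finiteness is not presupposed.\<close>

definition pressure :: "(real \<Rightarrow> (real \<Rightarrow> real) measure) \<Rightarrow> (real \<Rightarrow> real) \<Rightarrow> ereal" where
  "pressure P V = Sup {ereal (free_energy P V Q \<mu>) | Q \<mu>. admissible_pair P Q \<mu>}"

definition equilibrium_state ::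
  "(real \<Rightarrow> (real \<Rightarrow> real) measure) \<Rightarrow> (real \<Rightarrow> real) \<Rightarrow> (real \<Rightarrow> real) measure \<Rightarrow> bool" where
  "equilibrium_state P V R \<longleftrightarrow>
     (\<exists>Q \<mu>. admissible_pair P Q \<mu> \<and> R = mixture \<mu> Q \<and>
        ereal (free_energy P V Q \<mu>) = pressure P V)"

end

theory Submission
  imports Defs
begin

text \<open>
  With \<open>h = exp g\<close> and \<open>U = (g'' + g'\<^sup>2) / 2\<close> one has \<open>L h = U h\<close>, so tilting by \<open>g\<close> is Doob's
  \<open>h\<close>-transform of the Feynman--Kac semigroup of \<open>L - U\<close>. Both the tilted Brownian motion and any
  Markov process with generator \<open>L f + g' f'\<close> have one-dimensional marginals that solve, after
  division by \<open>h\<close>, the forward equation \<open>\<partial>\<^sub>t \<eta> = \<eta> \<circ> (L - U)\<close>; its solutions are unique by Duhamel's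
  formula, tested on trigonometric polynomials, and induction over cylinder sets then identifies
  the two laws. In particular the Gibbs process is the tilting by \<open>G = ln F\<close>.

  Solving the Poisson equation \<open>L \<phi> + g' \<phi>' = U - \<integral> U d\<mu>\<close> on the circle shows that the entropy rate of
  an admissible probability is \<open>\<integral> U d\<mu> = - \<integral> g'\<^sup>2 / 2 d\<mu>\<close>, without using stationarity. Since
  \<open>V = \<lambda> - (G'' + G'\<^sup>2) / 2\<close>, integration by parts turns the free energy into
  \<open>\<lambda> - \<integral> (g' - G')\<^sup>2 / 2 d\<mu>\<close>. It is at most \<open>\<lambda>\<close>, with equality only if \<open>g - G\<close> is constant, in which
  case the two tiltings coincide.
\<close>

section \<open>Functions on the circle\<close>

text \<open>\<open>markov_laws\<close> describes a process by limits as time decreases to 0 and by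
  the Markov property. Shifting such a limit to time \<open>s\<close> gives right derivatives of
  expectations, hence the forward equation; a backward equation would require transition functions
  smooth in the starting point. This is why uniqueness is proved on the dual side, against test
  functions whose heat flow is explicit. The sup-norm bound for that flow is in turn read off from
  Brownian motion, so no heat kernel appears. A tilted family is given by its densities on each
  \<open>path_filtration T\<close>; \<open>tilted_laws\<close> contains neither a Markov property
  nor measurability in the starting point. Its expectations are therefore rewritten under
  \<open>P\<close>, where both are available. Invariance of the marginal would need a proof of its
  own. Instead, the solution of the Poisson equation bounds the deviation of the expected exponent
  from linear growth by a constant independent of starting point and time, which disappears after
  division by \<open>T\<close>.\<close>

definition C0_circle :: "(real \<Rightarrow> real) \<Rightarrow> bool" where
  "C0_circle f \<longleftrightarrow> periodic1 f \<and> continuous_on UNIV f"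

lemma periodic1_add_int:
  assumes "periodic1 f"
  shows "f (x + of_int n) = f x"
proof -
  have nat: "f (y + of_nat m) = f y" for y m
  proof (induction m)
    case (Suc m)
    have "f (y + of_nat (Suc m)) = f ((y + of_nat m) + 1)"
      by (simp add: algebra_simps)
    then show ?case using Suc assms by (simp add: periodic1_def)
  qed simp
  show ?thesis
  proof (cases "n \<ge> 0")
    case True
    then show ?thesis using nat[of x "nat n"] by simp
  next
    case False
    then show ?thesis using nat[of "x + of_int n" "nat (- n)"] by simp
  qed
qed

lemma periodic1_frac:
  assumes "periodic1 f"
  shows "f (frac x) = f x"
  using periodic1_add_int[OF assms, of "frac x" "\<lfloor>x\<rfloor>"] by (simp add: frac_def)

lemma frac_in_circle: "frac x \<in> circle"
  by (simp add: frac_lt_1)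

lemma periodic1_cis_eq:
  assumes "periodic1 f" "cis (2 * pi * x) = cis (2 * pi * y)"
  shows "f x = f y"
proof -
  have "sin (2 * pi * x) = sin (2 * pi * y) \<and> cos (2 * pi * x) = cos (2 * pi * y)"
    using assms(2) by (metis cis.simps)
  then obtain n :: int where "2 * pi * x = 2 * pi * y + 2 * pi * n"
    unfolding sin_cos_eq_iff by blast
  then have "2 * pi * x = 2 * pi * (y + n)" by (simp add: algebra_simps)
  then have "x = y + of_int n" by (metis mult_cancel_left pi_neq_zero zero_neq_numeral mult_eq_0_iff)
  then show ?thesis using periodic1_add_int[OF assms(1)] by simp
qed

text \<open>Path continuity is stated through \<open>cis\<close>, since the representative in
  \<open>circle\<close> jumps at 0. Factoring \<open>f\<close> over the unit circle makes
  \<open>f\<close> of a path continuous, and also hands \<open>f\<close> to the Stone--Weierstrass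
  theorem on a compact set.\<close>

lemma C0_circle_factor:
  assumes "C0_circle f"
  obtains G where "continuous_on (sphere 0 1) G" "\<And>x. f x = G (cis (2 * pi * x))"
proof
  have per: "periodic1 f" and cont: "continuous_on UNIV f"
    using assms by (auto simp: C0_circle_def)
  define G where "G z = f (Arg z / (2 * pi))" for z
  show eq: "f x = G (cis (2 * pi * x))" for x
    unfolding G_def
    by (rule periodic1_cis_eq[OF per]) (simp add: cis_Arg)
  show "continuous_on (sphere 0 1) G"
    unfolding continuous_on_eq_continuous_within
  proof
    fix z0 :: complex assume z0: "z0 \<in> sphere 0 1"
    define x0 where "x0 = Arg z0 / (2 * pi)"
    have cis0: "cis (2 * pi * x0) = z0"
      using z0 cis_Arg[of z0] by (force simp: x0_def sgn_eq)
    \<comment> \<open>Near \<open>z0\<close>, the angle is measured from \<open>z0\<close>, away from the branch cut of \<open>Arg\<close>.\<close>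
    have G': "G z = f (x0 + Arg (z / z0) / (2 * pi))" if "z \<in> sphere 0 1" for z
      unfolding G_def
    proof (rule periodic1_cis_eq[OF per])
      have nz: "z \<noteq> 0" "z0 \<noteq> 0" using that z0 by auto
      have "cis (2 * pi * (x0 + Arg (z / z0) / (2 * pi))) = z0 * cis (Arg (z / z0))"
        by (simp add: distrib_left cis_mult[symmetric] cis0)
      also have "\<dots> = z0 * (z / z0)"
        using nz that z0 by (subst cis_Arg) (auto simp: sgn_eq norm_divide)
      finally show "cis (2 * pi * (Arg z / (2 * pi))) = cis (2 * pi * (x0 + Arg (z / z0) / (2 * pi)))"
        using nz that by (simp add: cis_Arg sgn_eq)
    qed
    have "continuous (at z0 within sphere 0 1) (\<lambda>z. f (x0 + Arg (z / z0) / (2 * pi)))"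
    proof (rule continuous_at_imp_continuous_within)
      have nz: "z0 \<noteq> 0" using z0 by auto
      have "isCont (\<lambda>z. Arg (z / z0)) z0"
        by (rule isCont_o2[where g = Arg])
          (use nz in \<open>auto intro!: continuous_intros continuous_at_Arg\<close>)
      then have "isCont (\<lambda>z. x0 + Arg (z / z0) / (2 * pi)) z0"
        by (intro continuous_intros) auto
      then show "isCont (\<lambda>z. f (x0 + Arg (z / z0) / (2 * pi))) z0"
        by (rule isCont_o2) (use cont in \<open>simp add: continuous_on_eq_continuous_at\<close>)
    qed
    then show "continuous (at z0 within sphere 0 1) G"
      by (rule continuous_transform_within[where \<delta> = 1]) (use z0 G' in auto)
  qed
qed

lemma C0_circle_bounded:
  assumes "C0_circle f"
  obtains K where "K > 0" "\<And>x. \<bar>f x\<bar> \<le> K"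
proof -
  have "compact (f ` {0..1})"
    using assms by (intro compact_continuous_image) (auto simp: C0_circle_def intro: continuous_on_subset)
  then have "bounded (f ` {0..1})" by (rule compact_imp_bounded)
  then obtain K where K: "K > 0" "\<And>x. x \<in> {0..1} \<Longrightarrow> \<bar>f x\<bar> \<le> K"
    unfolding bounded_pos by (auto simp del: atLeastAtMost_iff)
  have "\<bar>f x\<bar> \<le> K" for x
    using K(2)[of "frac x"] periodic1_frac[of f x] assms frac_in_circle[of x] by (auto simp: C0_circle_def)
  with K(1) show ?thesis by (rule that)
qed

lemma C0_circle_intros:
  "C0_circle (\<lambda>x. c)"
  "C0_circle f \<Longrightarrow> C0_circle g \<Longrightarrow> C0_circle (\<lambda>x. f x + g x)"
  "C0_circle f \<Longrightarrow> C0_circle g \<Longrightarrow> C0_circle (\<lambda>x. f x - g x)"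
  "C0_circle f \<Longrightarrow> C0_circle g \<Longrightarrow> C0_circle (\<lambda>x. f x * g x)"
  "C0_circle f \<Longrightarrow> C0_circle (\<lambda>x. - f x)"
  "C0_circle f \<Longrightarrow> C0_circle (\<lambda>x. (f x)^2)"
  "C0_circle f \<Longrightarrow> C0_circle (\<lambda>x. exp (f x))"
  "C0_circle f \<Longrightarrow> C0_circle g \<Longrightarrow> (\<And>x. g x \<noteq> 0) \<Longrightarrow> C0_circle (\<lambda>x. f x / g x)"
  by (auto simp: C0_circle_def periodic1_def intro!: continuous_intros)

lemma C0_circle_continuous_on: "C0_circle f \<Longrightarrow> continuous_on S f"
  by (auto simp: C0_circle_def intro: continuous_on_subset)

lemma C0_circle_measurable [measurable_dest]: "C0_circle f \<Longrightarrow> f \<in> borel_measurable borel"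
  by (auto simp: C0_circle_def intro: borel_measurable_continuous_onI)

lemma C2_circleI:
  assumes "periodic1 f"
    and f': "\<And>x. (f has_real_derivative f' x) (at x)"
    and f'': "\<And>x. (f' has_real_derivative f'' x) (at x)"
    and "continuous_on UNIV f''"
  shows "C2_circle f" "deriv f = f'" "deriv (deriv f) = f''"
proof -
  show 1: "deriv f = f'" using f' by (intro ext DERIV_imp_deriv)
  show 2: "deriv (deriv f) = f''" unfolding 1 using f'' by (intro ext DERIV_imp_deriv)
  show "C2_circle f"
    unfolding C2_circle_def 2 unfolding 1 using assms real_differentiable_def by blast
qed

lemma C2_circle_DERIV:
  assumes "C2_circle f"
  shows "(f has_real_derivative deriv f x) (at x)"
    and "(deriv f has_real_derivative deriv (deriv f) x) (at x)"
  using assms by (auto simp: C2_circle_def DERIV_deriv_iff_real_differentiable)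

lemma periodic1_deriv:
  assumes "periodic1 f"
  shows "periodic1 (deriv f)"
  unfolding periodic1_def
proof
  fix x :: real
  \<comment> \<open>\<open>deriv\<close> chooses a number satisfying the derivative predicate, so
    equality of the predicates at both points gives equality of the chosen values.\<close>
  have "(f has_field_derivative D) (at (x + 1)) \<longleftrightarrow> (f has_field_derivative D) (at x)" for D
    using assms DERIV_shift[of f D x 1] by (simp add: periodic1_def)
  then show "deriv f (x + 1) = deriv f x" by (simp add: deriv_def)
qed

lemma C2_circle_C0:
  assumes "C2_circle f"
  shows "C0_circle f" "C0_circle (deriv f)" "C0_circle (deriv (deriv f))"
  using assms periodic1_deriv C2_circle_DERIV[OF assms]
  by (auto simp: C0_circle_def C2_circle_def continuous_on_eq_continuous_at intro: DERIV_isCont)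

lemma C2_circle_continuous_on:
  assumes "C2_circle f"
  shows "continuous_on S f" "continuous_on S (deriv f)" "continuous_on S (deriv (deriv f))"
  using C2_circle_C0[OF assms] by (auto intro: C0_circle_continuous_on)

lemma half_laplacian_C0: "C2_circle f \<Longrightarrow> C0_circle (half_laplacian f)"
  unfolding half_laplacian_def[abs_def] by (intro C0_circle_intros C2_circle_C0)

lemma C2_circle_mult:
  assumes "C2_circle f" "C2_circle g"
  shows "C2_circle (\<lambda>x. f x * g x)"
    and "half_laplacian (\<lambda>x. f x * g x) x
      = f x * half_laplacian g x + deriv f x * deriv g x + g x * half_laplacian f x"
proof -
  have per: "periodic1 (\<lambda>x. f x * g x)"
    using assms by (simp add: C2_circle_def periodic1_def)
  note C2 = C2_circleI[of "\<lambda>x. f x * g x" "\<lambda>x. deriv f x * g x + deriv g x * f x"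
      "\<lambda>x. deriv (deriv f) x * g x + deriv g x * deriv f x + (deriv (deriv g) x * f x + deriv f x * deriv g x)"]
  have *: "C2_circle (\<lambda>x. f x * g x)" "deriv (deriv (\<lambda>x. f x * g x)) =
    (\<lambda>x. deriv (deriv f) x * g x + deriv g x * deriv f x + (deriv (deriv g) x * f x + deriv f x * deriv g x))"
    by (rule C2; (rule per | intro DERIV_add DERIV_mult continuous_intros
          C2_circle_DERIV[OF assms(1)] C2_circle_DERIV[OF assms(2)]
          C2_circle_continuous_on[OF assms(1)] C2_circle_continuous_on[OF assms(2)]))+
  show "C2_circle (\<lambda>x. f x * g x)" by fact
  show "half_laplacian (\<lambda>x. f x * g x) x
      = f x * half_laplacian g x + deriv f x * deriv g x + g x * half_laplacian f x"
    unfolding half_laplacian_def *(2) by (simp add: algebra_simps)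
qed

lemma C2_circle_exp:
  assumes "C2_circle g"
  shows "C2_circle (\<lambda>x. exp (g x))" "deriv (\<lambda>x. exp (g x)) x = exp (g x) * deriv g x"
    "half_laplacian (\<lambda>x. exp (g x)) x = exp (g x) * ((deriv (deriv g) x + (deriv g x)\<^sup>2) / 2)"
proof -
  have per: "periodic1 (\<lambda>x. exp (g x))"
    using assms by (simp add: C2_circle_def periodic1_def)
  note C2 = C2_circleI[of "\<lambda>x. exp (g x)" "\<lambda>x. exp (g x) * deriv g x"
      "\<lambda>x. exp (g x) * deriv g x * deriv g x + deriv (deriv g) x * exp (g x)"]
  have *: "C2_circle (\<lambda>x. exp (g x))" "deriv (\<lambda>x. exp (g x)) = (\<lambda>x. exp (g x) * deriv g x)"
    "deriv (deriv (\<lambda>x. exp (g x)))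
       = (\<lambda>x. exp (g x) * deriv g x * deriv g x + deriv (deriv g) x * exp (g x))"
    by (rule C2; use per in \<open>auto intro!: derivative_intros continuous_intros
          C2_circle_DERIV[OF assms] DERIV_mult DERIV_fun_exp C2_circle_continuous_on[OF assms]\<close>)+
  show "C2_circle (\<lambda>x. exp (g x))" "deriv (\<lambda>x. exp (g x)) x = exp (g x) * deriv g x"
    "half_laplacian (\<lambda>x. exp (g x)) x = exp (g x) * ((deriv (deriv g) x + (deriv g x)\<^sup>2) / 2)"
    using * by (auto simp: half_laplacian_def algebra_simps power2_eq_square)
qed

lemma C2_circle_ln:
  assumes "C2_circle F" "\<And>x. F x > 0"
  shows "C2_circle (\<lambda>x. ln (F x))"
proof (rule C2_circleI(1)[of "\<lambda>x. ln (F x)" "\<lambda>x. deriv F x / F x"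
      "\<lambda>x. (deriv (deriv F) x * F x - deriv F x * deriv F x) / (F x * F x)"])
  have nz: "F x \<noteq> 0" for x using assms(2)[of x] by simp
  show "periodic1 (\<lambda>x. ln (F x))" using assms by (auto simp: C2_circle_def periodic1_def)
  show "((\<lambda>x. ln (F x)) has_real_derivative deriv F x / F x) (at x)" for x
    using C2_circle_DERIV(1)[OF assms(1), of x] assms(2)[of x]
    by (auto intro!: derivative_eq_intros)
  show "((\<lambda>x. deriv F x / F x) has_real_derivative
      (deriv (deriv F) x * F x - deriv F x * deriv F x) / (F x * F x)) (at x)" for x
    using C2_circle_DERIV[OF assms(1), of x] nz by (intro DERIV_divide)
  show "continuous_on UNIV (\<lambda>x. (deriv (deriv F) x * F x - deriv F x * deriv F x) / (F x * F x))"
    using nz by (auto intro!: continuous_intros C2_circle_continuous_on[OF assms(1)])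
qed


section \<open>The heat flow on trigonometric polynomials\<close>

text \<open>Real trigonometric polynomials together with their evolution under the semigroup of
  \<open>half_laplacian\<close>; the decay rate is half the square of the frequency
  \<open>2 * pi * k\<close>. Keeping time inside the predicate gives an explicit heat flow on a
  dense set of functions.\<close>

inductive heat_poly :: "(real \<Rightarrow> real \<Rightarrow> real) \<Rightarrow> bool" where
  cos: "heat_poly (\<lambda>t x. exp (- (2 * pi\<^sup>2 * (real_of_int k)\<^sup>2) * t) * cos (2 * pi * of_int k * x))"
| sin: "heat_poly (\<lambda>t x. exp (- (2 * pi\<^sup>2 * (real_of_int k)\<^sup>2) * t) * sin (2 * pi * of_int k * x))"
| add: "heat_poly u \<Longrightarrow> heat_poly v \<Longrightarrow> heat_poly (\<lambda>t x. u t x + v t x)"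
| scale: "heat_poly u \<Longrightarrow> heat_poly (\<lambda>t x. c * u t x)"

lemma C2_circle_cos_sin:
  fixes k :: int
  defines "a \<equiv> 2 * pi * of_int k"
  shows "C2_circle (\<lambda>x. cos (a * x))" "C2_circle (\<lambda>x. sin (a * x))"
    "half_laplacian (\<lambda>x. cos (a * x)) = (\<lambda>x. - (2 * pi\<^sup>2 * (real_of_int k)\<^sup>2) * cos (a * x))"
    "half_laplacian (\<lambda>x. sin (a * x)) = (\<lambda>x. - (2 * pi\<^sup>2 * (real_of_int k)\<^sup>2) * sin (a * x))"
proof -
  have per: "periodic1 (\<lambda>x. cos (a * x))" "periodic1 (\<lambda>x. sin (a * x))"
    unfolding periodic1_def a_def
    using sin_cos_eq_iff[of "2 * pi * of_int k * (x + 1)" "2 * pi * of_int k * x" for x]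
    by (auto simp: algebra_simps)
  note C = C2_circleI[of "\<lambda>x. cos (a * x)" "\<lambda>x. - a * sin (a * x)" "\<lambda>x. - a * a * cos (a * x)"]
  have c: "C2_circle (\<lambda>x. cos (a * x))" "deriv (deriv (\<lambda>x. cos (a * x))) = (\<lambda>x. - a * a * cos (a * x))"
    by (rule C; use per in \<open>auto intro!: derivative_eq_intros continuous_intros\<close>)+
  note S = C2_circleI[of "\<lambda>x. sin (a * x)" "\<lambda>x. a * cos (a * x)" "\<lambda>x. - a * a * sin (a * x)"]
  have s: "C2_circle (\<lambda>x. sin (a * x))" "deriv (deriv (\<lambda>x. sin (a * x))) = (\<lambda>x. - a * a * sin (a * x))"
    by (rule S; use per in \<open>auto intro!: derivative_eq_intros continuous_intros\<close>)+
  show "C2_circle (\<lambda>x. cos (a * x))" "C2_circle (\<lambda>x. sin (a * x))"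
    "half_laplacian (\<lambda>x. cos (a * x)) = (\<lambda>x. - (2 * pi\<^sup>2 * (real_of_int k)\<^sup>2) * cos (a * x))"
    "half_laplacian (\<lambda>x. sin (a * x)) = (\<lambda>x. - (2 * pi\<^sup>2 * (real_of_int k)\<^sup>2) * sin (a * x))"
    using c s by (auto simp: half_laplacian_def[abs_def] a_def power2_eq_square)
qed

lemma heat_poly_C0: "heat_poly u \<Longrightarrow> C0_circle (u t)"
  by (induction rule: heat_poly.induct)
    (auto intro!: C0_circle_intros C2_circle_C0(1)[OF C2_circle_cos_sin(1)] C2_circle_C0(1)[OF C2_circle_cos_sin(2)])

text \<open>A product of two heat solutions is in general no heat solution, so only the initial
  values are multiplied and \<open>w\<close> is a new evolution started from the product. The
  product-to-sum formulas keep the frequencies integral.\<close>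

lemma heat_poly_mult:
  assumes "heat_poly u" "heat_poly v"
  shows "\<exists>w. heat_poly w \<and> (\<forall>x. w 0 x = u 0 x * v 0 x)"
proof -
  define T where "T f \<longleftrightarrow> (\<exists>w. heat_poly w \<and> (\<forall>x. w 0 x = f x))" for f
  have T_add: "T (\<lambda>x. f x + g x)" if "T f" "T g" for f g
    using that heat_poly.add unfolding T_def by (metis (no_types, lifting))
  have T_scale: "T (\<lambda>x. c * f x)" if "T f" for f c
    using that heat_poly.scale unfolding T_def by (metis (no_types, lifting))
  have T_cos: "T (\<lambda>x. cos (2 * pi * of_int k * x))" and T_sin: "T (\<lambda>x. sin (2 * pi * of_int k * x))" for k
    unfolding T_def using heat_poly.cos[of k] heat_poly.sin[of k] by force+
  have cc: "T (\<lambda>x. cos (2 * pi * of_int k * x) * cos (2 * pi * of_int l * x))" for k l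
    using T_scale[OF T_add[OF T_cos[of "k - l"] T_cos[of "k + l"]], of "1/2"]
    by (simp add: cos_times_cos algebra_simps add_divide_distrib)
  have ss: "T (\<lambda>x. sin (2 * pi * of_int k * x) * sin (2 * pi * of_int l * x))" for k l
    using T_scale[OF T_add[OF T_cos[of "k - l"] T_scale[OF T_cos[of "k + l"], of "-1"]], of "1/2"]
    by (simp add: sin_times_sin algebra_simps diff_divide_distrib)
  have sc: "T (\<lambda>x. sin (2 * pi * of_int k * x) * cos (2 * pi * of_int l * x))" for k l
  proof -
    have "sin (2 * pi * of_int k * x) * cos (2 * pi * of_int l * x)
      = 1/2 * (sin (2 * pi * of_int (k + l) * x) + sin (2 * pi * of_int (k - l) * x))" for x
      unfolding sin_times_cos by (simp add: algebra_simps)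
    then show ?thesis using T_scale[OF T_add[OF T_sin T_sin]] by (simp only:)
  qed
  have cs: "T (\<lambda>x. cos (2 * pi * of_int l * x) * sin (2 * pi * of_int k * x))" for k l
    using sc[of k l] by (simp only: mult.commute[of "cos _"])
  have cv: "T (\<lambda>x. cos (2 * pi * of_int k * x) * v 0 x)" for k
    using assms(2)
  proof induction
    case (add u v)
    then show ?case using T_add by (fastforce simp: distrib_left)
  next
    case (scale u c)
    then show ?case using T_scale[OF scale.IH, of c] by (simp add: mult.left_commute)
  qed (use cc cs in auto)
  have sv: "T (\<lambda>x. sin (2 * pi * of_int k * x) * v 0 x)" for k
    using assms(2)
  proof induction
    case (add u v)
    then show ?case using T_add by (fastforce simp: distrib_left)
  next
    case (scale u c)
    then show ?case using T_scale[OF scale.IH, of c] by (simp add: mult.left_commute)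
  qed (use sc ss in auto)
  have "T (\<lambda>x. u 0 x * v 0 x)"
    using assms(1)
  proof induction
    case (add u v)
    then show ?case using T_add by (fastforce simp: distrib_right)
  next
    case (scale u c)
    then show ?case using T_scale[OF scale.IH, of c] by (simp add: mult.assoc)
  qed (use cv sv in auto)
  then show ?thesis unfolding T_def by blast
qed

text \<open>A real polynomial function restricted to the unit circle is a polynomial in
  \<open>cos (2 * pi * x)\<close> and \<open>sin (2 * pi * x)\<close>, hence the initial value of
  some heat polynomial.\<close>

lemma heat_poly_dense:
  assumes "C0_circle f" "d > 0"
  obtains u where "heat_poly u" "\<And>x. \<bar>f x - u 0 x\<bar> < d"
proof -
  obtain G where G: "continuous_on (sphere 0 1) G" "\<And>x. f x = G (cis (2 * pi * x))"
    using C0_circle_factor[OF assms(1)] by blast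
  obtain p where p: "real_polynomial_function p" "\<And>z. z \<in> sphere 0 1 \<Longrightarrow> \<bar>G z - p z\<bar> < d"
    using Stone_Weierstrass_real_polynomial_function[OF compact_sphere G(1) assms(2)] by blast
  from p(1) have "\<exists>u. heat_poly u \<and> (\<forall>x. u 0 x = p (cis (2 * pi * x)))"
  proof induction
    case (linear h)
    interpret bounded_linear h by fact
    \<comment> \<open>\<open>h\<close> is linear over the reals, so its values at \<open>1\<close>
      and \<open>\<i>\<close> determine it.\<close>
    have "h (cis (2 * pi * x)) = h 1 * cos (2 * pi * of_int 1 * x) + h \<i> * sin (2 * pi * of_int 1 * x)" for x
    proof -
      have "cis (2 * pi * x) = cos (2 * pi * x) *\<^sub>R 1 + sin (2 * pi * x) *\<^sub>R \<i>"
        by (simp add: complex_eq_iff)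
      then show ?thesis by (simp add: add scale)
    qed
    then show ?case
      by (intro exI[of _ "\<lambda>t x. h 1 * (exp (- (2 * pi\<^sup>2 * (real_of_int 1)\<^sup>2) * t) * cos (2 * pi * of_int 1 * x))
        + h \<i> * (exp (- (2 * pi\<^sup>2 * (real_of_int 1)\<^sup>2) * t) * sin (2 * pi * of_int 1 * x))"] conjI
          heat_poly.intros) auto
  next
    case (const c)
    show ?case using heat_poly.scale[OF heat_poly.cos[of 0], of c] by (intro exI conjI) auto
  next
    case (add f g)
    then show ?case using heat_poly.add by (metis (no_types, lifting))
  next
    case (mult f g)
    then show ?case using heat_poly_mult by metis
  qed
  then obtain u where "heat_poly u" "\<forall>x. u 0 x = p (cis (2 * pi * x))" by blast
  then show ?thesis using that p(2) G(2) by simp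
qed

section \<open>One-sided derivatives\<close>

text \<open>Generators are limits from the right, so expectations come with right derivatives only
  and the mean value theorem does not apply. If \<open>c\<close> rose, subtract half of its mean
  slope: at the last time where the remainder is nonpositive, its right derivative is negative, so
  it is still nonpositive slightly later.\<close>

lemma right_derivative_nonpos_imp_le:
  fixes c :: "real \<Rightarrow> real"
  assumes "a \<le> b" and cont: "continuous_on {a..b} c"
    and deriv: "\<And>s. a \<le> s \<Longrightarrow> s < b \<Longrightarrow> (c has_real_derivative c' s) (at_right s)"
    and nonpos: "\<And>s. a \<le> s \<Longrightarrow> s < b \<Longrightarrow> c' s \<le> 0"
  shows "c b \<le> c a"
proof (rule ccontr)
  assume "\<not> c b \<le> c a"
  then have "a < b" using \<open>a \<le> b\<close> by (cases "a = b") auto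
  define e where "e = (c b - c a) / (2 * (b - a))"
  have "e > 0" using \<open>a < b\<close> \<open>\<not> c b \<le> c a\<close> by (simp add: e_def)
  define d where "d s = c s - c a - e * (s - a)" for s
  have "d b = (c b - c a) / 2" using \<open>a < b\<close> by (simp add: d_def e_def field_simps)
  then have "d b > 0" using \<open>\<not> c b \<le> c a\<close> by simp
  have contd: "continuous_on {a..b} d" unfolding d_def by (intro continuous_intros cont)
  define S where "S = {s \<in> {a..b}. d s \<le> 0}"
  have "closed S" unfolding S_def
    using continuous_closed_preimage[OF contd, of "{..0}"] by (simp add: vimage_def Int_def)
  moreover have "S \<subseteq> {a..b}" by (auto simp: S_def)
  ultimately have "compact S" by (metis bounded_closed_interval bounded_subset compact_eq_bounded_closed)
  moreover have "S \<noteq> {}" using \<open>a < b\<close> by (auto simp: S_def d_def intro!: exI[of _ a])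
  ultimately obtain m where m: "m \<in> S" "\<And>s. s \<in> S \<Longrightarrow> s \<le> m"
    using compact_attains_sup[of S] by auto
  have "m < b" using m(1) \<open>d b > 0\<close> by (cases "m = b") (auto simp: S_def)
  have "a \<le> m" using m(1) by (auto simp: S_def)
  have "(d has_real_derivative c' m - e) (at_right m)"
    unfolding d_def using deriv[OF \<open>a \<le> m\<close> \<open>m < b\<close>] by (auto intro!: derivative_eq_intros)
  moreover have "c' m - e < 0" using nonpos[OF \<open>a \<le> m\<close> \<open>m < b\<close>] \<open>e > 0\<close> by simp
  ultimately obtain r where r: "r > 0" "\<And>h. h > 0 \<Longrightarrow> m + h \<in> {m<..} \<Longrightarrow> h < r \<Longrightarrow> d m > d (m + h)"
    using has_real_derivative_neg_dec_right by blast
  define h where "h = min (r / 2) (b - m)"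
  have h: "h > 0" "h < r" "m + h \<le> b" using r(1) \<open>m < b\<close> by (auto simp: h_def min_def)
  then have "d (m + h) \<le> 0" using r(2)[of h] m(1) by (auto simp: S_def)
  then have "m + h \<in> S" using h \<open>a \<le> m\<close> by (auto simp: S_def)
  then show False using m(2)[of "m + h"] h by simp
qed

text \<open>A mean value inequality in which the integral of \<open>d'\<close> enters through its
  antiderivative \<open>d\<close>, so that a one-sided derivative never has to be
  integrated.\<close>

lemma right_derivative_abs_le:
  fixes c d :: "real \<Rightarrow> real"
  assumes "a \<le> b" "continuous_on {a..b} c" "continuous_on {a..b} d"
    and c: "\<And>s. a \<le> s \<Longrightarrow> s < b \<Longrightarrow> (c has_real_derivative c' s) (at_right s)"
    and d: "\<And>s. a \<le> s \<Longrightarrow> s < b \<Longrightarrow> (d has_real_derivative d' s) (at_right s)"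
    and le: "\<And>s. a \<le> s \<Longrightarrow> s < b \<Longrightarrow> \<bar>c' s\<bar> \<le> d' s"
  shows "\<bar>c b - c a\<bar> \<le> d b - d a"
proof -
  have "c b - d b \<le> c a - d a"
    by (rule right_derivative_nonpos_imp_le[where c = "\<lambda>s. c s - d s" and c' = "\<lambda>s. c' s - d' s"])
      (use assms in \<open>auto intro!: continuous_intros derivative_intros simp: abs_le_iff\<close>)
  moreover have "- c b - d b \<le> - c a - d a"
  proof (rule right_derivative_nonpos_imp_le[where c = "\<lambda>s. - c s - d s" and c' = "\<lambda>s. - c' s - d' s"])
    show "- c' s - d' s \<le> 0" if "a \<le> s" "s < b" for s using le[OF that] by linarith
  qed (use assms in \<open>auto intro!: continuous_intros derivative_intros\<close>)
  ultimately show ?thesis by linarith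
qed

text \<open>Rewriting rules for the functionals below hold only from the initial time on; a right
  derivative sees no earlier times.\<close>

lemma DERIV_at_right_cong:
  fixes f g :: "real \<Rightarrow> real"
  assumes "(f has_real_derivative D) (at_right s)" "\<And>r. s \<le> r \<Longrightarrow> f r = g r"
  shows "(g has_real_derivative D) (at_right s)"
proof -
  have "eventually (\<lambda>r. f r = g r) (at_right s)"
    using eventually_at_right_less[of s] by eventually_elim (simp add: assms(2))
  then show ?thesis
    using has_field_derivative_cong_eventually assms by (metis order_refl)
qed

section \<open>Uniqueness for the forward equation\<close>

text \<open>Moving \<open>s\<close> inside \<open>u (t - s)\<close> contributes minus the Laplacian
  term, which cancels the one in the forward equation and leaves the perturbation \<open>U\<close>.
  On one mode, \<open>u (t - s)\<close> is a scalar factor times a fixed eigenfunction, so the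
  product rule for two real functions of \<open>s\<close> suffices; linear combinations
  follow.\<close>

lemma heat_poly_duhamel:
  fixes \<eta> :: "real \<Rightarrow> (real \<Rightarrow> real) \<Rightarrow> real"
  assumes "heat_poly u"
    and add: "\<And>s f g. s \<ge> a \<Longrightarrow> C0_circle f \<Longrightarrow> C0_circle g \<Longrightarrow>
      \<eta> s (\<lambda>x. f x + g x) = \<eta> s f + \<eta> s g"
    and scale: "\<And>s f c. s \<ge> a \<Longrightarrow> C0_circle f \<Longrightarrow> \<eta> s (\<lambda>x. c * f x) = c * \<eta> s f"
    and cont: "\<And>f. C2_circle f \<Longrightarrow> continuous_on {a..} (\<lambda>s. \<eta> s f)"
    and deriv: "\<And>f s. C2_circle f \<Longrightarrow> s \<ge> a \<Longrightarrow>
      ((\<lambda>s. \<eta> s f) has_real_derivative \<eta> s (\<lambda>x. half_laplacian f x - U x * f x)) (at_right s)"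
    and U: "C0_circle U"
  shows "continuous_on {a..} (\<lambda>s. \<eta> s (u (t - s))) \<and>
    (\<forall>s\<ge>a. ((\<lambda>s. \<eta> s (u (t - s))) has_real_derivative - \<eta> s (\<lambda>x. U x * u (t - s) x)) (at_right s))"
proof -
  have mode: "continuous_on {a..} (\<lambda>s. \<eta> s (\<lambda>x. exp (- l * (t - s)) * f x)) \<and>
    (\<forall>s\<ge>a. ((\<lambda>s. \<eta> s (\<lambda>x. exp (- l * (t - s)) * f x))
      has_real_derivative - \<eta> s (\<lambda>x. U x * (exp (- l * (t - s)) * f x))) (at_right s))"
    if f: "C2_circle f" "half_laplacian f = (\<lambda>x. - l * f x)" for f l
  proof
    note C0 = C2_circle_C0(1)[OF f(1)]
    have "continuous_on {a..} (\<lambda>s. exp (- l * (t - s)) * \<eta> s f)"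
      by (intro continuous_intros cont f)
    then show "continuous_on {a..} (\<lambda>s. \<eta> s (\<lambda>x. exp (- l * (t - s)) * f x))"
      by (rule continuous_on_eq) (simp add: scale C0)
    show "\<forall>s\<ge>a. ((\<lambda>s. \<eta> s (\<lambda>x. exp (- l * (t - s)) * f x))
      has_real_derivative - \<eta> s (\<lambda>x. U x * (exp (- l * (t - s)) * f x))) (at_right s)"
    proof (intro allI impI)
      fix s assume s: "a \<le> s"
      have "\<eta> s (\<lambda>x. half_laplacian f x - U x * f x) = \<eta> s (\<lambda>x. - l * f x + -1 * (U x * f x))"
        by (simp add: f(2))
      also have "\<dots> = - l * \<eta> s f + -1 * \<eta> s (\<lambda>x. U x * f x)"
        using s by (simp only: add scale C0 U C0_circle_intros)
      finally have e: "\<eta> s (\<lambda>x. half_laplacian f x - U x * f x) = - l * \<eta> s f - \<eta> s (\<lambda>x. U x * f x)"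
        by simp
      have "((\<lambda>s. exp (- l * (t - s)) * \<eta> s f) has_real_derivative
        - (exp (- l * (t - s)) * \<eta> s (\<lambda>x. U x * f x))) (at_right s)"
        using deriv[OF f(1) s] unfolding e
        by (auto intro!: derivative_eq_intros simp: algebra_simps)
      also have "exp (- l * (t - s)) * \<eta> s (\<lambda>x. U x * f x) = \<eta> s (\<lambda>x. exp (- l * (t - s)) * (U x * f x))"
        using s by (simp only: scale C0 U C0_circle_intros)
      also have "(\<lambda>x. exp (- l * (t - s)) * (U x * f x)) = (\<lambda>x. U x * (exp (- l * (t - s)) * f x))"
        by (simp add: ac_simps)
      finally show "((\<lambda>s. \<eta> s (\<lambda>x. exp (- l * (t - s)) * f x))
        has_real_derivative - \<eta> s (\<lambda>x. U x * (exp (- l * (t - s)) * f x))) (at_right s)"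
        by (rule DERIV_at_right_cong)
          (use s in \<open>auto simp: scale C0\<close>)
    qed
  qed
  show ?thesis
    using assms(1)
  proof induction
    case (cos k)
    show ?case using C2_circle_cos_sin(1)[of k] C2_circle_cos_sin(3)[of k] by (rule mode)
  next
    case (sin k)
    show ?case using C2_circle_cos_sin(2)[of k] C2_circle_cos_sin(4)[of k] by (rule mode)
  next
    case (add u v)
    note C0 = heat_poly_C0[OF add.hyps(1)] heat_poly_C0[OF add.hyps(2)]
    have e: "\<eta> s (\<lambda>x. u (t - s) x + v (t - s) x) = \<eta> s (u (t - s)) + \<eta> s (v (t - s))" if "a \<le> s" for s
      using that by (simp add: assms(2) C0)
    show ?case
    proof (intro conjI allI impI)
      have "continuous_on {a..} (\<lambda>s. \<eta> s (u (t - s)) + \<eta> s (v (t - s)))"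
        using add.IH by (intro continuous_intros) auto
      then show "continuous_on {a..} (\<lambda>s. \<eta> s (\<lambda>x. u (t - s) x + v (t - s) x))"
        by (rule continuous_on_eq) (simp add: e)
      fix s assume s: "a \<le> s"
      have "((\<lambda>s. \<eta> s (u (t - s)) + \<eta> s (v (t - s))) has_real_derivative
        - \<eta> s (\<lambda>x. U x * u (t - s) x) + - \<eta> s (\<lambda>x. U x * v (t - s) x)) (at_right s)"
        using add.IH s by (intro derivative_intros) auto
      also have "- \<eta> s (\<lambda>x. U x * u (t - s) x) + - \<eta> s (\<lambda>x. U x * v (t - s) x)
        = - \<eta> s (\<lambda>x. U x * u (t - s) x + U x * v (t - s) x)"
        using s by (simp add: assms(2) C0 U C0_circle_intros)
      finally show "((\<lambda>s. \<eta> s (\<lambda>x. u (t - s) x + v (t - s) x)) has_real_derivative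
        - \<eta> s (\<lambda>x. U x * (u (t - s) x + v (t - s) x))) (at_right s)"
        unfolding distrib_left
        by (rule DERIV_at_right_cong) (use s in \<open>auto simp: e\<close>)
    qed
  next
    case (scale u c)
    note C0 = heat_poly_C0[OF scale.hyps(1)]
    have e: "\<eta> s (\<lambda>x. c * u (t - s) x) = c * \<eta> s (u (t - s))" if "a \<le> s" for s
      using that by (simp add: assms(3) C0)
    show ?case
    proof (intro conjI allI impI)
      have "continuous_on {a..} (\<lambda>s. c * \<eta> s (u (t - s)))"
        using scale.IH by (intro continuous_intros) auto
      then show "continuous_on {a..} (\<lambda>s. \<eta> s (\<lambda>x. c * u (t - s) x))"
        by (rule continuous_on_eq) (simp add: e)
      fix s assume s: "a \<le> s"
      have "((\<lambda>s. c * \<eta> s (u (t - s))) has_real_derivative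
        c * - \<eta> s (\<lambda>x. U x * u (t - s) x)) (at_right s)"
        using scale.IH s by (intro DERIV_cmult) auto
      also have "c * - \<eta> s (\<lambda>x. U x * u (t - s) x) = - \<eta> s (\<lambda>x. c * (U x * u (t - s) x))"
        using s by (simp add: assms(3) C0 U C0_circle_intros)
      finally show "((\<lambda>s. \<eta> s (\<lambda>x. c * u (t - s) x)) has_real_derivative
        - \<eta> s (\<lambda>x. U x * (c * u (t - s) x))) (at_right s)"
        unfolding mult.left_commute[of "U _"]
        by (rule DERIV_at_right_cong) (use s in \<open>auto simp: e\<close>)
    qed
  qed
qed

lemma le_of_le_add_mult:
  fixes x y c :: real
  assumes "c \<ge> 0" "\<And>d. d > 0 \<Longrightarrow> x \<le> y + d * c"
  shows "x \<le> y"
proof (rule field_le_epsilon)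
  fix e :: real assume "e > 0"
  \<comment> \<open>Dividing by \<open>c + 1\<close> rather than \<open>c\<close> covers
    \<open>c = 0\<close>.\<close>
  have "x \<le> y + e / (c + 1) * c" using assms(1) assms(2)[of "e / (c + 1)"] \<open>e > 0\<close> by simp
  also have "e / (c + 1) * c \<le> e" using assms(1) \<open>e > 0\<close> by (simp add: field_simps)
  finally show "x \<le> y + e" by simp
qed

text \<open>
  Duhamel's formula for the perturbation \<open>U\<close> of the heat flow gives, by iteration,
  \<open>\<bar>\<eta> t f\<bar> \<le> C \<parallel>f\<parallel> (K (t - a))\<^sup>n / n!\<close> for all \<open>n\<close>.
\<close>

lemma forward_equation_unique:
  fixes \<eta> :: "real \<Rightarrow> (real \<Rightarrow> real) \<Rightarrow> real"
  assumes contraction: "\<And>u t M x. heat_poly u \<Longrightarrow> t \<ge> 0 \<Longrightarrow> (\<And>x. \<bar>u 0 x\<bar> \<le> M) \<Longrightarrow> \<bar>u t x\<bar> \<le> M"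
    and add: "\<And>s f g. s \<ge> a \<Longrightarrow> C0_circle f \<Longrightarrow> C0_circle g \<Longrightarrow>
      \<eta> s (\<lambda>x. f x + g x) = \<eta> s f + \<eta> s g"
    and scale: "\<And>s f c. s \<ge> a \<Longrightarrow> C0_circle f \<Longrightarrow> \<eta> s (\<lambda>x. c * f x) = c * \<eta> s f"
    and bound: "\<And>s f M. a \<le> s \<Longrightarrow> s \<le> b \<Longrightarrow> C0_circle f \<Longrightarrow>
      (\<And>x. \<bar>f x\<bar> \<le> M) \<Longrightarrow> \<bar>\<eta> s f\<bar> \<le> C * M"
    and cont: "\<And>f. C2_circle f \<Longrightarrow> continuous_on {a..} (\<lambda>s. \<eta> s f)"
    and deriv: "\<And>f s. C2_circle f \<Longrightarrow> s \<ge> a \<Longrightarrow>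
      ((\<lambda>s. \<eta> s f) has_real_derivative \<eta> s (\<lambda>x. half_laplacian f x - U x * f x)) (at_right s)"
    and U: "C0_circle U"
    and init: "\<And>f. C0_circle f \<Longrightarrow> \<eta> a f = 0"
    and "a \<le> t" "t \<le> b" "C0_circle f"
  shows "\<eta> t f = 0"
proof -
  obtain K where K: "K > 0" "\<And>x. \<bar>U x\<bar> \<le> K" using C0_circle_bounded[OF U] by blast
  have "\<bar>\<eta> a (\<lambda>x. 1)\<bar> \<le> C * 1" by (rule bound) (use assms in \<open>auto intro: C0_circle_intros\<close>)
  then have "C \<ge> 0" by linarith
  \<comment> \<open>\<open>f\<close> and \<open>M\<close> vary in the induction because Duhamel's
    formula applies the previous bound to \<open>U\<close> times a heat polynomial, with
    \<open>K * N\<close> as the new sup bound.\<close>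
  have est: "\<bar>\<eta> t f\<bar> \<le> C * M * ((K * (t - a)) ^ n / fact n)"
    if "a \<le> t" "t \<le> b" "C0_circle f" "\<And>x. \<bar>f x\<bar> \<le> M" for t f M n
    using that
  proof (induction n arbitrary: t f M)
    case 0
    then show ?case using bound by simp
  next
    case (Suc n)
    define q where "q = (K * (t - a)) ^ Suc n / fact (Suc n)"
    have "q \<ge> 0" using K Suc.prems by (simp add: q_def)
    \<comment> \<open>Heat polynomials come first, since their flow is explicit. By
      \<open>contraction\<close>, \<open>u (t - s)\<close> obeys the same bound \<open>N\<close> as
      \<open>u 0\<close>, so each round gains only the factor \<open>K\<close> and one time
      integration.\<close>
    have poly: "\<bar>\<eta> t (u 0)\<bar> \<le> C * N * q" if u: "heat_poly u" "\<And>x. \<bar>u 0 x\<bar> \<le> N" for u N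
    proof -
      have D: "continuous_on {a..} (\<lambda>s. \<eta> s (u (t - s))) \<and>
        (\<forall>s\<ge>a. ((\<lambda>s. \<eta> s (u (t - s))) has_real_derivative - \<eta> s (\<lambda>x. U x * u (t - s) x)) (at_right s))"
        by (rule heat_poly_duhamel[OF u(1)]) (rule add scale cont deriv U; assumption)+
      \<comment> \<open>The comparison function is the antiderivative in \<open>s\<close> of the
        induction bound; it vanishes at \<open>a\<close>, and so does
        \<open>\<eta> a\<close>.\<close>
      have "\<bar>\<eta> t (u (t - t)) - \<eta> a (u (t - a))\<bar>
        \<le> C * N * ((K * (t - a)) ^ Suc n / fact (Suc n)) - C * N * ((K * (a - a)) ^ Suc n / fact (Suc n))"
      proof (rule right_derivative_abs_le[where c' = "\<lambda>s. - \<eta> s (\<lambda>x. U x * u (t - s) x)"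
            and d' = "\<lambda>s. C * (K * N) * ((K * (s - a)) ^ n / fact n)"])
        show "continuous_on {a..t} (\<lambda>s. \<eta> s (u (t - s)))"
          by (rule continuous_on_subset[OF D[THEN conjunct1]]) auto
        show "continuous_on {a..t} (\<lambda>s. C * N * ((K * (s - a)) ^ Suc n / fact (Suc n)))"
          by (intro continuous_intros) auto
        fix s assume s: "a \<le> s" "s < t"
        show "((\<lambda>s. \<eta> s (u (t - s))) has_real_derivative - \<eta> s (\<lambda>x. U x * u (t - s) x)) (at_right s)"
          using D s by blast
        show "((\<lambda>s. C * N * ((K * (s - a)) ^ Suc n / fact (Suc n))) has_real_derivative
          C * (K * N) * ((K * (s - a)) ^ n / fact n)) (at_right s)"
        proof -
          have "((\<lambda>s. C * N * ((K * (s - a)) ^ Suc n / fact (Suc n))) has_real_derivative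
            C * N * (of_nat (Suc n) * (K * (s - a)) ^ n * K / fact (Suc n))) (at_right s)"
            by (auto intro!: derivative_eq_intros simp del: power_Suc fact_Suc of_nat_Suc)
          also have "of_nat (Suc n) * (K * (s - a)) ^ n * K / fact (Suc n) = (K * (s - a)) ^ n * K / fact n"
            by (simp del: of_nat_Suc add: mult.assoc)
          finally show ?thesis by (simp add: ac_simps)
        qed
        have "\<bar>\<eta> s (\<lambda>x. U x * u (t - s) x)\<bar> \<le> C * (K * N) * ((K * (s - a)) ^ n / fact n)"
        proof (rule Suc.IH)
          show "C0_circle (\<lambda>x. U x * u (t - s) x)"
            by (intro C0_circle_intros U heat_poly_C0 u)
          have "\<bar>u (t - s) x\<bar> \<le> N" for x
            by (rule contraction) (use u s in auto)
          then show "\<bar>U x * u (t - s) x\<bar> \<le> K * N" for x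
            unfolding abs_mult using K by (intro mult_mono) (auto intro: order_less_imp_le)
        qed (use s Suc.prems(2) in auto)
        then show "\<bar>- \<eta> s (\<lambda>x. U x * u (t - s) x)\<bar> \<le> C * (K * N) * ((K * (s - a)) ^ n / fact n)"
          by simp
      qed (use Suc.prems in simp)
      then show ?thesis
        by (simp add: init heat_poly_C0[OF u(1)] q_def)
    qed
    \<comment> \<open>Approximating \<open>f\<close> within \<open>d\<close> costs
      \<open>C * d\<close> for the remainder and \<open>C * d * q\<close> for the larger sup bound
      \<open>M + d\<close> of the approximant.\<close>
    have "\<bar>\<eta> t f\<bar> \<le> C * M * q + d * (C * (1 + q))" if "d > 0" for d
    proof -
      obtain u where u: "heat_poly u" "\<And>x. \<bar>f x - u 0 x\<bar> < d"
        using heat_poly_dense[OF Suc.prems(3) \<open>d > 0\<close>] by blast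
      have C0: "C0_circle (\<lambda>x. f x - u 0 x)" "C0_circle (u 0)"
        by (intro C0_circle_intros Suc.prems heat_poly_C0 u)+
      have "\<eta> t f = \<eta> t (\<lambda>x. (f x - u 0 x) + u 0 x)" by simp
      also have "\<dots> = \<eta> t (\<lambda>x. f x - u 0 x) + \<eta> t (u 0)"
        by (rule add) (use C0 Suc.prems in auto)
      finally have "\<eta> t f = \<eta> t (\<lambda>x. f x - u 0 x) + \<eta> t (u 0)" .
      moreover have "\<bar>\<eta> t (\<lambda>x. f x - u 0 x)\<bar> \<le> C * d"
        by (rule bound) (use C0 Suc.prems u(2) in \<open>auto intro: less_imp_le\<close>)
      moreover have "\<bar>\<eta> t (u 0)\<bar> \<le> C * (M + d) * q"
      proof (rule poly[OF u(1)])
        show "\<bar>u 0 x\<bar> \<le> M + d" for x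
          using Suc.prems(4)[of x] u(2)[of x] by linarith
      qed
      ultimately show ?thesis by (simp add: algebra_simps)
    qed
    moreover have "C * (1 + q) \<ge> 0" using \<open>C \<ge> 0\<close> \<open>q \<ge> 0\<close> by simp
    ultimately have "\<bar>\<eta> t f\<bar> \<le> C * M * q"
      by (rule le_of_le_add_mult[rotated])
    then show ?case by (simp add: q_def)
  qed
  obtain M where M: "M > 0" "\<And>x. \<bar>f x\<bar> \<le> M" using C0_circle_bounded[OF \<open>C0_circle f\<close>] by blast
  \<comment> \<open>These are multiples of the terms of the exponential series at
    \<open>K * (t - a)\<close>.\<close>
  have "(\<lambda>n. C * M * (inverse (fact n) * (K * (t - a)) ^ n)) \<longlonglongrightarrow> C * M * 0"
    by (intro tendsto_mult tendsto_const summable_LIMSEQ_zero summable_exp)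
  then have "\<bar>\<eta> t f\<bar> \<le> C * M * 0"
    by (rule LIMSEQ_le_const)
      (use est[OF \<open>a \<le> t\<close> \<open>t \<le> b\<close> \<open>C0_circle f\<close> M(2)] in \<open>simp add: divide_inverse_commute\<close>)
  then show ?thesis by simp
qed

section \<open>Measures determined by continuous functions on the circle\<close>

text \<open>Periodic continuous functions approximate indicators of arcs, not of half-lines. Open
  arcs starting at 0 are reached as limits, the mass at the point 0 is what remains of the total,
  and the half-lines, an intersection-stable generator, are assembled from these.\<close>

lemma measure_eq_of_C0_circle:
  fixes \<mu> \<nu> :: "real measure"
  assumes fin: "finite_measure \<mu>" "finite_measure \<nu>"
    and sets: "sets \<mu> = sets borel" "sets \<nu> = sets borel"
    and AE: "AE x in \<mu>. x \<in> circle" "AE x in \<nu>. x \<in> circle"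
    and eq: "\<And>f. C0_circle f \<Longrightarrow> (LINT x|\<mu>. f x) = (LINT x|\<nu>. f x)"
  shows "\<mu> = \<nu>"
proof -
  note [measurable_cong] = sets
  have sp: "space \<mu> = UNIV" "space \<nu> = UNIV"
    using sets[THEN sets_eq_imp_space_eq] by simp_all
  \<comment> \<open>The arc has midpoint \<open>b / 2\<close> and half-length \<open>b / 2\<close>,
    so \<open>cos (2 * pi * (x - b / 2))\<close> exceeds \<open>cos (pi * b)\<close> exactly inside
    it. Scaling the positive part by \<open>n\<close> and truncating at 1 tends to the
    indicator.\<close>
  have lim: "(\<lambda>n. LINT x|\<rho>. min 1 (real n * max 0 (cos (2 * pi * (x - b / 2)) - cos (pi * b))))
      \<longlonglongrightarrow> measure \<rho> {0<..<b}"
    if b: "0 < b" "b \<le> 1" and \<rho>: "finite_measure \<rho>" "sets \<rho> = sets borel" "AE x in \<rho>. x \<in> circle" for b \<rho>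
  proof -
    interpret finite_measure \<rho> by fact
    note [measurable_cong] = \<rho>(2)
    have pos: "cos (2 * pi * (x - b / 2)) - cos (pi * b) > 0 \<longleftrightarrow> x \<in> {0<..<b}" if "x \<in> circle" for x
    proof -
      have "cos (2 * pi * (x - b / 2)) = cos (2 * pi * \<bar>x - b / 2\<bar>)"
        using cos_minus[of "2 * pi * (x - b / 2)"] by (cases "x \<ge> b / 2") (auto simp: abs_if algebra_simps)
      show ?thesis
      proof (cases "\<bar>x - b / 2\<bar> \<le> 1 / 2")
        case True
        then have "cos (2 * pi * \<bar>x - b / 2\<bar>) > cos (pi * b) \<longleftrightarrow> 2 * pi * \<bar>x - b / 2\<bar> < pi * b"
          using b True mult_left_mono[of "2 * \<bar>x - b / 2\<bar>" 1 pi]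
          by (intro cos_mono_less_eq) (auto simp: ac_simps)
        also have "\<dots> \<longleftrightarrow> pi * (2 * \<bar>x - b / 2\<bar>) < pi * b" by (simp add: ac_simps)
        also have "\<dots> \<longleftrightarrow> x \<in> {0<..<b}" using b unfolding mult_less_cancel_left_pos[OF pi_gt_zero] by (auto simp: abs_if split: if_splits)
        finally show ?thesis using \<open>cos (2 * pi * (x - b / 2)) = _\<close> by simp
      next
        case False
        then have x: "x - b / 2 > 1 / 2" using that b by (auto simp: abs_if split: if_splits)
        \<comment> \<open>Beyond half a turn from the midpoint, the shorter way round the circle has
          length \<open>1 - (x - b / 2)\<close>, which is still at least
          \<open>b / 2\<close>.\<close>
        have "cos (2 * pi * (x - b / 2)) = cos (2 * pi * (1 - (x - b / 2)))"
        proof -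
          have "2 * pi * (1 - (x - b / 2)) = - (2 * pi * (x - b / 2)) + 2 * pi" by (simp add: algebra_simps)
          then show ?thesis by (simp only: cos_periodic cos_minus)
        qed
        also have "\<dots> \<le> cos (pi * b)"
        proof (rule cos_monotone_0_pi_le)
          show "pi * b \<le> 2 * pi * (1 - (x - b / 2))"
            using that mult_left_mono[of b "2 * (1 - (x - b / 2))" pi] by (simp add: algebra_simps)
          show "2 * pi * (1 - (x - b / 2)) \<le> pi"
            using x mult_left_mono[of "2 * (1 - (x - b / 2))" 1 pi] by (simp add: algebra_simps)
        qed (use b in auto)
        finally show ?thesis using x b that by auto
      qed
    qed
    have "(\<lambda>n. LINT x|\<rho>. min 1 (real n * max 0 (cos (2 * pi * (x - b / 2)) - cos (pi * b))))
      \<longlonglongrightarrow> (LINT x|\<rho>. indicator {0<..<b} x)"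
    proof (rule integral_dominated_convergence[where w = "\<lambda>_. 1"])
      show "AE x in \<rho>. (\<lambda>n. min 1 (real n * max 0 (cos (2 * pi * (x - b / 2)) - cos (pi * b))))
        \<longlonglongrightarrow> indicator {0<..<b} x"
        using \<rho>(3)
      proof eventually_elim
        case (elim x)
        define c where "c = max 0 (cos (2 * pi * (x - b / 2)) - cos (pi * b))"
        have c: "c > 0 \<longleftrightarrow> x \<in> {0<..<b}" using pos[OF elim] by (auto simp: c_def)
        have "(\<lambda>n. min 1 (real n * c)) \<longlonglongrightarrow> indicator {0<..<b} x"
        proof (cases "c > 0")
          case True
          have "eventually (\<lambda>n. real n \<ge> 1 / c) sequentially"
            using filterlim_at_top filterlim_real_sequentially by blast
          then have "eventually (\<lambda>n. min 1 (real n * c) = 1) sequentially"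
            by eventually_elim (use True in \<open>auto simp: field_simps\<close>)
          then show ?thesis using True c by (simp add: tendsto_eventually)
        next
          case False
          then have "c = 0" by (simp add: c_def)
          then show ?thesis using c by simp
        qed
        then show ?case by (simp add: c_def)
      qed
      show "AE x in \<rho>. norm (min 1 (real n * max 0 (cos (2 * pi * (x - b / 2)) - cos (pi * b)))) \<le> 1" for n
        by (intro AE_I2) (simp add: abs_of_nonneg)
    qed auto
    then show ?thesis by (simp add: \<rho>(2)[THEN sets_eq_imp_space_eq])
  qed
  have C0: "C0_circle (\<lambda>x. min 1 (real n * max 0 (cos (2 * pi * (x - b / 2)) - cos (pi * b))))" for n b
    unfolding C0_circle_def periodic1_def
  proof (intro conjI allI continuous_intros)
    fix x :: real
    have "cos (2 * pi * (x + 1 - b / 2)) = cos (2 * pi * (x - b / 2))"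
      using cos_periodic[of "2 * pi * (x - b / 2)"] by (simp add: algebra_simps)
    then show "min 1 (real n * max 0 (cos (2 * pi * (x + 1 - b / 2)) - cos (pi * b)))
      = min 1 (real n * max 0 (cos (2 * pi * (x - b / 2)) - cos (pi * b)))" by simp
  qed
  have arc: "measure \<mu> {0<..<b} = measure \<nu> {0<..<b}" if b: "0 < b" "b \<le> 1" for b
    using lim[OF b fin(1) sets(1) AE(1)] lim[OF b fin(2) sets(2) AE(2)] eq[OF C0]
    by (simp add: LIMSEQ_unique)
  have total: "measure \<mu> UNIV = measure \<nu> UNIV"
    using eq[OF C0_circle_intros(1)[of 1]] sp by simp
  have half: "measure \<rho> {..<a} = (if a \<le> 0 then 0 else
      measure \<rho> UNIV - measure \<rho> {0<..<1} + measure \<rho> {0<..<min a 1})"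
    if \<rho>: "finite_measure \<rho>" "sets \<rho> = sets borel" "AE x in \<rho>. x \<in> circle" for a \<rho>
  proof -
    interpret finite_measure \<rho> by fact
    note [measurable_cong] = \<rho>(2)
    have sp: "space \<rho> = UNIV" using \<rho>(2)[THEN sets_eq_imp_space_eq] by simp
    show ?thesis
    proof (cases "a \<le> 0")
      case True
      have "measure \<rho> {..<a} = measure \<rho> {}"
        by (rule measure_eq_AE) (use \<rho>(3) True in auto)
      then show ?thesis using True by simp
    next
      case False
      have "measure \<rho> {..<a} = measure \<rho> ({0} \<union> {0<..<min a 1})"
        by (rule measure_eq_AE) (use \<rho>(3) False in auto)
      also have "\<dots> = measure \<rho> {0} + measure \<rho> {0<..<min a 1}"
        by (rule finite_measure_Union) auto
      also have "measure \<rho> {0} = measure \<rho> (UNIV - {0<..<1})"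
        by (rule measure_eq_AE) (use \<rho>(3) in auto)
      also have "\<dots> = measure \<rho> UNIV - measure \<rho> {0<..<1}"
        using sp by (metis finite_measure_compl \<rho>(2) borel_open open_greaterThanLessThan)
      finally show ?thesis using False by simp
    qed
  qed
  show ?thesis
  proof (rule measure_eqI_generator_eq[where E = "range lessThan" and \<Omega> = UNIV and A = "\<lambda>n. {..<real n}"])
    show "Int_stable (range (lessThan :: real \<Rightarrow> _))"
    proof -
      have "{..<a} \<inter> {..<b} = {..<min a b}" for a b :: real by auto
      then show ?thesis by (auto simp: Int_stable_def)
    qed
    show "sets \<mu> = sigma_sets UNIV (range lessThan)" "sets \<nu> = sigma_sets UNIV (range lessThan)"
      unfolding sets by (simp_all add: borel_Iio)
    show "(\<Union>i. {..<real i}) = UNIV" using reals_Archimedean2 by auto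
    show "emeasure \<mu> {..<real i} \<noteq> \<infinity>" for i
      using fin(1) by (simp add: finite_measure.emeasure_finite)
    show "emeasure \<mu> X = emeasure \<nu> X" if "X \<in> range lessThan" for X
    proof -
      from that obtain a :: real where X: "X = {..<a}" by auto
      have "measure \<mu> X = measure \<nu> X"
        unfolding X half[OF fin(1) sets(1) AE(1)] half[OF fin(2) sets(2) AE(2)] total arc[OF zero_less_one order_refl]
        using arc[of "min a 1"] by auto
      then show ?thesis
        using fin by (simp add: finite_measure.emeasure_eq_measure)
    qed
  qed auto
qed

section \<open>Paths, occupation integrals and the Markov property\<close>

text \<open>A non-integrable function has Bochner integral 0 by convention, and \<open>c\<close> is
  nonnegative because the space is nonempty. Sup bounds thus pass to expectations without a
  measurability goal at each use.\<close>

lemma prob_space_abs_integral_le: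
  fixes h :: "'a \<Rightarrow> real"
  assumes "prob_space M" "\<And>w. w \<in> space M \<Longrightarrow> \<bar>h w\<bar> \<le> c"
  shows "\<bar>LINT w|M. h w\<bar> \<le> c"
proof -
  interpret prob_space M by fact
  have "c \<ge> 0" using assms(2) not_empty by fastforce
  show ?thesis
  proof (cases "integrable M h")
    case True
    have "\<bar>LINT w|M. h w\<bar> \<le> (LINT w|M. \<bar>h w\<bar>)" by (rule integral_abs_bound)
    also have "\<dots> \<le> (LINT w|M. c)"
      by (rule integral_mono) (use True assms(2) in auto)
    finally show ?thesis by (simp add: prob_space)
  next
    case False
    then show ?thesis using \<open>c \<ge> 0\<close> by (simp add: not_integrable_integral_eq)
  qed
qed

text \<open>Along a convergent sequence of times, the monotone bound \<open>C\<close> is dominated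
  by its value at a bound of that sequence. This admits weights such as \<open>exp (K * s)\<close>
  that grow in time.\<close>

lemma continuous_on_LINT:
  fixes h :: "real \<Rightarrow> 'a \<Rightarrow> real"
  assumes "finite_measure M"
    and [measurable]: "\<And>s. s \<in> S \<Longrightarrow> h s \<in> borel_measurable M"
    and bound: "\<And>s w. s \<in> S \<Longrightarrow> w \<in> space M \<Longrightarrow> \<bar>h s w\<bar> \<le> C s" and "mono C"
    and cont: "\<And>w. w \<in> space M \<Longrightarrow> continuous_on S (\<lambda>s. h s w)"
  shows "continuous_on S (\<lambda>s. LINT w|M. h s w)"
proof (rule continuous_on_sequentiallyI)
  interpret finite_measure M by fact
  fix u a assume u: "\<forall>n. u n \<in> S" "a \<in> S" "u \<longlonglongrightarrow> a"
  obtain b where b: "\<And>n. \<bar>u n\<bar> \<le> b"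
    using convergent_imp_Bseq[of u] u(3) by (auto simp: convergent_def Bseq_def)
  show "(\<lambda>n. LINT w|M. h (u n) w) \<longlonglongrightarrow> (LINT w|M. h a w)"
  proof (rule integral_dominated_convergence[where w = "\<lambda>_. C b"])
    show "AE w in M. (\<lambda>n. h (u n) w) \<longlonglongrightarrow> h a w"
      using u cont unfolding continuous_on_sequentially comp_def by (intro AE_I2) blast
    show "AE w in M. norm (h (u n) w) \<le> C b" for n
    proof (intro AE_I2)
      fix w assume "w \<in> space M"
      then have "\<bar>h (u n) w\<bar> \<le> C (u n)" using u bound by blast
      also have "\<dots> \<le> C b" using b[of n] by (intro monoD[OF \<open>mono C\<close>]) simp
      finally show "norm (h (u n) w) \<le> C b" by simp
    qed
  qed (use u in auto)
qed

lemma measurable_coordinate_borel: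
  assumes "t \<in> I" "I \<subseteq> {0..}"
  shows "(\<lambda>w. w t) \<in> borel_measurable (coordinate_algebra I)"
  using measurable_coordinate[OF assms] by (simp add: measurable_restrict_space2_iff)

lemma measurable_path_filtration_path_space:
  "f \<in> borel_measurable (path_filtration s) \<Longrightarrow> f \<in> borel_measurable path_space"
  using subalgebra_path_filtration measurable_from_subalg by blast

lemma path_in_circle: "w \<in> circle_paths \<Longrightarrow> 0 \<le> t \<Longrightarrow> w t \<in> circle"
  by (auto simp: circle_paths_def PiE_def Pi_def)

lemma continuous_on_path:
  assumes "w \<in> circle_paths" "C0_circle f"
  shows "continuous_on {0..} (\<lambda>t. f (w t))"
proof -
  obtain G where G: "continuous_on (sphere 0 1) G" "\<And>x. f x = G (cis (2 * pi * x))"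
    using C0_circle_factor[OF assms(2)] by blast
  have "continuous_on {0..} (\<lambda>t. G (cis (2 * pi * w t)))"
    by (rule continuous_on_compose2[OF G(1)]) (use assms(1) in \<open>auto simp: circle_paths_def\<close>)
  then show ?thesis by (simp add: G(2))
qed

definition occupation :: "(real \<Rightarrow> real) \<Rightarrow> real \<Rightarrow> (real \<Rightarrow> real) \<Rightarrow> real" where
  "occupation U s w = (LINT r:{0..s}|lborel. U (w r))"

lemma occupation_eq_integral:
  assumes "w \<in> circle_paths" "C0_circle U"
  shows "occupation U s w = integral {0..s} (\<lambda>r. U (w r))"
    and "continuous_on {0..s} (\<lambda>r. U (w r))"
proof -
  show c: "continuous_on {0..s} (\<lambda>r. U (w r))"
    by (rule continuous_on_subset[OF continuous_on_path[OF assms]]) auto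
  show "occupation U s w = integral {0..s} (\<lambda>r. U (w r))"
    unfolding occupation_def
    by (rule set_borel_integral_eq_integral) (use borel_integrable_atLeastAtMost'[OF c] in simp)
qed

lemma occupation_DERIV:
  assumes "w \<in> circle_paths" "C0_circle U" "0 \<le> s"
  shows "((\<lambda>s. occupation U s w) has_real_derivative U (w s)) (at_right s)"
    and "continuous_on {0..} (\<lambda>s. occupation U s w)"
proof -
  have D: "((\<lambda>s. occupation U s w) has_real_derivative U (w r)) (at r within {0..b})"
    if "r \<in> {0..b}" for r b
    unfolding occupation_eq_integral(1)[OF assms(1,2)]
    by (rule integral_has_real_derivative) (use that occupation_eq_integral(2)[OF assms(1,2)] in auto)
  have "((\<lambda>s. occupation U s w) has_real_derivative U (w s)) (at s within {s..s+1})"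
    by (rule DERIV_subset[OF D[of s "s + 1"]]) (use assms in auto)
  then show "((\<lambda>s. occupation U s w) has_real_derivative U (w s)) (at_right s)"
    by (simp add: at_within_Icc_at_right)
  show "continuous_on {0..} (\<lambda>s. occupation U s w)"
    unfolding continuous_on_eq_continuous_within
  proof
    fix r :: real assume "r \<in> {0..}"
    then have "continuous (at r within {0..r+1}) (\<lambda>s. occupation U s w)"
      by (intro DERIV_continuous[OF D]) auto
    moreover have "at r within {0..r+1} = at r within {0..}"
      by (rule at_within_nhd[where S = "{..<r+1}"]) auto
    ultimately show "continuous (at r within {0..}) (\<lambda>s. occupation U s w)" by simp
  qed
qed

lemma occupation_diff_le:
  assumes "w \<in> circle_paths" "C0_circle U" "0 \<le> r" "r \<le> s" "\<And>x. \<bar>U x\<bar> \<le> K"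
  shows "\<bar>occupation U s w - occupation U r w\<bar> \<le> K * (s - r)"
proof -
  note i = integrable_continuous_real[OF occupation_eq_integral(2)[OF assms(1,2)]]
  have "occupation U s w - occupation U r w = integral {r..s} (\<lambda>r. U (w r))"
    unfolding occupation_eq_integral(1)[OF assms(1,2)]
    using Henstock_Kurzweil_Integration.integral_combine[OF assms(3,4) i] by simp
  also have "\<bar>\<dots>\<bar> \<le> K * (s - r)"
    using integral_bound[OF assms(4), of "\<lambda>r. U (w r)" K] assms(3,5)
      continuous_on_subset[OF occupation_eq_integral(2)[OF assms(1,2)], of "{r..s}" s] by auto
  finally show ?thesis .
qed

lemma occupation_0 [simp]: "occupation U 0 w = 0"
proof -
  have "AE r in lborel. indicator {0..0} r *\<^sub>R U (w r) = 0"
    using AE_lborel_singleton[of 0] by eventually_elim auto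
  then show ?thesis
    unfolding occupation_def set_lebesgue_integral_def by (rule integral_eq_zero_AE)
qed

lemma occupation_abs_le:
  assumes "w \<in> circle_paths" "C0_circle U" "0 \<le> s" "\<And>x. \<bar>U x\<bar> \<le> K"
  shows "\<bar>occupation U s w\<bar> \<le> K * s"
  using occupation_diff_le[OF assms(1,2) order_refl assms(3,4)] by simp

text \<open>Joint measurability in path and time is obtained by freezing time on a grid, where
  countably many coordinates occur, and refining the grid along the continuous path. Time is then
  integrated out.\<close>

lemma occupation_measurable:
  assumes U: "C0_circle U" and "0 \<le> s" "s \<le> T"
  shows "occupation U s \<in> borel_measurable (path_filtration T)"
proof -
  note [measurable] = C0_circle_measurable[OF U]
  let ?M = "path_filtration T"
  \<comment> \<open>Rounding down keeps the grid time in \<open>{0..s}\<close>. Clamping to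
    \<open>{0..T}\<close> makes every coordinate that is mentioned measurable for
    \<open>path_filtration T\<close>, including those of grid indices that are never
    reached.\<close>
  define h where "h n = (\<lambda>(w, r). indicator {0..s} r * U (w (max 0 (min T (of_int \<lfloor>real (Suc n) * r\<rfloor> / real (Suc n))))) :: real)" for n
  have h: "h n \<in> borel_measurable (?M \<Otimes>\<^sub>M lborel)" for n
  proof -
    have c: "(\<lambda>w. w (max 0 (min T (of_int i / real (Suc n))))) \<in> borel_measurable ?M" for i
      unfolding path_filtration_def by (rule measurable_coordinate_borel) (use assms in auto)
    define g where "g i x = (indicator {0..s} (snd x) * U (fst x (max 0 (min T (of_int i / real (Suc n))))) :: real)"
      for i and x :: "(real \<Rightarrow> real) \<times> real"
    have "(\<lambda>x. g \<lfloor>real (Suc n) * snd x\<rfloor> x) \<in> borel_measurable (?M \<Otimes>\<^sub>M lborel)"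
    proof (rule measurable_compose_countable)
      fix i :: int
      have [measurable]: "(\<lambda>x. fst x (max 0 (min T (of_int i / real (Suc n))))) \<in> borel_measurable (?M \<Otimes>\<^sub>M lborel)"
        using measurable_compose[OF measurable_fst c] .
      show "g i \<in> borel_measurable (?M \<Otimes>\<^sub>M lborel)"
        unfolding g_def by measurable
    qed measurable
    moreover have "h n = (\<lambda>x. g \<lfloor>real (Suc n) * snd x\<rfloor> x)"
      by (auto simp: h_def g_def)
    ultimately show ?thesis by simp
  qed
  have "(\<lambda>(w, r). indicator {0..s} r * U (w r)) \<in> borel_measurable (?M \<Otimes>\<^sub>M lborel)"
  proof (rule borel_measurable_LIMSEQ_real[OF _ h])
    fix x :: "(real \<Rightarrow> real) \<times> real" assume "x \<in> space (?M \<Otimes>\<^sub>M lborel)"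
    then obtain w r where x: "x = (w, r)" "w \<in> circle_paths"
      by (auto simp: space_pair_measure path_filtration_def)
    show "(\<lambda>n. h n x) \<longlonglongrightarrow> (case x of (w, r) \<Rightarrow> indicator {0..s} r * U (w r))"
    proof (cases "r \<in> {0..s}")
      case True
      define q where "q n = of_int \<lfloor>real (Suc n) * r\<rfloor> / real (Suc n)" for n
      have q: "r - 1 / real (Suc n) \<le> q n" "q n \<le> r" "0 \<le> q n" for n
      proof -
        have m: "real (Suc n) > 0" by simp
        have "(real (Suc n) * r - 1) / real (Suc n) \<le> q n" "q n \<le> (real (Suc n) * r) / real (Suc n)"
          unfolding q_def by (rule divide_right_mono; linarith)+
        then show "r - 1 / real (Suc n) \<le> q n" "q n \<le> r"
          by (simp_all add: diff_divide_distrib del: of_nat_Suc)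
        show "0 \<le> q n" using True by (simp add: q_def)
      qed
      have "q \<longlonglongrightarrow> r"
      proof (rule tendsto_sandwich)
        show "(\<lambda>n. r - 1 / real (Suc n)) \<longlonglongrightarrow> r"
          using tendsto_diff[OF tendsto_const LIMSEQ_inverse_real_of_nat, of r] by (simp add: divide_inverse)
        show "(\<lambda>n. r) \<longlonglongrightarrow> r" by simp
      qed (use q in auto)
      then have "(\<lambda>n. U (w (q n))) \<longlonglongrightarrow> U (w r)"
        using continuous_on_path[OF x(2) U] q True unfolding continuous_on_sequentially comp_def by auto
      moreover have "h n x = U (w (q n))" for n
      proof -
        have "max 0 (min T (q n)) = q n" using q[of n] True assms by auto
        then show ?thesis using True by (simp add: h_def x q_def)
      qed
      ultimately show ?thesis using True by (simp add: x)
    qed (simp add: h_def x)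
  qed
  then have "(\<lambda>w. LINT r|lborel. indicator {0..s} r * U (w r)) \<in> borel_measurable ?M"
    by (rule lborel.borel_measurable_lebesgue_integral)
  then show ?thesis by (simp add: occupation_def[abs_def] set_lebesgue_integral_def)
qed

lemma markov_lawsD:
  assumes "markov_laws A Q" "x \<in> circle"
  shows "prob_space (Q x)" "sets (Q x) = sets path_space" "space (Q x) = circle_paths"
    "AE w in Q x. w 0 = x"
proof -
  have "Q x \<in> space (prob_algebra path_space)"
    using assms measurable_space[of Q circle_borel "prob_algebra path_space" x]
    by (simp add: markov_laws_def space_restrict_space)
  then show "prob_space (Q x)" "sets (Q x) = sets path_space"
    by (auto simp: space_prob_algebra)
  then show "space (Q x) = circle_paths"
    using sets_eq_imp_space_eq[of "Q x" path_space] by (simp add: path_space_def)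
  show "AE w in Q x. w 0 = x" using assms by (auto simp: markov_laws_def)
qed

lemma markov_laws_kernel_measurable:
  fixes h :: "(real \<Rightarrow> real) \<Rightarrow> real"
  assumes "markov_laws A Q" "h \<in> borel_measurable path_space"
  shows "(\<lambda>x. LINT w|Q x. h w) \<in> borel_measurable circle_borel"
proof -
  have "Q \<in> circle_borel \<rightarrow>\<^sub>M subprob_algebra path_space"
    using assms(1) by (auto simp: markov_laws_def intro: measurable_prob_algebraD)
  from measurable_compose[OF this integral_measurable_subprob_algebra[OF assms(2)]]
  show ?thesis .
qed

text \<open>For sets \<open>D\<close>, the Markov property says that two measures on the circle
  agree: the law of \<open>w (s + t)\<close> on \<open>B\<close>, and the law of \<open>w s\<close>
  on \<open>B\<close> pushed through the transition kernel. Equality of the measures yields all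
  nonnegative Borel \<open>f\<close> at once.\<close>

lemma markov_laws_nn_integral:
  assumes Q: "markov_laws A Q" and "x \<in> circle" "0 \<le> s" "0 \<le> t" and B: "B \<in> sets (path_filtration s)"
    and f: "f \<in> borel_measurable circle_borel"
  shows "(\<integral>\<^sup>+w. f (w (s + t)) * indicator B w \<partial>Q x)
    = (\<integral>\<^sup>+w. (\<integral>\<^sup>+v. f (v t) \<partial>Q (w s)) * indicator B w \<partial>Q x)"
proof -
  note D = markov_lawsD[OF Q \<open>x \<in> circle\<close>]
  interpret prob_space "Q x" by fact
  have B' [measurable]: "B \<in> sets (Q x)"
    using B D(2) subalgebra_path_filtration by (auto simp: subalgebra_def)
  have X: "(\<lambda>w. w r) \<in> path_space \<rightarrow>\<^sub>M circle_borel" if "r \<ge> 0" for r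
    unfolding path_space_def using that by (intro measurable_coordinate) auto
  have XQ: "(\<lambda>w. w r) \<in> Q x \<rightarrow>\<^sub>M circle_borel" if "r \<ge> 0" for r
    using X[OF that] D(2) by (simp cong: measurable_cong_sets)
  note [measurable] = XQ[OF \<open>0 \<le> s\<close>] XQ[of "s + t"] X[OF \<open>0 \<le> t\<close>] f
  have Qs: "Q \<in> circle_borel \<rightarrow>\<^sub>M subprob_algebra path_space"
    using Q by (auto simp: markov_laws_def intro: measurable_prob_algebraD)
  have K: "(\<lambda>y. distr (Q y) circle_borel (\<lambda>v. v t)) \<in> circle_borel \<rightarrow>\<^sub>M subprob_algebra circle_borel"
    using measurable_compose[OF Qs measurable_distr[OF X[OF \<open>0 \<le> t\<close>]]] .
  let ?N = "distr (density (Q x) (indicator B)) circle_borel (\<lambda>w. w s)"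
  let ?N1 = "distr (density (Q x) (indicator B)) circle_borel (\<lambda>w. w (s + t))"
  let ?N2 = "?N \<bind> (\<lambda>y. distr (Q y) circle_borel (\<lambda>v. v t))"
  have ne: "space ?N \<noteq> {}" by (auto simp: space_restrict_space intro!: exI[of _ 0])
  have KN: "(\<lambda>y. distr (Q y) circle_borel (\<lambda>v. v t)) \<in> ?N \<rightarrow>\<^sub>M subprob_algebra circle_borel"
    using K by (simp cong: measurable_cong_sets)
  have XQy: "(\<lambda>v. v t) \<in> Q y \<rightarrow>\<^sub>M circle_borel" if "y \<in> circle" for y
    using X[OF \<open>0 \<le> t\<close>] markov_lawsD(2)[OF Q that] by (simp cong: measurable_cong_sets)
  have in_circle: "w s \<in> circle" if "w \<in> space (Q x)" for w
    using that D(3) path_in_circle \<open>0 \<le> s\<close> by auto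
  have "?N1 = ?N2"
  proof (rule measure_eqI)
    show "sets ?N1 = sets ?N2" using sets_bind[OF _ ne, of _ circle_borel] K
      by (simp add: space_restrict_space subprob_measurableD(2)[OF K])
    fix E assume "E \<in> sets ?N1"
    then have E [measurable]: "E \<in> sets circle_borel" by simp
    have "emeasure ?N1 E = emeasure (Q x) {w \<in> B. w (s + t) \<in> E}"
    proof -
      have "emeasure ?N1 E = (\<integral>\<^sup>+w. indicator B w * indicator ((\<lambda>w. w (s + t)) -` E \<inter> space (Q x)) w \<partial>Q x)"
        using assms by (simp add: emeasure_distr emeasure_density)
      also have "\<dots> = (\<integral>\<^sup>+w. indicator {w \<in> B. w (s + t) \<in> E} w \<partial>Q x)"
        by (intro nn_integral_cong) (auto simp: indicator_def)
      also have "\<dots> = emeasure (Q x) {w \<in> B. w (s + t) \<in> E}"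
      proof (rule nn_integral_indicator)
        have "{w \<in> B. w (s + t) \<in> E} = B \<inter> ((\<lambda>w. w (s + t)) -` E \<inter> space (Q x))"
          using sets.sets_into_space[OF B'] by auto
        also have "\<dots> \<in> sets (Q x)"
          using assms by (intro sets.Int B' measurable_sets[OF XQ E]) auto
        finally show "{w \<in> B. w (s + t) \<in> E} \<in> sets (Q x)" .
      qed
      finally show ?thesis .
    qed
    also have "\<dots> = ennreal (LINT w:B|Q x. measure (Q (w s)) {v \<in> circle_paths. v t \<in> E})"
      using assms E unfolding emeasure_eq_measure markov_laws_def by auto
    also have "\<dots> = (\<integral>\<^sup>+w. ennreal (indicator B w * measure (Q (w s)) {v \<in> circle_paths. v t \<in> E}) \<partial>Q x)"
    proof -
      have "{v \<in> circle_paths. v t \<in> E} = (\<lambda>v. v t) -` E \<inter> space path_space"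
        by (auto simp: path_space_def)
      also have "\<dots> \<in> sets path_space" using assms by measurable
      finally have "(\<lambda>M. measure M {v \<in> circle_paths. v t \<in> E}) \<in> borel_measurable (subprob_algebra path_space)"
        by (rule measurable_measure_subprob_algebra)
      from measurable_compose[OF measurable_compose[OF XQ[OF \<open>0 \<le> s\<close>] Qs] this]
      have [measurable]: "(\<lambda>w. measure (Q (w s)) {v \<in> circle_paths. v t \<in> E}) \<in> borel_measurable (Q x)" .
      show ?thesis
        unfolding set_lebesgue_integral_def real_scaleR_def
      proof (rule nn_integral_eq_integral[symmetric])
        show "integrable (Q x) (\<lambda>w. indicator B w * measure (Q (w s)) {v \<in> circle_paths. v t \<in> E})"
        proof (rule integrable_const_bound[where B = 1])
          show "AE w in Q x. norm (indicator B w * measure (Q (w s)) {v \<in> circle_paths. v t \<in> E}) \<le> 1"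
            using prob_space.prob_le_1[OF markov_lawsD(1)[OF Q in_circle]]
            by (intro AE_I2) (auto simp: indicator_def)
        qed measurable
      qed (auto simp: indicator_def)
    qed
    also have "\<dots> = (\<integral>\<^sup>+w. indicator B w * emeasure (distr (Q (w s)) circle_borel (\<lambda>v. v t)) E \<partial>Q x)"
    proof (intro nn_integral_cong)
      fix w assume w: "w \<in> space (Q x)"
      note Dw = markov_lawsD[OF Q in_circle[OF w]]
      have "{v \<in> circle_paths. v t \<in> E} = (\<lambda>v. v t) -` E \<inter> space (Q (w s))"
        using Dw(3) by auto
      then have "emeasure (distr (Q (w s)) circle_borel (\<lambda>v. v t)) E = emeasure (Q (w s)) {v \<in> circle_paths. v t \<in> E}"
        using XQy[OF in_circle[OF w]] E by (simp add: emeasure_distr)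
      also have "\<dots> = ennreal (measure (Q (w s)) {v \<in> circle_paths. v t \<in> E})"
        using Dw(1) by (simp add: finite_measure.emeasure_eq_measure prob_space.finite_measure)
      finally show "ennreal (indicator B w * measure (Q (w s)) {v \<in> circle_paths. v t \<in> E})
        = indicator B w * emeasure (distr (Q (w s)) circle_borel (\<lambda>v. v t)) E"
        by (simp add: indicator_def)
    qed
    also have "\<dots> = (\<integral>\<^sup>+y. emeasure (distr (Q y) circle_borel (\<lambda>v. v t)) E \<partial>?N)"
      using measurable_emeasure_kernel[OF K E] by (subst nn_integral_distr) (auto simp: nn_integral_density)
    also have "\<dots> = emeasure ?N2 E"
      by (rule emeasure_bind[OF ne KN E, symmetric])
    finally show "emeasure ?N1 E = emeasure ?N2 E" .
  qed
  then have "(\<integral>\<^sup>+y. f y \<partial>?N1) = (\<integral>\<^sup>+y. f y \<partial>?N2)" by simp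
  also have "\<dots> = (\<integral>\<^sup>+y. \<integral>\<^sup>+z. f z \<partial>distr (Q y) circle_borel (\<lambda>v. v t) \<partial>?N)"
    by (rule nn_integral_bind[OF f KN])
  also have "\<dots> = (\<integral>\<^sup>+w. indicator B w * (\<integral>\<^sup>+z. f z \<partial>distr (Q (w s)) circle_borel (\<lambda>v. v t)) \<partial>Q x)"
    using nn_integral_measurable_subprob_algebra2[of "\<lambda>_ z. f z", OF _ K]
    by (subst nn_integral_distr) (auto simp: nn_integral_density)
  also have "\<dots> = (\<integral>\<^sup>+w. (\<integral>\<^sup>+v. f (v t) \<partial>Q (w s)) * indicator B w \<partial>Q x)"
    by (intro nn_integral_cong) (simp add: nn_integral_distr[OF XQy[OF in_circle]] mult.commute)
  also have "(\<integral>\<^sup>+y. f y \<partial>?N1) = (\<integral>\<^sup>+w. f (w (s + t)) * indicator B w \<partial>Q x)"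
    using assms by (subst nn_integral_distr) (auto simp: nn_integral_density mult.commute)
  finally show ?thesis .
qed

text \<open>The passage from events \<open>B\<close> to bounded adapted weights \<open>Y\<close>
  goes through conditional expectations: the transition function evaluated at \<open>w s\<close> is
  a version of the conditional expectation of \<open>f (w (s + t))\<close> given
  \<open>path_filtration s\<close>.\<close>

lemma markov_laws_LINT:
  assumes Q: "markov_laws A Q" and "x \<in> circle" "0 \<le> s" "0 \<le> t"
    and Y: "Y \<in> borel_measurable (path_filtration s)" "\<And>w. w \<in> circle_paths \<Longrightarrow> \<bar>Y w\<bar> \<le> C"
    and f: "C0_circle f"
  shows "(LINT w|Q x. Y w * f (w (s + t))) = (LINT w|Q x. Y w * (LINT v|Q (w s). f (v t)))"
proof -
  note D = markov_lawsD[OF Q \<open>x \<in> circle\<close>]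
  interpret finite_measure_subalgebra "Q x" "path_filtration s"
    using D subalgebra_path_filtration[of s]
    by (auto simp: finite_measure_subalgebra_def finite_measure_subalgebra_axioms_def subalgebra_def
        prob_space.finite_measure path_space_def)
  interpret prob_space "Q x" by fact
  note [measurable_cong] = D(2)
  note [measurable] = C0_circle_measurable[OF f] measurable_path_filtration_path_space[OF Y(1)]
  obtain K where K: "K > 0" "\<And>x. \<bar>f x\<bar> \<le> K" using C0_circle_bounded[OF f] by blast
  \<comment> \<open>Shifting by the bound \<open>K\<close> makes the integrand nonnegative, so the
    previous lemma applies; the shift is removed at the end.\<close>
  have nn: "0 \<le> f y + K" for y using K(2)[of y] by linarith
  have X: "(\<lambda>w. w r) \<in> borel_measurable path_space" if "r \<ge> 0" for r
    unfolding path_space_def using that by (intro measurable_coordinate_borel) auto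
  note [measurable] = X[OF \<open>0 \<le> t\<close>] X[of "s + t"]
  have Xs: "(\<lambda>w. w s) \<in> path_filtration s \<rightarrow>\<^sub>M circle_borel"
    unfolding path_filtration_def using \<open>0 \<le> s\<close> by (intro measurable_coordinate) auto
  define g where "g y = (LINT v|Q y. f (v t))" for y
  have "g \<in> borel_measurable circle_borel"
    unfolding g_def by (rule markov_laws_kernel_measurable[OF Q]) measurable
  from measurable_compose[OF Xs this] have g [measurable]: "(\<lambda>w. g (w s)) \<in> borel_measurable (path_filtration s)" .
  note [measurable] = measurable_path_filtration_path_space[OF g]
  have in_circle: "w s \<in> circle" if "w \<in> space (Q x)" for w
    using that D(3) path_in_circle \<open>0 \<le> s\<close> by auto
  have gK: "\<bar>g (w s)\<bar> \<le> K" if "w \<in> space (Q x)" for w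
    unfolding g_def by (rule prob_space_abs_integral_le[OF markov_lawsD(1)[OF Q in_circle[OF that]] K(2)])
  have YQ [measurable]: "Y \<in> borel_measurable (Q x)"
    using measurable_path_filtration_path_space[OF Y(1)] D(2) by (simp cong: measurable_cong_sets)
  have fQ [measurable]: "(\<lambda>w. f (w (s + t))) \<in> borel_measurable (Q x)"
    using measurable_compose[OF X[of "s + t"] C0_circle_measurable[OF f]] assms D(2)
    by (simp cong: measurable_cong_sets)
  have int_f: "integrable (Q x) (\<lambda>w. f (w (s + t)))"
    by (rule integrable_const_bound[where B = K]) (use K fQ in auto)
  have int_g: "integrable (Q x) (\<lambda>w. g (w s))"
    by (rule integrable_const_bound[where B = K]) (use gK in auto)
  have "AE w in Q x. real_cond_exp (Q x) (path_filtration s) (\<lambda>w. f (w (s + t))) w = g (w s)"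
  proof (rule real_cond_exp_charact[OF _ int_f int_g g])
    fix B assume B: "B \<in> sets (path_filtration s)"
    have B' [measurable]: "B \<in> sets (Q x)"
      using B D(2) subalgebra_path_filtration by (auto simp: subalgebra_def)
    have fK: "(\<lambda>y. ennreal (f y + K)) \<in> borel_measurable circle_borel"
      by (rule measurable_restrict_space1) measurable
    have "(\<integral>w\<in>B. (f (w (s + t)) + K) \<partial>Q x) = enn2real (\<integral>\<^sup>+w. ennreal (f (w (s + t)) + K) * indicator B w \<partial>Q x)"
      unfolding set_lebesgue_integral_def
    proof (subst integral_eq_nn_integral)
      show "AE w in Q x. 0 \<le> indicator B w *\<^sub>R (f (w (s + t)) + K)"
        by (intro AE_I2) (simp add: nn)
    qed (use assms in \<open>auto intro!: arg_cong[where f = enn2real] nn_integral_cong simp: indicator_def\<close>)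
    also have "\<dots> = enn2real (\<integral>\<^sup>+w. (\<integral>\<^sup>+v. ennreal (f (v t) + K) \<partial>Q (w s)) * indicator B w \<partial>Q x)"
      using markov_laws_nn_integral[OF Q assms(2-4) B fK] by simp
    also have "(\<integral>\<^sup>+w. (\<integral>\<^sup>+v. ennreal (f (v t) + K) \<partial>Q (w s)) * indicator B w \<partial>Q x)
      = (\<integral>\<^sup>+w. ennreal (g (w s) + K) * indicator B w \<partial>Q x)"
    proof (intro nn_integral_cong)
      fix w assume w: "w \<in> space (Q x)"
      note Dw = markov_lawsD[OF Q in_circle[OF w]]
      interpret w: prob_space "Q (w s)" by fact
      note [measurable_cong] = Dw(2)
      have int: "integrable (Q (w s)) (\<lambda>v. f (v t))"
        by (rule w.integrable_const_bound[where B = K]) (use K in auto)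
      have "(\<integral>\<^sup>+v. ennreal (f (v t) + K) \<partial>Q (w s)) = ennreal (LINT v|Q (w s). f (v t) + K)"
        by (rule nn_integral_eq_integral) (use int nn in auto)
      also have "(LINT v|Q (w s). f (v t) + K) = g (w s) + K"
        using int by (simp add: g_def w.prob_space)
      finally show "(\<integral>\<^sup>+v. ennreal (f (v t) + K) \<partial>Q (w s)) * indicator B w = ennreal (g (w s) + K) * indicator B w"
        by simp
    qed
    also have "enn2real \<dots> = (\<integral>w\<in>B. (g (w s) + K) \<partial>Q x)"
      unfolding set_lebesgue_integral_def
    proof (subst integral_eq_nn_integral)
      show "AE w in Q x. 0 \<le> indicator B w *\<^sub>R (g (w s) + K)"
      proof (intro AE_I2)
        fix w assume "w \<in> space (Q x)"
        then have "0 \<le> g (w s) + K" using gK[of w] by linarith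
        then show "0 \<le> indicator B w *\<^sub>R (g (w s) + K)" by simp
      qed
    qed (auto intro!: arg_cong[where f = enn2real] nn_integral_cong simp: indicator_def)
    finally have "(\<integral>w\<in>B. (f (w (s + t)) + K) \<partial>Q x) = (\<integral>w\<in>B. (g (w s) + K) \<partial>Q x)" .
    moreover have i: "set_integrable (Q x) B (\<lambda>w. f (w (s + t)))" "set_integrable (Q x) B (\<lambda>w. g (w s))"
      "set_integrable (Q x) B (\<lambda>w. K)"
      unfolding set_integrable_def
      by (rule integrable_mult_indicator[OF B'], rule int_f int_g integrable_const)+
    moreover note set_integral_add(2)[OF i(1) i(3)] set_integral_add(2)[OF i(2) i(3)]
    ultimately show "(\<integral>w\<in>B. f (w (s + t)) \<partial>Q x) = (\<integral>w\<in>B. g (w s) \<partial>Q x)"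
      by linarith
  qed
  then have "(LINT w|Q x. Y w * g (w s)) = (LINT w|Q x. Y w * real_cond_exp (Q x) (path_filtration s) (\<lambda>w. f (w (s + t))) w)"
    by (intro integral_cong_AE) (auto simp: measurable_from_subalg[OF subalg])
  also have "\<dots> = (LINT w|Q x. Y w * f (w (s + t)))"
  proof (rule real_cond_exp_intg)
    show "integrable (Q x) (\<lambda>w. Y w * f (w (s + t)))"
    proof (rule integrable_const_bound[where B = "C * K"])
      show "AE w in Q x. norm (Y w * f (w (s + t))) \<le> C * K"
        using K Y(2) D(3) by (intro AE_I2) (auto simp: abs_mult intro!: mult_mono order_trans[OF abs_ge_zero])
    qed measurable
  qed (use Y(1) fQ in auto)
  finally show ?thesis by (simp add: g_def)
qed

section \<open>Feynman--Kac semigroups\<close>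

lemma exp_diff_abs_le:
  fixes x y b :: real
  assumes "x \<le> b" "y \<le> b"
  shows "\<bar>exp x - exp y\<bar> \<le> exp b * \<bar>x - y\<bar>"
proof -
  have *: "exp x - exp y \<le> exp b * \<bar>x - y\<bar>" if "x \<le> b" "y \<le> x" for x y :: real
  proof -
    have "exp x * (1 + (y - x)) \<le> exp x * exp (y - x)"
      using exp_ge_add_one_self[of "y - x"] by (intro mult_left_mono) auto
    then have "exp x - exp y \<le> exp x * (x - y)"
      by (simp add: exp_diff algebra_simps)
    also have "\<dots> \<le> exp b * \<bar>x - y\<bar>" using that by (intro mult_mono) auto
    finally show ?thesis .
  qed
  show ?thesis
  proof (cases "y \<le> x")
    case True
    then have "exp y \<le> exp x" by simp
    then show ?thesis using *[OF assms(1) True] by linarith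
  next
    case False
    then have "exp x \<le> exp y" by simp
    then show ?thesis using *[OF assms(2), of x] False by (simp add: abs_minus_commute)
  qed
qed

text \<open>The forward object: a linear functional of the test function \<open>f\<close>. The
  weight \<open>Y\<close> will depend on the path up to a fixed time \<open>a\<close>, which brings
  in past events and initial factors. The same functional serves a process with drift, with
  \<open>U = 0\<close>, and Brownian motion with a potential.\<close>

definition feynman_kac ::
  "(real \<Rightarrow> real) measure \<Rightarrow> ((real \<Rightarrow> real) \<Rightarrow> real) \<Rightarrow> (real \<Rightarrow> real) \<Rightarrow> real \<Rightarrow> (real \<Rightarrow> real) \<Rightarrow> real" where
  "feynman_kac R Y U s f = (LINT w|R. Y w * exp (- occupation U s w) * f (w s))"

context
  fixes A and Q :: "real \<Rightarrow> (real \<Rightarrow> real) measure" and x a K C :: real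
    and Y :: "(real \<Rightarrow> real) \<Rightarrow> real" and U :: "real \<Rightarrow> real"
  assumes Q: "markov_laws A Q" and x: "x \<in> circle" and a: "0 \<le> (a::real)"
    and Y: "Y \<in> borel_measurable (path_filtration a)" "\<And>w. w \<in> circle_paths \<Longrightarrow> \<bar>Y w\<bar> \<le> C"
    and U: "C0_circle U" "\<And>y. \<bar>U y\<bar> \<le> K"
begin

lemma feynman_kac_measurable_weight:
  assumes "a \<le> s"
  shows "(\<lambda>w. Y w * exp (- occupation U s w)) \<in> borel_measurable (path_filtration s)"
proof -
  have "Y \<in> borel_measurable (path_filtration s)"
  proof (rule measurable_from_subalg[OF _ Y(1)])
    show "subalgebra (path_filtration s) (path_filtration a)"
      unfolding subalgebra_def path_filtration_def sets_coordinate_algebra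
      using assms order_trans by (auto intro!: sigma_sets_mono') blast
  qed
  then show ?thesis
    using occupation_measurable[OF U(1) _ order_refl, of s] a assms by simp
qed

lemma feynman_kac_weight_le:
  assumes "a \<le> s" "w \<in> circle_paths"
  shows "\<bar>Y w * exp (- occupation U s w)\<bar> \<le> C * exp (K * s)"
proof -
  have "\<bar>occupation U s w\<bar> \<le> K * s"
    using assms a by (intro occupation_abs_le U) auto
  then have "exp (- occupation U s w) \<le> exp (K * s)" by (simp add: abs_le_iff)
  moreover have "0 \<le> C" using Y(2)[OF assms(2)] by linarith
  ultimately show ?thesis
    unfolding abs_mult using Y(2)[OF assms(2)] by (intro mult_mono) auto
qed

lemma feynman_kac_measurable:
  assumes "a \<le> s" and f: "C0_circle f"
  shows "(\<lambda>w. Y w * exp (- occupation U s w) * f (w s)) \<in> borel_measurable (Q x)"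
proof -
  have "(\<lambda>w. w s) \<in> borel_measurable path_space"
    unfolding path_space_def using a assms by (intro measurable_coordinate_borel) auto
  then have "(\<lambda>w. Y w * exp (- occupation U s w) * f (w s)) \<in> borel_measurable path_space"
    using measurable_path_filtration_path_space[OF feynman_kac_measurable_weight[OF assms(1)]]
      C0_circle_measurable[OF f] by measurable
  then show ?thesis using markov_lawsD(2)[OF Q x] by (simp cong: measurable_cong_sets)
qed

lemma feynman_kac_integrand_le:
  assumes "a \<le> s" "w \<in> circle_paths" "\<And>y. \<bar>f y\<bar> \<le> M"
  shows "\<bar>Y w * exp (- occupation U s w) * f (w s)\<bar> \<le> C * exp (K * s) * M"
  unfolding abs_mult[of _ "f _"]
  by (rule mult_mono[OF feynman_kac_weight_le[OF assms(1,2)] assms(3)])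
    (use feynman_kac_weight_le[OF assms(1,2)] in auto)

lemma feynman_kac_integrable:
  assumes "a \<le> s" and f: "C0_circle f"
  shows "integrable (Q x) (\<lambda>w. Y w * exp (- occupation U s w) * f (w s))"
proof -
  obtain M where M: "M > 0" "\<And>x. \<bar>f x\<bar> \<le> M" using C0_circle_bounded[OF f] by blast
  interpret prob_space "Q x" by (rule markov_lawsD[OF Q x])
  show ?thesis
    by (rule integrable_const_bound[where B = "C * exp (K * s) * M"])
      (use feynman_kac_integrand_le[where f = f, OF assms(1) _ M(2)] feynman_kac_measurable[OF assms]
        markov_lawsD(3)[OF Q x] in \<open>auto intro!: AE_I2\<close>)
qed

lemma feynman_kac_add:
  assumes "a \<le> s" "C0_circle f" "C0_circle g"
  shows "feynman_kac (Q x) Y U s (\<lambda>y. f y + g y) = feynman_kac (Q x) Y U s f + feynman_kac (Q x) Y U s g"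
  unfolding feynman_kac_def distrib_left
  by (rule Bochner_Integration.integral_add) (intro feynman_kac_integrable assms)+

lemma feynman_kac_scale:
  "feynman_kac (Q x) Y U s (\<lambda>y. c * f y) = c * feynman_kac (Q x) Y U s f"
proof -
  have "Y w * exp (- occupation U s w) * (c * f (w s)) = c * (Y w * exp (- occupation U s w) * f (w s))" for w
    by simp
  then show ?thesis unfolding feynman_kac_def by (simp only: integral_mult_right_zero)
qed

lemma feynman_kac_abs_le:
  assumes "a \<le> s" "\<And>y. \<bar>f y\<bar> \<le> M"
  shows "\<bar>feynman_kac (Q x) Y U s f\<bar> \<le> C * exp (K * s) * M"
  unfolding feynman_kac_def
  by (rule prob_space_abs_integral_le[OF markov_lawsD(1)[OF Q x]])
    (use feynman_kac_integrand_le[where f = f, OF assms(1) _ assms(2)] markov_lawsD(3)[OF Q x] in auto)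

lemma feynman_kac_continuous:
  assumes f: "C0_circle f"
  shows "continuous_on {a..} (\<lambda>s. feynman_kac (Q x) Y U s f)"
proof -
  obtain M where M: "M > 0" "\<And>x. \<bar>f x\<bar> \<le> M" using C0_circle_bounded[OF f] by blast
  note D = markov_lawsD[OF Q x]
  interpret prob_space "Q x" by fact
  have "0 \<le> C" "0 \<le> K" using Y(2) not_empty D(3) U(2)[of 0] by fastforce+
  show ?thesis
    unfolding feynman_kac_def
  proof (rule continuous_on_LINT[where C = "\<lambda>s. C * exp (K * s) * M"])
    show "mono (\<lambda>s. C * exp (K * s) * M)"
      using \<open>0 \<le> C\<close> \<open>0 \<le> K\<close> M(1) by (auto intro!: monoI mult_mono mult_left_mono)
    fix w assume "w \<in> space (Q x)"
    then have w: "w \<in> circle_paths" using D by simp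
    show "continuous_on {a..} (\<lambda>s. Y w * exp (- occupation U s w) * f (w s))"
      by (intro continuous_intros continuous_on_subset[OF occupation_DERIV(2)[OF w U(1) order_refl]]
          continuous_on_subset[OF continuous_on_path[OF w f]]) (use a in auto)
  qed (use feynman_kac_measurable[OF _ f] feynman_kac_integrand_le[where f = f, OF _ _ M(2)] D(3) in
      \<open>auto simp: finite_measure_axioms\<close>)
qed

text \<open>A product rule at the level of expectations. The change of the exponential weight is
  handled pathwise by dominated convergence, the change of \<open>f (w s)\<close> by the Markov
  property and the generator, which accounts for the one-sided derivative.\<close>

lemma feynman_kac_DERIV:
  assumes f: "C2_circle f" and Af: "C0_circle (A f)" and s: "a \<le> s"
  shows "((\<lambda>s. feynman_kac (Q x) Y U s f) has_real_derivative
    feynman_kac (Q x) Y U s (\<lambda>y. A f y - U y * f y)) (at_right s)"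
  unfolding has_field_derivative_iff
proof (rule tendsto_at_right_sequentially[of s "s + 1"])
  fix r assume r: "\<And>n. s < r n" "\<And>n. r n < s + 1" "r \<longlonglongrightarrow> s"
  note D = markov_lawsD[OF Q x]
  interpret prob_space "Q x" by fact
  note f0 = C2_circle_C0(1)[OF f]
  obtain M where M: "M > 0" "\<And>x. \<bar>f x\<bar> \<le> M" using C0_circle_bounded[OF f0] by blast
  have "0 \<le> C" "0 \<le> K" using Y(2) not_empty D(3) U(2)[of 0] by fastforce+
  have "0 \<le> s" using a s by simp
  have in_circle: "w s \<in> circle" if "w \<in> space (Q x)" for w
    using that D(3) path_in_circle \<open>0 \<le> s\<close> by auto
  let ?Z = "\<lambda>w. Y w * exp (- occupation U s w)"
  note Z = feynman_kac_measurable_weight[OF s] feynman_kac_weight_le[OF s]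
  \<comment> \<open>The difference quotient splits into \<open>q\<close>, where the weight moves
    while \<open>f\<close> is already evaluated at time \<open>r n\<close>, and \<open>p\<close>,
    where the weight stays frozen at time \<open>s\<close> and the Markov property can restart the
    process.\<close>
  define q where "q n w = Y w * (exp (- occupation U (r n) w) - exp (- occupation U s w)) / (r n - s) * f (w (r n))" for n w
  define p where "p n y = ((LINT v|Q y. f (v (r n - s))) - f y) / (r n - s)" for n y
  have rs: "a \<le> r n" "0 \<le> r n - s" "r n - s > 0" "s + (r n - s) = r n" for n
    using r(1)[of n] s by auto
  have X: "(\<lambda>w. w t) \<in> borel_measurable (Q x)" if "t \<ge> 0" for t
    using measurable_coordinate_borel[of t "{0..}"] that D(2)
    by (simp add: path_space_def cong: measurable_cong_sets)
  have Z_Q [measurable]: "?Z \<in> borel_measurable (Q x)"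
    using measurable_path_filtration_path_space[OF Z(1)] D(2) by (simp cong: measurable_cong_sets)
  have Zr_Q: "(\<lambda>w. Y w * exp (- occupation U (r n) w)) \<in> borel_measurable (Q x)" for n
    using measurable_path_filtration_path_space[OF feynman_kac_measurable_weight[OF rs(1)]] D(2)
    by (simp cong: measurable_cong_sets)
  have "0 \<le> r n" for n using rs(1)[of n] a by simp
  then have fr_Q: "(\<lambda>w. f (w (r n))) \<in> borel_measurable (Q x)" for n
    by (rule measurable_compose[OF X C0_circle_measurable[OF f0]])
  note [measurable] = C0_circle_measurable[OF f0] C0_circle_measurable[OF U(1)] C0_circle_measurable[OF Af] X[OF \<open>0 \<le> s\<close>]
  have p_meas: "(\<lambda>w. p n (w s)) \<in> borel_measurable (Q x)" for n
  proof -
    have "(\<lambda>v. v (r n - s)) \<in> borel_measurable path_space"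
      unfolding path_space_def using rs(2)[of n] by (intro measurable_coordinate_borel) auto
    then have "(\<lambda>y. LINT v|Q y. f (v (r n - s))) \<in> borel_measurable circle_borel"
      by (intro markov_laws_kernel_measurable[OF Q] measurable_compose[OF _ C0_circle_measurable[OF f0]])
    then have "p n \<in> borel_measurable circle_borel"
      unfolding p_def
      by (intro borel_measurable_divide borel_measurable_diff borel_measurable_const
          measurable_restrict_space1[OF C0_circle_measurable[OF f0]])
    moreover have "(\<lambda>w. w s) \<in> Q x \<rightarrow>\<^sub>M circle_borel"
      using X[OF \<open>0 \<le> s\<close>] in_circle by (auto simp: measurable_restrict_space2_iff)
    ultimately show ?thesis by (rule measurable_compose[rotated])
  qed
  have quotient: "(feynman_kac (Q x) Y U (r n) f - feynman_kac (Q x) Y U s f) / (r n - s)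
    = (LINT w|Q x. q n w) + (LINT w|Q x. ?Z w * p n (w s))" for n
  proof -
    have int1: "integrable (Q x) (\<lambda>w. ?Z w * f (w (r n)))"
    proof (rule integrable_const_bound[where B = "C * exp (K * s) * M"])
      show "AE w in Q x. norm (?Z w * f (w (r n))) \<le> C * exp (K * s) * M"
        unfolding real_norm_def abs_mult[of _ "f _"]
        using Z(2) M D(3) by (intro AE_I2 mult_mono) (auto intro: order_trans[OF abs_ge_zero])
      show "random_variable borel (\<lambda>w. ?Z w * f (w (r n)))"
        by (intro borel_measurable_times Z_Q fr_Q)
    qed
    note int2 = feynman_kac_integrable[OF rs(1) f0, of n] feynman_kac_integrable[OF s f0]
    have "feynman_kac (Q x) Y U (r n) f - (LINT w|Q x. ?Z w * f (w (r n)))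
      = (LINT w|Q x. Y w * exp (- occupation U (r n) w) * f (w (r n)) - ?Z w * f (w (r n)))"
      unfolding feynman_kac_def using int1 int2 by simp
    also have "\<dots> = (LINT w|Q x. (r n - s) * q n w)"
      by (rule Bochner_Integration.integral_cong) (use rs(3)[of n] in \<open>auto simp: q_def field_simps\<close>)
    finally have 1: "feynman_kac (Q x) Y U (r n) f - (LINT w|Q x. ?Z w * f (w (r n))) = (r n - s) * (LINT w|Q x. q n w)"
      by simp
    have "(LINT w|Q x. ?Z w * f (w (r n))) = (LINT w|Q x. ?Z w * (LINT v|Q (w s). f (v (r n - s))))"
      using markov_laws_LINT[OF Q x \<open>0 \<le> s\<close> rs(2)[of n] Z f0] rs(4)[of n] by simp
    also have "\<dots> = (LINT w|Q x. ?Z w * f (w s) + (r n - s) * (?Z w * p n (w s)))"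
      by (rule Bochner_Integration.integral_cong) (use rs(3)[of n] in \<open>auto simp: p_def field_simps\<close>)
    also have "\<dots> = feynman_kac (Q x) Y U s f + (r n - s) * (LINT w|Q x. ?Z w * p n (w s))"
    proof -
      have "integrable (Q x) (\<lambda>w. ?Z w * p n (w s))"
      proof (rule integrable_const_bound[where B = "C * exp (K * s) * (2 * M / (r n - s))"])
        have "\<bar>p n (w s)\<bar> \<le> 2 * M / (r n - s)" if w: "w \<in> space (Q x)" for w
        proof -
          have "\<bar>LINT v|Q (w s). f (v (r n - s))\<bar> \<le> M"
            by (rule prob_space_abs_integral_le[OF markov_lawsD(1)[OF Q in_circle[OF w]] M(2)])
          then have "\<bar>(LINT v|Q (w s). f (v (r n - s))) - f (w s)\<bar> \<le> 2 * M"
            using M(2)[of "w s"] by linarith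
          then show ?thesis
            unfolding p_def abs_divide using rs(3)[of n] by (simp add: divide_right_mono)
        qed
        then show "AE w in Q x. norm (?Z w * p n (w s)) \<le> C * exp (K * s) * (2 * M / (r n - s))"
          unfolding real_norm_def abs_mult[of _ "p _ _"]
          using Z(2) D(3) by (intro AE_I2 mult_mono) (auto intro: order_trans[OF abs_ge_zero])
        show "random_variable borel (\<lambda>w. ?Z w * p n (w s))" using p_meas by measurable
      qed
      then show ?thesis unfolding feynman_kac_def using int2 by simp
    qed
    finally have 2: "(LINT w|Q x. ?Z w * f (w (r n)))
      = feynman_kac (Q x) Y U s f + (r n - s) * (LINT w|Q x. ?Z w * p n (w s))" .
    have "feynman_kac (Q x) Y U (r n) f - feynman_kac (Q x) Y U s f
      = (r n - s) * ((LINT w|Q x. q n w) + (LINT w|Q x. ?Z w * p n (w s)))"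
      using 1 2 by (simp add: distrib_left)
    then show ?thesis using rs(3)[of n] by simp
  qed
  \<comment> \<open>Since \<open>r n < s + 1\<close>, all occupation integrals involved are at least
    \<open>- K * (s + 1)\<close>; the factor \<open>exp (K * (s + 1))\<close> is the resulting
    Lipschitz constant of the exponential, and \<open>K\<close> that of the occupation
    integral.\<close>
  have lim_q: "(\<lambda>n. LINT w|Q x. q n w) \<longlonglongrightarrow> (LINT w|Q x. ?Z w * (- U (w s) * f (w s)))"
  proof (rule integral_dominated_convergence[where w = "\<lambda>_. C * (exp (K * (s + 1)) * K) * M"])
    show "(\<lambda>w. ?Z w * (- U (w s) * f (w s))) \<in> borel_measurable (Q x)" by measurable
    show "q n \<in> borel_measurable (Q x)" for n
    proof -
      have "q n = (\<lambda>w. (Y w * exp (- occupation U (r n) w) - ?Z w) / (r n - s) * f (w (r n)))"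
        by (auto simp: q_def algebra_simps)
      also have "\<dots> \<in> borel_measurable (Q x)"
        by (intro borel_measurable_times borel_measurable_divide borel_measurable_diff
            borel_measurable_const Z_Q Zr_Q fr_Q)
      finally show ?thesis .
    qed
    show "AE w in Q x. (\<lambda>n. q n w) \<longlonglongrightarrow> ?Z w * (- U (w s) * f (w s))"
    proof (intro AE_I2)
      fix w assume "w \<in> space (Q x)"
      then have w: "w \<in> circle_paths" using D by simp
      have "((\<lambda>s. exp (- occupation U s w)) has_real_derivative exp (- occupation U s w) * - U (w s)) (at_right s)"
        using occupation_DERIV(1)[OF w U(1) \<open>0 \<le> s\<close>] by (auto intro!: derivative_eq_intros)
      then have "((\<lambda>t. (exp (- occupation U t w) - exp (- occupation U s w)) / (t - s))
        \<longlongrightarrow> exp (- occupation U s w) * - U (w s)) (at_right s)"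
        by (simp add: has_field_derivative_iff)
      moreover have "filterlim r (at_right s) sequentially"
        using r by (auto simp: filterlim_at intro!: always_eventually)
      ultimately have 1: "(\<lambda>n. (exp (- occupation U (r n) w) - exp (- occupation U s w)) / (r n - s))
        \<longlonglongrightarrow> exp (- occupation U s w) * - U (w s)"
        by (rule filterlim_compose)
      have 2: "(\<lambda>n. f (w (r n))) \<longlonglongrightarrow> f (w s)"
        using continuous_on_path[OF w f0] r(3) rs(1) a s \<open>0 \<le> s\<close>
        unfolding continuous_on_sequentially comp_def by (metis atLeast_iff order_trans)
      have "(\<lambda>n. Y w * ((exp (- occupation U (r n) w) - exp (- occupation U s w)) / (r n - s)) * f (w (r n)))
        \<longlonglongrightarrow> Y w * (exp (- occupation U s w) * - U (w s)) * f (w s)"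
        by (intro tendsto_intros 1 2)
      then show "(\<lambda>n. q n w) \<longlonglongrightarrow> ?Z w * (- U (w s) * f (w s))"
        by (simp add: q_def[abs_def] ac_simps)
    qed
    show "AE w in Q x. norm (q n w) \<le> C * (exp (K * (s + 1)) * K) * M" for n
    proof (intro AE_I2)
      fix w assume "w \<in> space (Q x)"
      then have w: "w \<in> circle_paths" using D by simp
      have b: "- occupation U t w \<le> K * (s + 1)" if "0 \<le> t" "t \<le> s + 1" for t
      proof -
        have "\<bar>occupation U t w\<bar> \<le> K * t" using that by (intro occupation_abs_le w U) auto
        also have "\<dots> \<le> K * (s + 1)" using that \<open>0 \<le> K\<close> by (intro mult_left_mono) auto
        finally show ?thesis by linarith
      qed
      have "\<bar>exp (- occupation U (r n) w) - exp (- occupation U s w)\<bar>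
        \<le> exp (K * (s + 1)) * \<bar>- occupation U (r n) w - - occupation U s w\<bar>"
        by (rule exp_diff_abs_le) (use b[of "r n"] b[of s] r(1,2)[of n] \<open>0 \<le> s\<close> in auto)
      also have "\<bar>- occupation U (r n) w - - occupation U s w\<bar> = \<bar>occupation U (r n) w - occupation U s w\<bar>"
        by simp
      also have "exp (K * (s + 1)) * \<dots> \<le> exp (K * (s + 1)) * (K * (r n - s))"
        using rs[of n] \<open>0 \<le> s\<close> by (intro mult_left_mono occupation_diff_le w U) auto
      finally have "\<bar>exp (- occupation U (r n) w) - exp (- occupation U s w)\<bar> / (r n - s) \<le> exp (K * (s + 1)) * K"
        using rs(3)[of n] by (simp add: field_simps)
      then have "\<bar>Y w\<bar> * (\<bar>exp (- occupation U (r n) w) - exp (- occupation U s w)\<bar> / (r n - s)) * \<bar>f (w (r n))\<bar>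
        \<le> C * (exp (K * (s + 1)) * K) * M"
        using Y(2)[OF w] M \<open>0 \<le> C\<close> \<open>0 \<le> K\<close> rs(3)[of n] by (intro mult_mono) auto
      then show "norm (q n w) \<le> C * (exp (K * (s + 1)) * K) * M"
        using rs(3)[of n] by (simp add: q_def abs_mult)
    qed
  qed auto
  \<comment> \<open>The restarted process begins at the random point \<open>w s\<close>, so here the
    convergence to the generator has to be uniform in the starting point.\<close>
  have lim_p: "(\<lambda>n. LINT w|Q x. ?Z w * p n (w s)) \<longlonglongrightarrow> (LINT w|Q x. ?Z w * A f (w s))"
  proof (rule tendstoI)
    fix e :: real assume "e > 0"
    \<comment> \<open>The summand 1 keeps the denominator positive when
      \<open>C = 0\<close>.\<close>
    define d where "d = e / (C * exp (K * s) + 1)"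
    have Cpos: "C * exp (K * s) \<ge> 0" using \<open>0 \<le> C\<close> by simp
    then have d: "d > 0" "C * exp (K * s) * d < e"
      using \<open>e > 0\<close> by (auto simp: d_def field_simps add_pos_nonneg)
    have "uniform_limit circle (\<lambda>t y. ((LINT w|Q y. f (w t)) - f y) / t) (A f) (at_right 0)"
      using Q f by (auto simp: markov_laws_def)
    then have "eventually (\<lambda>t. \<forall>y\<in>circle. dist (((LINT w|Q y. f (w t)) - f y) / t) (A f y) < d) (at_right 0)"
      using \<open>d > 0\<close> by (rule uniform_limitD)
    moreover have "filterlim (\<lambda>n. r n - s) (at_right 0) sequentially"
      using r tendsto_diff[OF r(3) tendsto_const[of s]] by (auto simp: filterlim_at intro!: always_eventually)
    ultimately have "eventually (\<lambda>n. \<forall>y\<in>circle. dist (p n y) (A f y) < d) sequentially"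
      unfolding filterlim_iff p_def by blast
    then show "eventually (\<lambda>n. dist (LINT w|Q x. ?Z w * p n (w s)) (LINT w|Q x. ?Z w * A f (w s)) < e) sequentially"
    proof eventually_elim
      case (elim n)
      have le: "\<bar>?Z w * (p n (w s) - A f (w s))\<bar> \<le> C * exp (K * s) * d" if "w \<in> space (Q x)" for w
        unfolding abs_mult[of _ "p _ _ - _"] using elim in_circle[OF that] Z(2)[of w] D(3) that
        by (intro mult_mono) (auto simp: dist_real_def intro: order_trans[OF abs_ge_zero] less_imp_le)
      have i1: "integrable (Q x) (\<lambda>w. ?Z w * (p n (w s) - A f (w s)))"
      proof (rule integrable_const_bound[where B = "C * exp (K * s) * d"])
        show "random_variable borel (\<lambda>w. ?Z w * (p n (w s) - A f (w s)))"
          using p_meas[of n] by measurable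
      qed (use le in \<open>auto intro!: AE_I2\<close>)
      note i2 = feynman_kac_integrable[OF s Af]
      have "(LINT w|Q x. ?Z w * p n (w s)) = (LINT w|Q x. ?Z w * (p n (w s) - A f (w s)) + ?Z w * A f (w s))"
        by (simp add: right_diff_distrib)
      also have "\<dots> = (LINT w|Q x. ?Z w * (p n (w s) - A f (w s))) + (LINT w|Q x. ?Z w * A f (w s))"
        by (rule Bochner_Integration.integral_add[OF i1 i2])
      finally have "dist (LINT w|Q x. ?Z w * p n (w s)) (LINT w|Q x. ?Z w * A f (w s))
        = \<bar>LINT w|Q x. ?Z w * (p n (w s) - A f (w s))\<bar>"
        by (simp add: dist_real_def)
      also have "\<dots> \<le> C * exp (K * s) * d"
        by (rule prob_space_abs_integral_le[OF D(1) le])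
      finally show ?case using d by simp
    qed
  qed
  have "(\<lambda>n. (feynman_kac (Q x) Y U (r n) f - feynman_kac (Q x) Y U s f) / (r n - s))
    \<longlonglongrightarrow> (LINT w|Q x. ?Z w * (- U (w s) * f (w s))) + (LINT w|Q x. ?Z w * A f (w s))"
    unfolding quotient by (rule tendsto_add[OF lim_q lim_p])
  also have "(LINT w|Q x. ?Z w * (- U (w s) * f (w s))) + (LINT w|Q x. ?Z w * A f (w s))
    = feynman_kac (Q x) Y U s (\<lambda>y. A f y - U y * f y)"
  proof -
    have "feynman_kac (Q x) Y U s (\<lambda>y. A f y - U y * f y) = feynman_kac (Q x) Y U s (\<lambda>y. - U y * f y + A f y)"
      by simp
    also have "\<dots> = feynman_kac (Q x) Y U s (\<lambda>y. - U y * f y) + feynman_kac (Q x) Y U s (A f)"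
      by (rule feynman_kac_add[OF s]) (intro C0_circle_intros U f0 Af)+
    finally show ?thesis by (simp add: feynman_kac_def)
  qed
  finally show "(\<lambda>n. (feynman_kac (Q x) Y U (r n) f - feynman_kac (Q x) Y U s f) / (r n - s))
    \<longlonglongrightarrow> feynman_kac (Q x) Y U s (\<lambda>y. A f y - U y * f y)" .
qed simp

end

section \<open>Change of drift\<close>

lemma feynman_kac_one [simp]:
  "feynman_kac R (\<lambda>_. 1) (\<lambda>_. 0) s f = (LINT w|R. f (w s))"
  by (simp add: feynman_kac_def occupation_def set_lebesgue_integral_def)

text \<open>Without a potential, Duhamel's derivative is zero, so the expectation of
  \<open>u (t - s) (w s)\<close> is constant in \<open>s\<close>; its values at \<open>s = t\<close>
  and \<open>s = 0\<close> are the two sides.\<close>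

lemma brownian_heat_poly:
  assumes P: "brownian_laws P" and u: "heat_poly u" and x: "x \<in> circle" and "0 \<le> t"
  shows "(LINT w|P x. u 0 (w t)) = u t x"
proof -
  have P': "markov_laws half_laplacian P" using P by (simp add: brownian_laws_def)
  have Y: "(\<lambda>_. 1) \<in> borel_measurable (path_filtration 0)" "\<And>w. w \<in> circle_paths \<Longrightarrow> \<bar>1\<bar> \<le> (1 :: real)"
    and U: "C0_circle (\<lambda>_. 0)" "\<And>y. \<bar>0\<bar> \<le> (0 :: real)"
    by (auto intro: C0_circle_intros)
  note FK = P' x order_refl Y U
  let ?\<eta> = "\<lambda>s f. feynman_kac (P x) (\<lambda>_. 1) (\<lambda>_. 0) s f"
  have D: "continuous_on {0..} (\<lambda>s. ?\<eta> s (u (t - s))) \<and>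
    (\<forall>s\<ge>0. ((\<lambda>s. ?\<eta> s (u (t - s))) has_real_derivative - ?\<eta> s (\<lambda>y. 0 * u (t - s) y)) (at_right s))"
  proof (rule heat_poly_duhamel[OF u, where \<eta> = ?\<eta> and U = "\<lambda>_. 0" and t = t and a = 0])
    show "?\<eta> s (\<lambda>y. f y + g y) = ?\<eta> s f + ?\<eta> s g" if "0 \<le> s" "C0_circle f" "C0_circle g" for s f g
      by (rule feynman_kac_add[where Y = "\<lambda>_. 1" and U = "\<lambda>_. 0", OF FK that])
    show "?\<eta> s (\<lambda>y. c * f y) = c * ?\<eta> s f" for s f c
      by (rule feynman_kac_scale[where Y = "\<lambda>_. 1" and U = "\<lambda>_. 0", OF FK])
    show "continuous_on {0..} (\<lambda>s. ?\<eta> s f)" if "C2_circle f" for f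
      by (rule feynman_kac_continuous[where Y = "\<lambda>_. 1" and U = "\<lambda>_. 0", OF FK C2_circle_C0(1)[OF that]])
    show "((\<lambda>s. ?\<eta> s f) has_real_derivative ?\<eta> s (\<lambda>y. half_laplacian f y - 0 * f y)) (at_right s)"
      if "C2_circle f" "0 \<le> s" for f s
      by (rule feynman_kac_DERIV[where A = half_laplacian and f = f and Y = "\<lambda>_. 1" and U = "\<lambda>_. 0", OF FK that(1) half_laplacian_C0[OF that(1)] that(2)])
    show "C0_circle (\<lambda>_. 0)" by (rule U)
  qed
  have "\<bar>?\<eta> t (u (t - t)) - ?\<eta> 0 (u (t - 0))\<bar> \<le> 0 - 0"
  proof (rule right_derivative_abs_le[where c = "\<lambda>s. ?\<eta> s (u (t - s))" and c' = "\<lambda>_. 0" and d = "\<lambda>_. 0" and d' = "\<lambda>_. 0"])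
    show "continuous_on {0..t} (\<lambda>s. ?\<eta> s (u (t - s)))"
      by (rule continuous_on_subset[OF D[THEN conjunct1]]) auto
    show "((\<lambda>s. ?\<eta> s (u (t - s))) has_real_derivative 0) (at_right s)" if "0 \<le> s" "s < t" for s
      using D that by (simp add: feynman_kac_def)
  qed (use \<open>0 \<le> t\<close> in auto)
  then have "(LINT w|P x. u 0 (w t)) = (LINT w|P x. u t (w 0))" by simp
  also have "\<dots> = (LINT w|P x. u t x)"
  proof (rule integral_cong_AE)
    have "(\<lambda>w. w 0) \<in> borel_measurable (P x)"
      using measurable_coordinate_borel[of 0 "{0..}"] markov_lawsD(2)[OF P' x]
      by (simp add: path_space_def cong: measurable_cong_sets)
    from measurable_compose[OF this C0_circle_measurable[OF heat_poly_C0[OF u]]]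
    show "(\<lambda>w. u t (w 0)) \<in> borel_measurable (P x)" .
    show "AE w in P x. u t (w 0) = u t x" using markov_lawsD(4)[OF P' x] by eventually_elim simp
  qed simp
  also have "\<dots> = u t x" using markov_lawsD(1)[OF P' x] by (simp add: prob_space.prob_space)
  finally show ?thesis .
qed

text \<open>The maximum principle for the heat flow, read off from Brownian motion: the flow
  averages its initial value. \<open>frac\<close> moves \<open>x\<close> into the fundamental
  domain, where the laws are specified.\<close>

lemma heat_poly_contraction:
  assumes P: "brownian_laws P" and u: "heat_poly u" and "0 \<le> t" and "\<And>x. \<bar>u 0 x\<bar> \<le> M"
  shows "\<bar>u t x\<bar> \<le> M"
proof -
  have P': "markov_laws half_laplacian P" using P by (simp add: brownian_laws_def)
  have "\<bar>u t (frac x)\<bar> \<le> M"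
    unfolding brownian_heat_poly[OF P u frac_in_circle \<open>0 \<le> t\<close>, symmetric]
    by (rule prob_space_abs_integral_le[OF markov_lawsD(1)[OF P' frac_in_circle] assms(4)])
  then show ?thesis
    using periodic1_frac[of "u t" x] heat_poly_C0[OF u, of t] by (simp add: C0_circle_def)
qed

section \<open>Doob transform by the exponential of \<open>g\<close>\<close>

definition tilt_potential :: "(real \<Rightarrow> real) \<Rightarrow> real \<Rightarrow> real" where
  "tilt_potential g x = (deriv (deriv g) x + (deriv g x)\<^sup>2) / 2"

definition drift_generator :: "(real \<Rightarrow> real) \<Rightarrow> (real \<Rightarrow> real) \<Rightarrow> real \<Rightarrow> real" where
  "drift_generator g f x = half_laplacian f x + deriv g x * deriv f x"

lemma tilt_potential_C0: "C2_circle g \<Longrightarrow> C0_circle (tilt_potential g)"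
  unfolding tilt_potential_def[abs_def] by (intro C0_circle_intros C2_circle_C0) auto

lemma drift_generator_C0: "C2_circle g \<Longrightarrow> C2_circle f \<Longrightarrow> C0_circle (drift_generator g f)"
  unfolding drift_generator_def[abs_def] by (intro C0_circle_intros C2_circle_C0 half_laplacian_C0) auto

lemma tilting_exponent_eq:
  "tilting_exponent g T w = g (w T) - g (w 0) - occupation (tilt_potential g) T w"
  by (simp add: tilting_exponent_def occupation_def tilt_potential_def set_lebesgue_integral_def)

lemma C2_circle_const: "C2_circle (\<lambda>x. c)"
  by (rule C2_circleI(1)[of _ "\<lambda>_. 0" "\<lambda>_. 0"]) (auto simp: periodic1_def)

lemma C2_circle_uminus: "C2_circle f \<Longrightarrow> C2_circle (\<lambda>x. - f x)"
  using C2_circle_mult(1)[OF C2_circle_const[of "-1"]] by simp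

text \<open>The conjugation behind the Doob transform: the cross term of the product rule becomes
  the drift, and the potential cancels the Laplacian of \<open>exp g\<close>.\<close>

lemma half_laplacian_exp_mult:
  assumes "C2_circle g" "C2_circle f"
  shows "half_laplacian (\<lambda>x. exp (g x) * f x) x - tilt_potential g x * (exp (g x) * f x)
    = exp (g x) * drift_generator g f x"
  unfolding C2_circle_mult(2)[OF C2_circle_exp(1)[OF assms(1)] assms(2)] C2_circle_exp[OF assms(1)]
  by (simp add: drift_generator_def tilt_potential_def algebra_simps)

text \<open>The exponent is distributed over three places: its end value joins the test function,
  its initial value the weight, and the occupation integral becomes the potential.\<close>

lemma tilted_integral_eq_feynman_kac:
  "(LINT w|R. Y w * exp (tilting_exponent g s w) * f (w s))
    = feynman_kac R (\<lambda>w. Y w * exp (- g (w 0))) (tilt_potential g) s (\<lambda>y. exp (g y) * f y)"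
  unfolding feynman_kac_def tilting_exponent_eq
  by (intro Bochner_Integration.integral_cong) (auto simp: exp_diff exp_minus exp_add field_simps)

lemma initial_weight:
  assumes g: "C2_circle g" and "0 \<le> a" and B: "B \<in> sets (path_filtration a)"
  obtains C where "(\<lambda>w. indicator B w * exp (- g (w 0))) \<in> borel_measurable (path_filtration a)"
    "\<And>w. w \<in> circle_paths \<Longrightarrow> \<bar>indicator B w * exp (- g (w 0))\<bar> \<le> C"
proof -
  have C0: "C0_circle (\<lambda>x. exp (- g x))" by (intro C0_circle_intros C2_circle_C0 g)
  obtain C where C: "C > 0" "\<And>x. \<bar>exp (- g x)\<bar> \<le> C" using C0_circle_bounded[OF C0] by metis
  show ?thesis
  proof (rule that)
    have "(\<lambda>w. w 0) \<in> borel_measurable (path_filtration a)"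
      unfolding path_filtration_def by (rule measurable_coordinate_borel) (use assms in auto)
    from measurable_compose[OF this C0_circle_measurable[OF C0]]
    show "(\<lambda>w. indicator B w * exp (- g (w 0))) \<in> borel_measurable (path_filtration a)"
      using B by measurable
    show "\<bar>indicator B w * exp (- g (w 0))\<bar> \<le> C" for w
      using C(2)[of "w 0"] C(1) by (auto simp: indicator_def)
  qed
qed

text \<open>The time step of the cylinder induction. With test functions divided by
  \<open>exp g\<close>, both sides solve the same forward equation from time \<open>a\<close> on, so
  agreement at \<open>a\<close> on the event \<open>B\<close> persists.\<close>

lemma drift_laws_propagate:
  assumes P: "brownian_laws P" and Q: "markov_laws (drift_generator g) Q" and g: "C2_circle g"
    and x: "x \<in> circle" and a: "0 \<le> a" "a \<le> s" and B: "B \<in> sets (path_filtration a)"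
    and init: "\<And>f. C0_circle f \<Longrightarrow> (LINT w|Q x. indicator B w * f (w a))
      = (LINT w|P x. indicator B w * exp (tilting_exponent g a w) * f (w a))"
    and f: "C0_circle f"
  shows "(LINT w|Q x. indicator B w * f (w s))
    = (LINT w|P x. indicator B w * exp (tilting_exponent g s w) * f (w s))"
proof -
  have P': "markov_laws half_laplacian P" using P by (simp add: brownian_laws_def)
  obtain C where Y: "(\<lambda>w. indicator B w * exp (- g (w 0))) \<in> borel_measurable (path_filtration a)"
    "\<And>w. w \<in> circle_paths \<Longrightarrow> \<bar>indicator B w * exp (- g (w 0))\<bar> \<le> C"
    using initial_weight[OF g a(1) B] by blast
  have Y': "(indicator B :: _ \<Rightarrow> real) \<in> borel_measurable (path_filtration a)"
    "\<And>w. w \<in> circle_paths \<Longrightarrow> \<bar>indicator B w\<bar> \<le> (1 :: real)"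
    using B by (auto simp: indicator_def)
  note U = tilt_potential_C0[OF g]
  obtain K where K: "K > 0" "\<And>y. \<bar>tilt_potential g y\<bar> \<le> K" using C0_circle_bounded[OF U] by blast
  have U': "C0_circle (\<lambda>_. 0)" "\<And>y. \<bar>0\<bar> \<le> (0 :: real)" by (auto intro: C0_circle_intros)
  \<comment> \<open>Testing the \<open>Q\<close> side against \<open>exp (- g y) * f y\<close>
    conjugates its generator into the Laplacian minus \<open>tilt_potential g\<close>, the operator
    that governs \<open>\<beta>\<close>.\<close>
  define \<alpha> where "\<alpha> s f = feynman_kac (Q x) (indicator B) (\<lambda>_. 0) s (\<lambda>y. exp (- g y) * f y)" for s f
  define \<beta> where "\<beta> s f = feynman_kac (P x) (\<lambda>w. indicator B w * exp (- g (w 0))) (tilt_potential g) s f" for s f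
  note FQ = Q x a(1) Y' U'
  note FP = P' x a(1) Y U K(2)
  have C0_exp: "C0_circle (\<lambda>y. exp (- g y) * f y)" if "C0_circle f" for f
    by (intro C0_circle_intros C2_circle_C0 g that)
  have C2_exp: "C2_circle (\<lambda>y. exp (- g y) * f y)" if "C2_circle f" for f
    by (intro C2_circle_mult C2_circle_exp C2_circle_uminus g that)
  obtain N where N: "N > 0" "\<And>y. \<bar>exp (- g y)\<bar> \<le> N"
    using C0_circle_bounded[OF C0_circle_intros(7)[OF C0_circle_intros(5)[OF C2_circle_C0(1)[OF g]]]] by blast
  have \<alpha>_eq: "\<alpha> r f = (LINT w|Q x. indicator B w * (exp (- g (w r)) * f (w r)))" for r f
    by (simp add: \<alpha>_def feynman_kac_def occupation_def set_lebesgue_integral_def)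
  have \<beta>_eq: "\<beta> r (\<lambda>y. exp (g y) * f y) = (LINT w|P x. indicator B w * exp (tilting_exponent g r w) * f (w r))" for r f
    by (simp add: \<beta>_def tilted_integral_eq_feynman_kac)
  let ?\<eta> = "\<lambda>r f. \<alpha> r f - \<beta> r f"
  have "0 \<le> C"
  proof -
    obtain w where "w \<in> circle_paths"
      using prob_space.not_empty[OF markov_lawsD(1)[OF P' x]] markov_lawsD(3)[OF P' x] by auto
    from Y(2)[OF this] show ?thesis by linarith
  qed
  \<comment> \<open>The factor \<open>exp (g y)\<close> undoes the division. In the constant below,
    \<open>N\<close> bounds \<open>exp (- g y)\<close> for \<open>\<alpha>\<close>, and
    \<open>C * exp (K * s)\<close> bounds the Feynman--Kac weight for \<open>\<beta>\<close> up to
    time \<open>s\<close>.\<close>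
  have "?\<eta> s (\<lambda>y. exp (g y) * f y) = 0"
  proof (rule forward_equation_unique[where \<eta> = ?\<eta> and a = a and b = s and U = "tilt_potential g"
        and C = "N + C * exp (K * s)"])
    show "\<bar>u t y\<bar> \<le> M" if "heat_poly u" "0 \<le> t" "\<And>x. \<bar>u 0 x\<bar> \<le> M" for u t y M
      by (rule heat_poly_contraction[OF P that])
    show "?\<eta> r (\<lambda>y. f y + h y) = ?\<eta> r f + ?\<eta> r h"
      if "a \<le> r" "C0_circle f" "C0_circle h" for r f h
    proof -
      have "\<alpha> r (\<lambda>y. f y + h y) = \<alpha> r f + \<alpha> r h"
        unfolding \<alpha>_def distrib_left
        by (rule feynman_kac_add[where U = "\<lambda>_. 0", OF FQ that(1) C0_exp C0_exp]) (use that in auto)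
      moreover have "\<beta> r (\<lambda>y. f y + h y) = \<beta> r f + \<beta> r h"
        unfolding \<beta>_def
        by (rule feynman_kac_add[where Y = "\<lambda>w. indicator B w * exp (- g (w 0))", OF FP that])
      ultimately show ?thesis by simp
    qed
    show "?\<eta> r (\<lambda>y. c * f y) = c * ?\<eta> r f" if "a \<le> r" "C0_circle f" for r f c
    proof -
      have "\<alpha> r (\<lambda>y. c * f y) = c * \<alpha> r f"
        unfolding \<alpha>_def mult.left_commute[of "exp _" c]
        by (rule feynman_kac_scale[where U = "\<lambda>_. 0", OF FQ])
      moreover have "\<beta> r (\<lambda>y. c * f y) = c * \<beta> r f"
        unfolding \<beta>_def
        by (rule feynman_kac_scale[where Y = "\<lambda>w. indicator B w * exp (- g (w 0))", OF FP])
      ultimately show ?thesis by (simp add: right_diff_distrib)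
    qed
    show "\<bar>?\<eta> r f\<bar> \<le> (N + C * exp (K * s)) * M"
      if r: "a \<le> r" "r \<le> s" and f: "C0_circle f" "\<And>y. \<bar>f y\<bar> \<le> M" for r f M
    proof -
      have "0 \<le> M" using f(2)[of 0] by linarith
      have "\<bar>exp (- g y) * f y\<bar> \<le> N * M" for y
        unfolding abs_mult using N f(2) by (intro mult_mono) (auto intro: less_imp_le)
      from feynman_kac_abs_le[where U = "\<lambda>_. 0" and f = "\<lambda>y. exp (- g y) * f y", OF FQ r(1) this]
      have "\<bar>\<alpha> r f\<bar> \<le> N * M" by (simp add: \<alpha>_def)
      moreover have "\<bar>\<beta> r f\<bar> \<le> C * exp (K * r) * M"
        unfolding \<beta>_def
        by (rule feynman_kac_abs_le[where Y = "\<lambda>w. indicator B w * exp (- g (w 0))" and f = f, OF FP r(1) f(2)])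
      moreover have "C * exp (K * r) * M \<le> C * exp (K * s) * M"
        using r K(1) \<open>0 \<le> C\<close> \<open>0 \<le> M\<close> by (intro mult_right_mono mult_left_mono) auto
      ultimately show ?thesis by (simp add: distrib_right abs_le_iff)
    qed
    show "continuous_on {a..} (\<lambda>r. ?\<eta> r f)" if "C2_circle f" for f
      proof (rule continuous_on_diff)
      show "continuous_on {a..} (\<lambda>r. \<alpha> r f)"
        unfolding \<alpha>_def
        by (rule feynman_kac_continuous[where U = "\<lambda>_. 0" and f = "\<lambda>y. exp (- g y) * f y",
            OF FQ C0_exp[OF C2_circle_C0(1)[OF that]]])
      show "continuous_on {a..} (\<lambda>r. \<beta> r f)"
        unfolding \<beta>_def
        by (rule feynman_kac_continuous[where Y = "\<lambda>w. indicator B w * exp (- g (w 0))" and f = f,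
            OF FP C2_circle_C0(1)[OF that]])
    qed
    show "((\<lambda>r. ?\<eta> r f) has_real_derivative ?\<eta> r (\<lambda>y. half_laplacian f y - tilt_potential g y * f y)) (at_right r)"
      if f: "C2_circle f" and r: "a \<le> r" for f r
    proof (rule DERIV_diff)
      have "drift_generator g (\<lambda>y. exp (- g y) * f y) y
        = exp (- g y) * (half_laplacian f y - tilt_potential g y * f y)" for y
        using half_laplacian_exp_mult[OF g C2_exp[OF f], of y]
        by (simp add: mult.assoc[symmetric] exp_minus_inverse) (simp add: exp_minus field_simps)
      then have e: "(\<lambda>y. drift_generator g (\<lambda>y. exp (- g y) * f y) y - 0 * (exp (- g y) * f y))
        = (\<lambda>y. exp (- g y) * (half_laplacian f y - tilt_potential g y * f y))" by simp
      show "((\<lambda>r. \<alpha> r f) has_real_derivative \<alpha> r (\<lambda>y. half_laplacian f y - tilt_potential g y * f y)) (at_right r)"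
        unfolding \<alpha>_def e[symmetric]
        by (rule feynman_kac_DERIV[where A = "drift_generator g" and U = "\<lambda>_. 0" and f = "\<lambda>y. exp (- g y) * f y",
            OF FQ C2_exp[OF f] drift_generator_C0[OF g C2_exp[OF f]] r])
      show "((\<lambda>r. \<beta> r f) has_real_derivative \<beta> r (\<lambda>y. half_laplacian f y - tilt_potential g y * f y)) (at_right r)"
        unfolding \<beta>_def
        by (rule feynman_kac_DERIV[where A = half_laplacian and f = f and Y = "\<lambda>w. indicator B w * exp (- g (w 0))",
            OF FP f half_laplacian_C0[OF f] r])
    qed
    show "C0_circle (tilt_potential g)" by (rule U)
    show "?\<eta> a f = 0" if f: "C0_circle f" for f
      using init[OF C0_exp[OF f]] \<beta>_eq[of a "\<lambda>y. exp (- g y) * f y"]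
      by (simp add: \<alpha>_eq mult.assoc[symmetric] exp_minus_inverse)
    show "C0_circle (\<lambda>y. exp (g y) * f y)" by (intro C0_circle_intros C2_circle_C0 g f)
  qed (use a in auto)
  then show ?thesis
    unfolding \<beta>_eq by (simp add: \<alpha>_eq mult.assoc[symmetric] exp_minus_inverse mult.commute[of "exp (- _)"])
qed

lemma tilting_exponent_measurable:
  assumes g: "C2_circle g" and "0 \<le> s"
  shows "tilting_exponent g s \<in> borel_measurable (path_filtration s)"
proof -
  have c: "(\<lambda>w. g (w r)) \<in> borel_measurable (path_filtration s)" if "0 \<le> r" "r \<le> s" for r
  proof (rule measurable_compose[OF _ C0_circle_measurable[OF C2_circle_C0(1)[OF g]]])
    show "(\<lambda>w. w r) \<in> borel_measurable (path_filtration s)"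
      unfolding path_filtration_def by (rule measurable_coordinate_borel) (use that in auto)
  qed
  show ?thesis
    unfolding tilting_exponent_eq[abs_def]
    by (intro borel_measurable_diff c occupation_measurable[OF tilt_potential_C0[OF g]])
      (use \<open>0 \<le> s\<close> in auto)
qed

lemma tilting_exponent_bounded:
  assumes g: "C2_circle g" and "0 \<le> s"
  obtains C where "\<And>w. w \<in> circle_paths \<Longrightarrow> \<bar>tilting_exponent g s w\<bar> \<le> C"
proof -
  obtain K where K: "K > 0" "\<And>y. \<bar>tilt_potential g y\<bar> \<le> K"
    using C0_circle_bounded[OF tilt_potential_C0[OF g]] by blast
  obtain N where N: "N > 0" "\<And>y. \<bar>g y\<bar> \<le> N" using C0_circle_bounded[OF C2_circle_C0(1)[OF g]] by blast
  show ?thesis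
  proof (rule that)
    fix w assume w: "w \<in> circle_paths"
    show "\<bar>tilting_exponent g s w\<bar> \<le> 2 * N + K * s"
      using occupation_abs_le[OF w tilt_potential_C0[OF g] \<open>0 \<le> s\<close> K(2)] N(2)[of "w s"] N(2)[of "w 0"]
      unfolding tilting_exponent_eq by linarith
  qed
qed

text \<open>Weighted expectations become integrals against a finite measure of the position at time
  \<open>b\<close>, so that agreement on continuous test functions can be upgraded to Borel
  ones.\<close>

lemma weighted_marginal:
  fixes Z :: "(real \<Rightarrow> real) \<Rightarrow> real"
  assumes R: "prob_space R" "sets R = sets path_space" and "0 \<le> b"
    and Z: "Z \<in> borel_measurable R" "\<forall>w\<in>circle_paths. 0 \<le> Z w \<and> Z w \<le> C"
  defines "\<mu> \<equiv> distr (density R (\<lambda>w. ennreal (Z w))) borel (\<lambda>w. w b)"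
  shows "finite_measure \<mu>" "sets \<mu> = sets borel" "AE x in \<mu>. x \<in> circle"
    "\<And>f :: real \<Rightarrow> real. f \<in> borel_measurable borel \<Longrightarrow> (LINT x|\<mu>. f x) = (LINT w|R. Z w * f (w b))"
proof -
  interpret prob_space R by fact
  have sp: "space R = circle_paths" using sets_eq_imp_space_eq[OF R(2)] by (simp add: path_space_def)
  have X: "(\<lambda>w. w b) \<in> borel_measurable R"
    using measurable_coordinate_borel[of b "{0..}"] \<open>0 \<le> b\<close> R(2)
    by (simp add: path_space_def cong: measurable_cong_sets)
  then have X': "(\<lambda>w. w b) \<in> borel_measurable (density R (\<lambda>w. ennreal (Z w)))" by simp
  show "sets \<mu> = sets borel" by (simp add: \<mu>_def)
  have "emeasure (density R (\<lambda>w. ennreal (Z w))) (space R) \<le> (\<integral>\<^sup>+w. ennreal C \<partial>R)"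
  proof (subst emeasure_density)
    show "(\<integral>\<^sup>+w. ennreal (Z w) * indicator (space R) w \<partial>R) \<le> (\<integral>\<^sup>+w. ennreal C \<partial>R)"
      using Z(2) sp by (intro nn_integral_mono) (simp add: ennreal_leI)
  qed (use Z(1) in auto)
  also have "\<dots> < \<infinity>" by (simp add: emeasure_space_1)
  finally have "finite_measure (density R (\<lambda>w. ennreal (Z w)))" by (intro finite_measureI) auto
  then show "finite_measure \<mu>" unfolding \<mu>_def using X' by (rule finite_measure.finite_measure_distr)
  show "AE x in \<mu>. x \<in> circle"
    unfolding \<mu>_def
  proof (subst AE_distr_iff[OF X'])
    show "AE w in density R (\<lambda>w. ennreal (Z w)). w b \<in> circle"
      by (rule AE_I2) (use sp path_in_circle \<open>0 \<le> b\<close> in auto)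
  qed simp
  fix f :: "real \<Rightarrow> real" assume f: "f \<in> borel_measurable borel"
  have "(LINT x|\<mu>. f x) = (LINT w|density R (\<lambda>w. ennreal (Z w)). f (w b))"
    unfolding \<mu>_def by (rule integral_distr[OF X' f])
  also have "\<dots> = (LINT w|R. Z w *\<^sub>R f (w b))"
    by (rule integral_density) (use Z sp in \<open>auto intro!: measurable_compose[OF X f]\<close>)
  finally show "(LINT x|\<mu>. f x) = (LINT w|R. Z w * f (w b))" by simp
qed

section \<open>Identification of laws through cylinder sets\<close>

definition cylinder :: "real set \<Rightarrow> (real \<Rightarrow> real set) \<Rightarrow> (real \<Rightarrow> real) set" where
  "cylinder J D = {w \<in> circle_paths. \<forall>j\<in>J. w j \<in> D j}"

lemma cylinder_measurable:
  assumes "finite J" "J \<subseteq> {0..s}" "\<And>j. D j \<in> sets borel"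
  shows "cylinder J D \<in> sets (path_filtration s)"
  using assms(1,2)
proof (induction rule: finite_induct)
  case empty
  have "space (path_filtration s) \<in> sets (path_filtration s)" by blast
  then show ?case by (simp add: cylinder_def path_filtration_def)
next
  case (insert j J)
  have "cylinder (insert j J) D = ((\<lambda>w. w j) -` D j \<inter> space (path_filtration s)) \<inter> cylinder J D"
    by (auto simp: cylinder_def path_filtration_def)
  moreover have "(\<lambda>w. w j) -` D j \<inter> space (path_filtration s) \<in> sets (path_filtration s)"
  proof (rule measurable_sets[OF _ assms(3)])
    show "(\<lambda>w. w j) \<in> borel_measurable (path_filtration s)"
      unfolding path_filtration_def by (rule measurable_coordinate_borel) (use insert.prems in auto)
  qed
  ultimately show ?case using insert by auto
qed

text \<open>Induction on the largest time \<open>b\<close>: all earlier times lie in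
  \<open>{0..b}\<close>, so the hypothesis holds at time \<open>b\<close>, the constraint at
  \<open>b\<close> is inserted there, and the forward equation carries the identity on to
  \<open>s\<close>. The free continuous \<open>f\<close> at the final time is what lets the next
  constraint be inserted.\<close>

lemma drift_laws_cylinder:
  assumes P: "brownian_laws P" and Q: "markov_laws (drift_generator g) Q" and g: "C2_circle g"
    and x: "x \<in> circle" and "finite J" and D: "\<And>j. D j \<in> sets borel"
  shows "J \<subseteq> {0..s} \<Longrightarrow> 0 \<le> s \<Longrightarrow> C0_circle f \<Longrightarrow> (LINT w|Q x. indicator (cylinder J D) w * f (w s))
    = (LINT w|P x. indicator (cylinder J D) w * exp (tilting_exponent g s w) * f (w s))"
  using \<open>finite J\<close>
proof (induction arbitrary: s f rule: finite_linorder_max_induct)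
  case empty
  have P': "markov_laws half_laplacian P" using P by (simp add: brownian_laws_def)
  have cyl: "cylinder {} D = circle_paths" by (simp add: cylinder_def)
  \<comment> \<open>At time 0 both laws sit at \<open>x\<close> and the tilting exponent is
    0.\<close>
  have init: "(LINT w|R x. indicator circle_paths w * f (w 0)) = f x"
    if R: "markov_laws A R" and f: "C0_circle f" for A R and f :: "real \<Rightarrow> real"
  proof -
    note DR = markov_lawsD[OF R x]
    interpret prob_space "R x" by fact
    have X: "(\<lambda>w. w 0) \<in> borel_measurable (R x)"
      using measurable_coordinate_borel[of 0 "{0..}"] DR(2)
      by (simp add: path_space_def cong: measurable_cong_sets)
    have "(LINT w|R x. indicator circle_paths w * f (w 0)) = (LINT w|R x. f (w 0))"
      by (rule Bochner_Integration.integral_cong) (auto simp: DR(3))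
    also have "\<dots> = (LINT w|R x. f x)"
      by (rule integral_cong_AE) (use DR(4) measurable_compose[OF X C0_circle_measurable[OF f]] in auto)
    finally show ?thesis by (simp add: prob_space)
  qed
  have 0: "(LINT w|Q x. indicator circle_paths w * f (w 0))
      = (LINT w|P x. indicator circle_paths w * exp (tilting_exponent g 0 w) * f (w 0))"
    if "C0_circle f" for f
    using init[OF Q that] init[OF P' that] by (simp add: tilting_exponent_eq)
  have "circle_paths \<in> sets (path_filtration 0)"
    using cylinder_measurable[of "{}" 0 D] D by (simp add: cyl)
  from drift_laws_propagate[OF P Q g x order_refl empty(2) this 0 empty(3)]
  show ?case unfolding cyl .
next
  case (insert b J)
  have P': "markov_laws half_laplacian P" using P by (simp add: brownian_laws_def)
  have b: "0 \<le> b" "b \<le> s" using insert.prems by auto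
  have J: "J \<subseteq> {0..b}" using insert.prems(1) insert.hyps(2) by (fastforce intro: less_imp_le)
  let ?B = "cylinder J D"
  have B: "?B \<in> sets (path_filtration b)" by (rule cylinder_measurable[OF insert.hyps(1) J D])
  have B': "?B \<in> sets path_space"
    using B subalgebra_path_filtration by (auto simp: subalgebra_def)
  obtain C where C: "\<And>w. w \<in> circle_paths \<Longrightarrow> \<bar>tilting_exponent g b w\<bar> \<le> C"
    using tilting_exponent_bounded[OF g b(1)] by blast
  note DQ = markov_lawsD[OF Q x] and DP = markov_lawsD[OF P' x]
  have ZQ: "(indicator ?B :: _ \<Rightarrow> real) \<in> borel_measurable (Q x)" using B' DQ(2) by simp
  have ZP: "(\<lambda>w. indicator ?B w * exp (tilting_exponent g b w)) \<in> borel_measurable (P x)"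
    using B' DP(2) measurable_path_filtration_path_space[OF tilting_exponent_measurable[OF g b(1)]]
    by (auto intro!: borel_measurable_times cong: measurable_cong_sets)
  have leP: "\<forall>w\<in>circle_paths. 0 \<le> indicator ?B w * exp (tilting_exponent g b w)
      \<and> indicator ?B w * exp (tilting_exponent g b w) \<le> exp C"
    using C by (auto simp: indicator_def abs_le_iff)
  have leQ: "\<forall>w\<in>circle_paths. (0 :: real) \<le> indicator ?B w \<and> indicator ?B w \<le> (1 :: real)"
    by (auto simp: indicator_def)
  note MQ = weighted_marginal[OF DQ(1,2) b(1) ZQ leQ]
  note MP = weighted_marginal[OF DP(1,2) b(1) ZP leP]
  \<comment> \<open>The hypothesis gives equal integrals of continuous functions only; equality of
    the weighted marginals is needed to use the test function
    \<open>indicator (D b) y * f y\<close>.\<close>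
  have eq: "distr (density (Q x) (\<lambda>w. ennreal (indicator ?B w))) borel (\<lambda>w. w b)
    = distr (density (P x) (\<lambda>w. ennreal (indicator ?B w * exp (tilting_exponent g b w)))) borel (\<lambda>w. w b)"
  proof (rule measure_eq_of_C0_circle)
    fix f :: "real \<Rightarrow> real" assume f: "C0_circle f"
    show "(LINT y|distr (density (Q x) (\<lambda>w. ennreal (indicator ?B w))) borel (\<lambda>w. w b). f y)
      = (LINT y|distr (density (P x) (\<lambda>w. ennreal (indicator ?B w * exp (tilting_exponent g b w)))) borel (\<lambda>w. w b). f y)"
      using MQ(4)[OF C0_circle_measurable[OF f]] MP(4)[OF C0_circle_measurable[OF f]]
        insert.IH[OF J b(1) f] by simp
  qed (use MQ MP in auto)
  have cyl: "indicator (cylinder (insert b J) D) w = (indicator ?B w * indicator (D b) (w b) :: real)" for w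
    by (auto simp: cylinder_def indicator_def)
  have init: "(LINT w|Q x. indicator (cylinder (insert b J) D) w * f (w b))
      = (LINT w|P x. indicator (cylinder (insert b J) D) w * exp (tilting_exponent g b w) * f (w b))"
    if f: "C0_circle f" for f
  proof -
    have m: "(\<lambda>y. indicator (D b) y * f y) \<in> borel_measurable borel"
      using C0_circle_measurable[OF f] D by measurable
    show ?thesis
      using MQ(4)[OF m] MP(4)[OF m] eq by (simp add: cyl ac_simps)
  qed
  have "cylinder (insert b J) D \<in> sets (path_filtration b)"
    by (rule cylinder_measurable) (use insert.hyps J b D in auto)
  from drift_laws_propagate[OF P Q g x b this init insert.prems(3)]
  show ?case .
qed

lemma sets_path_filtration_cylinder:
  assumes "0 \<le> s"
  shows "sets (path_filtration s)
    = sigma_sets circle_paths {cylinder J D |J D. finite J \<and> J \<subseteq> {0..s} \<and> (\<forall>j. D j \<in> sets borel)}"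
    (is "_ = sigma_sets _ ?E")
proof
  show "sigma_sets circle_paths ?E \<subseteq> sets (path_filtration s)"
  proof -
    have "?E \<subseteq> sets (path_filtration s)" using cylinder_measurable by blast
    then show ?thesis using sets.sigma_sets_subset[of ?E "path_filtration s"] by (simp add: path_filtration_def)
  qed
  have "{(\<lambda>w. w t) -` B \<inter> circle_paths |t B. t \<in> {0..s} \<and> B \<in> sets borel} \<subseteq> ?E"
  proof safe
    fix t and B :: "real set" assume "t \<in> {0..s}" "B \<in> sets borel"
    then show "\<exists>J D. (\<lambda>w. w t) -` B \<inter> circle_paths = cylinder J D \<and> finite J \<and> J \<subseteq> {0..s} \<and> (\<forall>j. D j \<in> sets borel)"
      by (intro exI[of _ "{t}"] exI[of _ "\<lambda>_. B"]) (auto simp: cylinder_def)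
  qed
  then show "sets (path_filtration s) \<subseteq> sigma_sets circle_paths ?E"
    unfolding path_filtration_def sets_coordinate_algebra by (rule sigma_sets_mono')
qed

lemma Int_stable_cylinder:
  "Int_stable {cylinder J D |J D. finite J \<and> J \<subseteq> S \<and> (\<forall>j. D j \<in> sets borel)}"
proof (rule Int_stableI, safe)
  fix J J' :: "real set" and D D' :: "real \<Rightarrow> real set"
  assume fin: "finite J" "finite J'" and sub: "J \<subseteq> S" "J' \<subseteq> S"
    and D: "\<forall>j. D j \<in> sets borel" "\<forall>j. D' j \<in> sets borel"
  \<comment> \<open>\<open>UNIV\<close> pads the times that occur in only one of the two index
    sets.\<close>
  have "cylinder J D \<inter> cylinder J' D'
    = cylinder (J \<union> J') (\<lambda>j. (if j \<in> J then D j else UNIV) \<inter> (if j \<in> J' then D' j else UNIV))"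
    by (auto simp: cylinder_def)
  then show "\<exists>J'' D''. cylinder J D \<inter> cylinder J' D' = cylinder J'' D'' \<and> finite J'' \<and> J'' \<subseteq> S
    \<and> (\<forall>j. D'' j \<in> sets borel)"
    using fin sub D
    by (intro exI[of _ "J \<union> J'"] exI[of _ "\<lambda>j. (if j \<in> J then D j else UNIV) \<inter> (if j \<in> J' then D' j else UNIV)"]) auto
qed

lemma subalgebra_restr:
  assumes "sets R = sets path_space"
  shows "subalgebra R (path_filtration T)"
  using assms sets_eq_imp_space_eq[OF assms] subalgebra_path_filtration[of T]
  by (simp add: subalgebra_def)

text \<open>The Girsanov formula in the form needed here: cylinders with times up to
  \<open>T\<close> are an intersection-stable generator, and the test function 1 in the cylinder
  identity compares the masses.\<close>

lemma drift_laws_density: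
  assumes P: "brownian_laws P" and Q: "markov_laws (drift_generator g) Q" and g: "C2_circle g"
    and x: "x \<in> circle" and T: "0 \<le> T"
  shows "restr_to_subalg (Q x) (path_filtration T)
    = density (restr_to_subalg (P x) (path_filtration T)) (\<lambda>w. ennreal (exp (tilting_exponent g T w)))"
    (is "?L = ?R")
proof -
  have P': "markov_laws half_laplacian P" using P by (simp add: brownian_laws_def)
  note DQ = markov_lawsD[OF Q x] and DP = markov_lawsD[OF P' x]
  interpret Q: prob_space "Q x" by fact
  interpret P: prob_space "P x" by fact
  note sub = subalgebra_restr[OF DQ(2), of T] subalgebra_restr[OF DP(2), of T]
  note m = tilting_exponent_measurable[OF g T]
  obtain C where C: "\<And>w. w \<in> circle_paths \<Longrightarrow> \<bar>tilting_exponent g T w\<bar> \<le> C"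
    using tilting_exponent_bounded[OF g T] by blast
  let ?E = "{cylinder J D |J D. finite J \<and> J \<subseteq> {0..T} \<and> (\<forall>j. D j \<in> sets borel)}"
  show ?thesis
  proof (rule measure_eqI_generator_eq[where E = ?E and \<Omega> = circle_paths and A = "\<lambda>_. circle_paths"])
    show "Int_stable ?E" by (rule Int_stable_cylinder)
    show "?E \<subseteq> Pow circle_paths" by (auto simp: cylinder_def)
    show "sets ?L = sigma_sets circle_paths ?E" "sets ?R = sigma_sets circle_paths ?E"
      using sub by (simp_all add: sets_restr_to_subalg sets_path_filtration_cylinder[OF T])
    have "circle_paths = cylinder {} (\<lambda>_. UNIV)" by (simp add: cylinder_def)
    then show "range (\<lambda>_ :: nat. circle_paths) \<subseteq> ?E" by force
    show "emeasure ?L circle_paths \<noteq> \<infinity>" for i :: nat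
    proof -
      have "circle_paths \<in> sets (path_filtration T)"
        using sets.top[of "path_filtration T"] by (simp add: path_filtration_def)
      then show ?thesis using Q.emeasure_finite by (simp add: emeasure_restr_to_subalg[OF sub(1)])
    qed
    fix X assume "X \<in> ?E"
    then obtain J D where X: "X = cylinder J D" and J: "finite J" "J \<subseteq> {0..T}" and D: "\<And>j. D j \<in> sets borel"
      by blast
    have XT: "X \<in> sets (path_filtration T)" unfolding X by (rule cylinder_measurable[OF J D])
    then have XQ: "X \<in> sets (Q x)" and XP: "X \<in> sets (P x)" using sub by (auto simp: subalgebra_def)
    have "(LINT w|Q x. indicator X w * 1) = (LINT w|P x. indicator X w * exp (tilting_exponent g T w) * 1)"
      unfolding X by (rule drift_laws_cylinder[OF P Q g x J(1) D J(2) T]) (rule C0_circle_intros)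
    then have eq: "measure (Q x) X = (LINT w|P x. exp (tilting_exponent g T w) * indicator X w)"
      using XQ by (simp add: mult.commute)
    have "emeasure ?L X = ennreal (measure (Q x) X)"
      by (simp add: emeasure_restr_to_subalg[OF sub(1) XT] Q.emeasure_eq_measure)
    also have "\<dots> = (\<integral>\<^sup>+w. ennreal (exp (tilting_exponent g T w) * indicator X w) \<partial>P x)"
      unfolding eq
    proof (rule nn_integral_eq_integral[symmetric])
      show "integrable (P x) (\<lambda>w. exp (tilting_exponent g T w) * indicator X w)"
      proof (rule P.integrable_const_bound[where B = "exp C"])
        show "AE w in P x. norm (exp (tilting_exponent g T w) * indicator X w) \<le> exp C"
          using C DP(3) by (intro AE_I2) (auto simp: indicator_def abs_le_iff)
        show "(\<lambda>w. exp (tilting_exponent g T w) * indicator X w) \<in> borel_measurable (P x)"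
          using measurable_from_subalg[OF sub(2) m] XP by measurable
      qed
    qed auto
    also have "\<dots> = (\<integral>\<^sup>+w. ennreal (exp (tilting_exponent g T w)) * indicator X w \<partial>restr_to_subalg (P x) (path_filtration T))"
      by (subst nn_integral_subalgebra2[OF sub(2)])
        (use m XT in \<open>auto intro!: nn_integral_cong simp: indicator_def\<close>)
    also have "\<dots> = emeasure ?R X"
      by (rule emeasure_density[symmetric])
        (use m XT sub in \<open>auto simp: sets_restr_to_subalg intro!: measurable_in_subalg measurable_compose[OF _ measurable_ennreal]\<close>)
    finally show "emeasure ?L X = emeasure ?R X" .
  qed auto
qed

section \<open>Expectations and log-densities under tilted laws\<close>

lemma tilted_lawsD:
  assumes "tilted_laws P g Q" "x \<in> circle"
  shows "C2_circle g" "prob_space (Q x)" "sets (Q x) = sets path_space" "space (Q x) = circle_paths"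
    "0 \<le> T \<Longrightarrow> restr_to_subalg (Q x) (path_filtration T)
      = density (restr_to_subalg (P x) (path_filtration T)) (\<lambda>w. ennreal (exp (tilting_exponent g T w)))"
  using assms sets_eq_imp_space_eq[of "Q x" path_space] by (auto simp: tilted_laws_def path_space_def)

text \<open>The density on \<open>path_filtration T\<close> converts expectations of variables known
  by time \<open>T\<close> into Brownian ones, where the Markov property and the generator can be
  used.\<close>

lemma tilted_laws_LINT:
  fixes k :: "(real \<Rightarrow> real) \<Rightarrow> real"
  assumes P: "brownian_laws P" and Q: "tilted_laws P g Q" and x: "x \<in> circle" and T: "0 \<le> T"
    and k: "k \<in> borel_measurable (path_filtration T)"
  shows "(LINT w|Q x. k w) = (LINT w|P x. exp (tilting_exponent g T w) * k w)"
proof -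
  have P': "markov_laws half_laplacian P" using P by (simp add: brownian_laws_def)
  note DQ = tilted_lawsD[OF Q x] and DP = markov_lawsD[OF P' x]
  note sub = subalgebra_restr[OF DQ(3), of T] subalgebra_restr[OF DP(2), of T]
  note m = tilting_exponent_measurable[OF DQ(1) T]
  have m': "(\<lambda>w. exp (tilting_exponent g T w)) \<in> borel_measurable (path_filtration T)"
    using m by measurable
  have "(LINT w|Q x. k w) = (LINT w|restr_to_subalg (Q x) (path_filtration T). k w)"
    by (rule integral_subalgebra2[OF sub(1) k, symmetric])
  also have "\<dots> = (LINT w|restr_to_subalg (P x) (path_filtration T). exp (tilting_exponent g T w) *\<^sub>R k w)"
    unfolding DQ(5)[OF T]
    by (rule integral_density) (use measurable_in_subalg[OF sub(2)] k m' in auto)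
  also have "\<dots> = (LINT w|P x. exp (tilting_exponent g T w) *\<^sub>R k w)"
    by (rule integral_subalgebra2[OF sub(2)]) (use k m' in measurable)
  finally show ?thesis by simp
qed

lemma tilted_laws_log_density:
  assumes P: "brownian_laws P" and Q: "tilted_laws P g Q" and x: "x \<in> circle" and T: "0 \<le> T"
  shows "(LINT w|Q x. ln (enn2real (RN_deriv (restr_to_subalg (P x) (path_filtration T))
      (restr_to_subalg (Q x) (path_filtration T)) w))) = (LINT w|Q x. tilting_exponent g T w)"
    (is "(LINT w|Q x. ln (enn2real (RN_deriv ?P ?Q w))) = _")
proof -
  have P': "markov_laws half_laplacian P" using P by (simp add: brownian_laws_def)
  note DQ = tilted_lawsD[OF Q x] and DP = markov_lawsD[OF P' x]
  note sub = subalgebra_restr[OF DQ(3), of T] subalgebra_restr[OF DP(2), of T]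
  note m = tilting_exponent_measurable[OF DQ(1) T]
  have m': "(\<lambda>w. ennreal (exp (tilting_exponent g T w))) \<in> borel_measurable ?P"
    using measurable_in_subalg[OF sub(2) m] by measurable
  interpret RP: prob_space ?P by (rule prob_space_restr_to_subalg[OF sub(2) DP(1)])
  have "AE w in ?P. ennreal (exp (tilting_exponent g T w)) = RN_deriv ?P ?Q w"
    by (rule RP.RN_deriv_unique[OF m']) (simp add: DQ(5)[OF T])
  \<comment> \<open>\<open>RN_deriv\<close> is determined only up to null sets of \<open>?P\<close>;
    restricting to positive density is the form in which an almost-everywhere statement passes to
    \<open>?Q\<close>.\<close>
  then have "AE w in ?P. 0 < ennreal (exp (tilting_exponent g T w)) \<longrightarrow>
      ln (enn2real (RN_deriv ?P ?Q w)) = tilting_exponent g T w"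
    by eventually_elim (metis enn2real_ennreal exp_ge_zero ln_exp)
  then have "AE w in ?Q. ln (enn2real (RN_deriv ?P ?Q w)) = tilting_exponent g T w"
    unfolding DQ(5)[OF T] using AE_density[OF m'] by simp
  then have "AE w in Q x. ln (enn2real (RN_deriv ?P ?Q w)) = tilting_exponent g T w"
    by (rule AE_restr_to_subalg[OF sub(1)])
  moreover have "(\<lambda>w. ln (enn2real (RN_deriv ?P ?Q w))) \<in> borel_measurable (Q x)"
  proof (rule measurable_from_subalg[OF sub(1)], rule measurable_in_subalg'[OF sub(2)])
    show "(\<lambda>w. ln (enn2real (RN_deriv ?P ?Q w))) \<in> borel_measurable ?P" by measurable
  qed
  ultimately show ?thesis
    using measurable_from_subalg[OF sub(1) m] by (intro integral_cong_AE)
qed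

section \<open>Integration over the circle\<close>

lemma space_circle_lebesgue [simp]: "space circle_lebesgue = circle"
  by (simp add: space_restrict_space)

lemma circle_lebesgue_integrable:
  assumes "C0_circle f"
  shows "integrable circle_lebesgue f"
proof -
  have "set_integrable lborel {0..1} f"
    by (rule borel_integrable_atLeastAtMost') (rule C0_circle_continuous_on[OF assms])
  then have "set_integrable lborel circle f"
    by (rule set_integrable_subset) auto
  then show ?thesis
    by (subst integrable_restrict_space) (auto simp: set_integrable_def)
qed

lemma circle_lebesgue_eq_Icc:
  assumes "C0_circle f"
  shows "(LINT x|circle_lebesgue. f x) = (LINT x:{0..1}|lborel. f x)"
proof -
  have "(LINT x|circle_lebesgue. f x) = (LINT x:circle|lborel. f x)"
    by (subst integral_restrict_space) (auto simp: set_lebesgue_integral_def)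
  also have "\<dots> = (LINT x:{0..1}|lborel. f x)"
    unfolding set_lebesgue_integral_def
  proof (rule integral_cong_AE)
    show "AE x in lborel. indicator circle x *\<^sub>R f x = indicator {0..1} x *\<^sub>R f x"
      using AE_lborel_singleton[of 1] by eventually_elim (auto simp: indicator_def)
  qed (use C0_circle_measurable[OF assms] in measurable)
  finally show ?thesis .
qed

lemma circle_lebesgue_FTC:
  assumes "C0_circle f" "\<And>x. (F has_real_derivative f x) (at x)"
  shows "(LINT x|circle_lebesgue. f x) = F 1 - F 0"
proof -
  have "(LINT x|lborel. f x * indicator {0..1} x) = F 1 - F 0"
    by (rule integral_FTC_Icc_real)
      (use assms in \<open>auto simp: C0_circle_def continuous_on_eq_continuous_at\<close>)
  then show ?thesis
    unfolding circle_lebesgue_eq_Icc[OF assms(1)] by (simp add: set_lebesgue_integral_def mult.commute)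
qed

lemma circle_lebesgue_integral_eq_0_imp:
  assumes f: "C0_circle f" "\<And>x. 0 \<le> f x" and "(LINT x|circle_lebesgue. f x) = 0"
  shows "f x = 0"
proof -
  have "f y = 0" if "y \<in> {0..1}" for y
  proof -
    have int: "set_integrable lborel {0..1} f"
      by (rule borel_integrable_atLeastAtMost') (rule C0_circle_continuous_on[OF f(1)])
    then have "integral {0..1} f = 0"
      using assms(3) circle_lebesgue_eq_Icc[OF f(1)] by (simp add: set_borel_integral_eq_integral)
    moreover have "f integrable_on {0..1}" using int by (rule set_borel_integral_eq_integral)
    ultimately have "(f has_integral 0) {0..1}" by (metis integrable_integral)
    then have "(f has_integral 0) (cbox 0 1)" by (simp add: cbox_interval)
    then show ?thesis
      by (rule has_integral_0_cbox_imp_0[rotated 2])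
        (use that f in \<open>auto intro: C0_circle_continuous_on simp: cbox_interval\<close>)
  qed
  from this[of "frac x"] show ?thesis
    using periodic1_frac[of f x] f(1) frac_in_circle[of x] by (auto simp: C0_circle_def)
qed

lemma circle_lebesgue_integral_pos:
  assumes "C0_circle f" "\<And>x. 0 < f x"
  shows "0 < (LINT x|circle_lebesgue. f x)"
proof -
  have "0 \<le> (LINT x|circle_lebesgue. f x)"
    by (rule Bochner_Integration.integral_nonneg) (use assms in \<open>auto intro: less_imp_le\<close>)
  moreover have "(LINT x|circle_lebesgue. f x) \<noteq> 0"
    using circle_lebesgue_integral_eq_0_imp[OF assms(1), of 0] assms(2) less_imp_le less_irrefl by metis
  ultimately show ?thesis by linarith
qed

lemma normalized_density:
  assumes h: "C0_circle h" "\<And>x. 0 < h x"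
  shows "prob_space (normalized_density h)" "sets (normalized_density h) = sets circle_borel"
    "space (normalized_density h) = circle"
    "C0_circle f \<Longrightarrow> (LINT x|normalized_density h. f x)
      = (LINT x|circle_lebesgue. h x * f x) / (LINT x|circle_lebesgue. h x)"
    "C0_circle f \<Longrightarrow> integrable (normalized_density h) f"
proof -
  let ?I = "LINT x|circle_lebesgue. h x"
  note pos = circle_lebesgue_integral_pos[OF h]
  have m: "f \<in> borel_measurable circle_lebesgue" if "C0_circle f" for f
    using circle_lebesgue_integrable[OF that] by auto
  show sets: "sets (normalized_density h) = sets circle_borel"
    unfolding normalized_density_def sets_density sets_restrict_space by simp
  show sp: "space (normalized_density h) = circle"
    by (simp add: normalized_density_def)
  have hm: "(\<lambda>x. h x / ?I) \<in> borel_measurable circle_lebesgue" using m[OF h(1)] by measurable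
  have nn: "AE x in circle_lebesgue. 0 \<le> h x / ?I"
    using h(2) pos by (intro AE_I2) (auto intro: less_imp_le)
  show int: "(LINT x|normalized_density h. f x) = (LINT x|circle_lebesgue. h x * f x) / ?I"
    if f: "C0_circle f" for f
  proof -
    have "(LINT x|normalized_density h. f x) = (LINT x|circle_lebesgue. (h x / ?I) *\<^sub>R f x)"
      unfolding normalized_density_def by (rule integral_density[OF m[OF f] hm nn])
    also have "\<dots> = (LINT x|circle_lebesgue. (h x * f x) / ?I)" by simp
    finally show ?thesis by simp
  qed
  show "integrable (normalized_density h) f" if f: "C0_circle f" for f
    unfolding normalized_density_def
  proof (subst integrable_density[OF m[OF f] hm nn])
    have "integrable circle_lebesgue (\<lambda>x. h x * f x / ?I)"
      by (intro integrable_divide circle_lebesgue_integrable C0_circle_intros h f)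
    then show "integrable circle_lebesgue (\<lambda>x. (h x / ?I) *\<^sub>R f x)" by simp
  qed
  have i: "integrable circle_lebesgue (\<lambda>x. h x / ?I)"
    by (intro integrable_divide circle_lebesgue_integrable h)
  have "emeasure (normalized_density h) (space (normalized_density h)) = (\<integral>\<^sup>+x. ennreal (h x / ?I) \<partial>circle_lebesgue)"
    unfolding normalized_density_def using hm sets.top[of circle_lebesgue]
    by (subst emeasure_density) (auto intro!: nn_integral_cong)
  also have "\<dots> = ennreal (LINT x|circle_lebesgue. h x / ?I)"
    by (rule nn_integral_eq_integral[OF i nn])
  also have "\<dots> = 1" using pos by simp
  finally show "prob_space (normalized_density h)" by (rule prob_spaceI)
qed

text \<open>The increment of an antiderivative over one period has derivative 0 by periodicity of
  \<open>f\<close>, hence is constant and equal to the integral over the circle, which is 0.\<close>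

lemma periodic_antiderivative:
  assumes f: "C0_circle f" and "(LINT x|circle_lebesgue. f x) = 0"
  obtains F where "\<And>x. (F has_real_derivative f x) (at x)" "periodic1 F"
proof -
  have "\<exists>F. \<forall>x::real. -\<infinity> < ereal x \<longrightarrow> ereal x < \<infinity> \<longrightarrow> (F has_vector_derivative f x) (at x)"
    using f by (intro einterval_antiderivative) (auto simp: C0_circle_def continuous_on_eq_continuous_at)
  then obtain F where F: "\<And>x. (F has_real_derivative f x) (at x)"
    by (auto simp: has_real_derivative_iff_has_vector_derivative)
  have "((\<lambda>x. F (x + 1) - F x) has_real_derivative 0) (at x)" for x
  proof -
    have "((\<lambda>x. F (x + 1)) has_real_derivative f (x + 1)) (at x)"
      using F[of "x + 1"] DERIV_shift[of F "f (x + 1)" x 1] by simp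
    from DERIV_diff[OF this F[of x]] show ?thesis
      using f by (simp add: C0_circle_def periodic1_def)
  qed
  then have "F (x + 1) - F x = F (0 + 1) - F 0" for x
    using DERIV_isconst_all[of "\<lambda>x. F (x + 1) - F x" x 0] by simp
  also have "F (0 + 1) - F 0 = 0" using circle_lebesgue_FTC[OF f F] assms(2) by simp
  finally have "periodic1 F" by (simp add: periodic1_def)
  with F show ?thesis by (rule that)
qed

text \<open>With \<open>h = exp (2 g)\<close> the equation takes the divergence form
  \<open>(h \<phi>')' = 2 h (\<psi> - m)\<close>, solved by two integrations. Each leaves one
  solvability condition on the circle: the first holds because \<open>m\<close> is the mean under
  the marginal, the second is met by the integration constant \<open>c\<close>.\<close>

lemma poisson_equation:
  assumes g: "C2_circle g" and \<psi>: "C0_circle \<psi>"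
  obtains \<phi> where "C2_circle \<phi>"
    "\<And>x. drift_generator g \<phi> x = \<psi> x - (LINT y|tilted_marginal g. \<psi> y)"
proof -
  define h where "h x = exp (2 * g x)" for x
  define m where "m = (LINT y|tilted_marginal g. \<psi> y)"
  note g0 = C2_circle_C0(1)[OF g]
  have h: "C0_circle h" "\<And>x. 0 < h x"
    unfolding h_def[abs_def] by (intro C0_circle_intros g0) simp
  have h': "(h has_real_derivative 2 * deriv g x * h x) (at x)" for x
    unfolding h_def[abs_def] using C2_circle_DERIV(1)[OF g, of x] by (auto intro!: derivative_eq_intros)
  let ?I = "LINT x|circle_lebesgue. h x"
  note pos = circle_lebesgue_integral_pos[OF h]
  have "m = (LINT x|circle_lebesgue. h x * \<psi> x) / ?I"
    unfolding m_def tilted_marginal_def h_def[abs_def, symmetric] by (rule normalized_density(4)[OF h \<psi>])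
  then have "(LINT x|circle_lebesgue. h x * \<psi> x) - m * ?I = 0" using pos by simp
  moreover have "(LINT x|circle_lebesgue. h x * \<psi> x - m * h x) = (LINT x|circle_lebesgue. h x * \<psi> x) - m * ?I"
    by (subst Bochner_Integration.integral_diff)
      (auto intro!: circle_lebesgue_integrable C0_circle_intros h \<psi>)
  ultimately have 0: "(LINT x|circle_lebesgue. h x * \<psi> x - m * h x) = 0" by simp
  have "C0_circle (\<lambda>x. h x * \<psi> x - m * h x)" by (intro C0_circle_intros h \<psi>)
  then obtain W where W: "\<And>x. (W has_real_derivative h x * \<psi> x - m * h x) (at x)" "periodic1 W"
    using periodic_antiderivative[OF _ 0] by blast
  have W0: "C0_circle W"
    using W by (auto simp: C0_circle_def continuous_on_eq_continuous_at intro: DERIV_isCont)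
  let ?J = "LINT x|circle_lebesgue. 1 / h x"
  have ih: "C0_circle (\<lambda>x. 1 / h x)" by (intro C0_circle_intros h) (use h(2) in \<open>metis less_irrefl\<close>)
  have Jpos: "0 < ?J" by (rule circle_lebesgue_integral_pos[OF ih]) (use h(2) in auto)
  \<comment> \<open>Chosen so that \<open>(W - c) / h\<close>, half the derivative of the solution,
    has integral 0 and so has a periodic antiderivative.\<close>
  define c where "c = (LINT x|circle_lebesgue. 1 / h x * W x) / ?J"
  have "(LINT x|circle_lebesgue. 1 / h x * W x - c * (1 / h x)) = (LINT x|circle_lebesgue. 1 / h x * W x) - c * ?J"
    unfolding integral_mult_right_zero[symmetric]
    by (intro Bochner_Integration.integral_diff circle_lebesgue_integrable C0_circle_intros(4) C0_circle_intros(1) ih W0)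
  also have "\<dots> = 0" using Jpos by (simp add: c_def)
  finally have 1: "(LINT x|circle_lebesgue. 1 / h x * W x - c * (1 / h x)) = 0" .
  have "C0_circle (\<lambda>x. 1 / h x * W x - c * (1 / h x))" by (intro C0_circle_intros(3,4) C0_circle_intros(1) ih W0)
  then obtain p where p: "\<And>x. (p has_real_derivative 1 / h x * W x - c * (1 / h x)) (at x)" "periodic1 p"
    using periodic_antiderivative[OF _ 1] by blast
  define p1 where "p1 x = 2 * ((W x - c) / h x)" for x
  \<comment> \<open>The derivative of \<open>p1\<close>, simplified by
    \<open>h' = 2 g' h\<close>.\<close>
  define p2 where "p2 x = 2 * (\<psi> x - m) - 2 * deriv g x * p1 x" for x
  have hnz: "h x \<noteq> 0" for x using h(2)[of x] by simp
  note C2 = C2_circleI[of "\<lambda>x. 2 * p x" p1 p2]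
  have per: "periodic1 (\<lambda>x. 2 * p x)" using p(2) by (simp add: periodic1_def)
  have d1: "((\<lambda>x. 2 * p x) has_real_derivative p1 x) (at x)" for x
    using DERIV_cmult[OF p(1)[of x], of 2] by (simp add: p1_def diff_divide_distrib)
  have d2: "(p1 has_real_derivative p2 x) (at x)" for x
  proof -
    have "((\<lambda>x. (W x - c) / h x) has_real_derivative
      ((h x * \<psi> x - m * h x) * h x - (W x - c) * (2 * deriv g x * h x)) / (h x * h x)) (at x)"
      by (rule DERIV_divide[OF _ h' hnz]) (use DERIV_diff[OF W(1)[of x] DERIV_const[of c]] in simp)
    from DERIV_cmult[OF this, of 2] show ?thesis
      unfolding p1_def[abs_def] by (rule DERIV_cong) (use hnz[of x] in \<open>simp add: p2_def p1_def field_simps\<close>)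
  qed
  have cont: "continuous_on UNIV p2"
    unfolding p2_def p1_def
    by (intro continuous_intros C2_circle_continuous_on[OF g] C0_circle_continuous_on[OF \<psi>]
        C0_circle_continuous_on[OF W0] C0_circle_continuous_on[OF h(1)]) (use hnz in auto)
  show ?thesis
  proof (rule that)
    show "C2_circle (\<lambda>x. 2 * p x)" by (rule C2(1)[OF per d1 d2 cont])
    show "drift_generator g (\<lambda>x. 2 * p x) x = \<psi> x - (LINT y|tilted_marginal g. \<psi> y)" for x
      unfolding drift_generator_def half_laplacian_def C2(3)[OF per d1 d2 cont] m_def[symmetric]
      unfolding C2(2)[OF per d1 d2 cont]
      by (simp add: p2_def algebra_simps)
  qed
qed

section \<open>The entropy rate\<close>

lemma expected_occupation_DERIV:
  assumes R: "prob_space R" "sets R = sets path_space" and U: "C0_circle U"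
  shows "continuous_on {0..} (\<lambda>s. LINT w|R. occupation U s w)"
    and "0 \<le> s \<Longrightarrow> ((\<lambda>s. LINT w|R. occupation U s w) has_real_derivative (LINT w|R. U (w s))) (at_right s)"
    and "0 \<le> s \<Longrightarrow> integrable R (occupation U s)"
proof -
  interpret prob_space R by fact
  have sp: "space R = circle_paths" using sets_eq_imp_space_eq[OF R(2)] by (simp add: path_space_def)
  obtain K where K: "K > 0" "\<And>y. \<bar>U y\<bar> \<le> K" using C0_circle_bounded[OF U] by blast
  have m: "occupation U s \<in> borel_measurable R" if "0 \<le> s" for s
    using measurable_path_filtration_path_space[OF occupation_measurable[OF U that order_refl]] R(2)
    by (simp cong: measurable_cong_sets)
  show int: "integrable R (occupation U s)" if "0 \<le> s" for s
    by (rule integrable_const_bound[where B = "K * s"])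
      (use m that occupation_abs_le[OF _ U that K(2)] sp in \<open>auto intro!: AE_I2\<close>)
  show "continuous_on {0..} (\<lambda>s. LINT w|R. occupation U s w)"
  proof (rule continuous_on_LINT[where C = "\<lambda>s. K * s"])
    show "mono (\<lambda>s. K * s)" using K(1) by (intro monoI mult_left_mono) auto
    show "\<bar>occupation U s w\<bar> \<le> K * s" if "s \<in> {0..}" "w \<in> space R" for s w
      using that sp by (intro occupation_abs_le U K) auto
    show "continuous_on {0..} (\<lambda>s. occupation U s w)" if "w \<in> space R" for w
      using that sp by (intro occupation_DERIV(2)[OF _ U order_refl]) auto
  qed (use m finite_measure_axioms in auto)
  assume s: "0 \<le> s"
  show "((\<lambda>s. LINT w|R. occupation U s w) has_real_derivative (LINT w|R. U (w s))) (at_right s)"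
    unfolding has_field_derivative_iff
  proof (rule tendsto_at_right_sequentially[of s "s + 1"])
    fix r assume r: "\<And>n. s < r n" "\<And>n. r n < s + 1" "r \<longlonglongrightarrow> s"
    have r0: "0 \<le> r n" "r n - s > 0" for n using r(1)[of n] s by auto
    have lim: "filterlim r (at_right s) sequentially"
      using r by (auto simp: filterlim_at intro!: always_eventually)
    have X: "(\<lambda>w. w s) \<in> borel_measurable R"
      using measurable_coordinate_borel[of s "{0..}"] s R(2)
      by (simp add: path_space_def cong: measurable_cong_sets)
    have "(\<lambda>n. LINT w|R. (occupation U (r n) w - occupation U s w) / (r n - s)) \<longlonglongrightarrow> (LINT w|R. U (w s))"
    proof (rule integral_dominated_convergence[where w = "\<lambda>_. K"])
      show "(\<lambda>w. U (w s)) \<in> borel_measurable R"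
        by (rule measurable_compose[OF X C0_circle_measurable[OF U]])
      show "(\<lambda>w. (occupation U (r n) w - occupation U s w) / (r n - s)) \<in> borel_measurable R" for n
        using m[OF r0(1)] m[OF s] by measurable
      show "AE w in R. (\<lambda>n. (occupation U (r n) w - occupation U s w) / (r n - s)) \<longlonglongrightarrow> U (w s)"
      proof (intro AE_I2)
        fix w assume "w \<in> space R"
        then have "((\<lambda>s. occupation U s w) has_real_derivative U (w s)) (at_right s)"
          using sp s by (intro occupation_DERIV U) auto
        then show "(\<lambda>n. (occupation U (r n) w - occupation U s w) / (r n - s)) \<longlonglongrightarrow> U (w s)"
          unfolding has_field_derivative_iff by (rule filterlim_compose[OF _ lim])
      qed
      show "AE w in R. norm ((occupation U (r n) w - occupation U s w) / (r n - s)) \<le> K" for n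
      proof (intro AE_I2)
        fix w assume "w \<in> space R"
        then have "\<bar>occupation U (r n) w - occupation U s w\<bar> \<le> K * (r n - s)"
          using sp s r0(2)[of n] by (intro occupation_diff_le U K) auto
        then show "norm ((occupation U (r n) w - occupation U s w) / (r n - s)) \<le> K"
          using r0(2)[of n] by (simp add: field_simps)
      qed
    qed auto
    then show "(\<lambda>n. ((LINT w|R. occupation U (r n) w) - (LINT w|R. occupation U s w)) / (r n - s))
      \<longlonglongrightarrow> (LINT w|R. U (w s))"
      using int[OF r0(1)] int[OF s] by simp
  qed simp
qed

text \<open>Dynkin's formula for the Poisson solution expresses the expected occupation integral as
  \<open>m * T\<close> plus boundary terms. Bounds on \<open>g\<close> and on that solution control
  everything else, so \<open>C\<close> depends on neither \<open>Q\<close>, \<open>x\<close> nor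
  \<open>T\<close>.\<close>

lemma tilted_laws_expected_exponent:
  assumes P: "brownian_laws P" and g: "C2_circle g"
  obtains C where "\<And>Q x T. tilted_laws P g Q \<Longrightarrow> x \<in> circle \<Longrightarrow> 0 \<le> T \<Longrightarrow>
    \<bar>(LINT w|Q x. tilting_exponent g T w) + T * (LINT y|tilted_marginal g. tilt_potential g y)\<bar> \<le> C"
proof -
  have P': "markov_laws half_laplacian P" using P by (simp add: brownian_laws_def)
  let ?U = "tilt_potential g"
  define m where "m = (LINT y|tilted_marginal g. ?U y)"
  note U = tilt_potential_C0[OF g] and g0 = C2_circle_C0(1)[OF g]
  obtain \<phi> where \<phi>: "C2_circle \<phi>" "\<And>x. drift_generator g \<phi> x = ?U x - m"
    using poisson_equation[OF g U] unfolding m_def by blast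
  note \<phi>0 = C2_circle_C0(1)[OF \<phi>(1)]
  obtain N where N: "N > 0" "\<And>y. \<bar>g y\<bar> \<le> N" using C0_circle_bounded[OF g0] by blast
  obtain M where M: "M > 0" "\<And>y. \<bar>\<phi> y\<bar> \<le> M" using C0_circle_bounded[OF \<phi>0] by blast
  obtain K where K: "K > 0" "\<And>y. \<bar>?U y\<bar> \<le> K" using C0_circle_bounded[OF U] by blast
  show ?thesis
  proof (rule that)
    fix Q x T assume Q: "tilted_laws P g Q" and x: "x \<in> circle" and T: "0 \<le> (T :: real)"
    note DQ = tilted_lawsD[OF Q x]
    interpret prob_space "Q x" by fact
    have "space (path_filtration 0) \<in> sets (path_filtration 0)" by blast
    then have B: "circle_paths \<in> sets (path_filtration 0)" by (simp add: path_filtration_def)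
    let ?Y = "\<lambda>w. indicator circle_paths w * exp (- g (w 0))"
    obtain C where Y: "?Y \<in> borel_measurable (path_filtration 0)" "\<And>w. w \<in> circle_paths \<Longrightarrow> \<bar>?Y w\<bar> \<le> C"
      using initial_weight[OF g order_refl B] by blast
    note FK = P' x order_refl Y U K(2)
    have fk: "(LINT w|Q x. f (w s)) = feynman_kac (P x) ?Y ?U s (\<lambda>y. exp (g y) * f y)"
      if "0 \<le> s" and f: "C0_circle f" for f s
    proof -
      have "(\<lambda>w. w s) \<in> borel_measurable (path_filtration s)"
        unfolding path_filtration_def by (rule measurable_coordinate_borel) (use that in auto)
      from tilted_laws_LINT[OF P Q x \<open>0 \<le> s\<close> measurable_compose[OF this C0_circle_measurable[OF f]]]
      have "(LINT w|Q x. f (w s)) = (LINT w|P x. exp (tilting_exponent g s w) * f (w s))" .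
      also have "\<dots> = (LINT w|P x. indicator circle_paths w * exp (tilting_exponent g s w) * f (w s))"
        by (rule Bochner_Integration.integral_cong) (auto simp: markov_lawsD(3)[OF P' x])
      finally show ?thesis by (simp only: tilted_integral_eq_feynman_kac)
    qed
    define a where "a s = (LINT w|Q x. \<phi> (w s))" for s
    define c where "c s = (LINT w|Q x. occupation ?U s w)" for s
    have C2: "C2_circle (\<lambda>y. exp (g y) * \<phi> y)" by (intro C2_circle_mult C2_circle_exp g \<phi>)
    have X: "(\<lambda>w. w s) \<in> borel_measurable (Q x)" if "0 \<le> s" for s
      using measurable_coordinate_borel[of s "{0..}"] that DQ(3)
      by (simp add: path_space_def cong: measurable_cong_sets)
    have int: "integrable (Q x) (\<lambda>w. f (w s))" if f: "C0_circle f" and "0 \<le> s" for f s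
    proof -
      obtain L where L: "L > 0" "\<And>y. \<bar>f y\<bar> \<le> L" using C0_circle_bounded[OF f] by blast
      show ?thesis
        by (rule integrable_const_bound[where B = L])
          (use L measurable_compose[OF X[OF \<open>0 \<le> s\<close>] C0_circle_measurable[OF f]] in auto)
    qed
    have a': "(a has_real_derivative (LINT w|Q x. ?U (w s)) - m) (at_right s)" if s: "0 \<le> s" for s
    proof -
      have e: "(\<lambda>y. half_laplacian (\<lambda>y. exp (g y) * \<phi> y) y - ?U y * (exp (g y) * \<phi> y))
        = (\<lambda>y. exp (g y) * (?U y - m))"
        unfolding half_laplacian_exp_mult[OF g \<phi>(1)] \<phi>(2) ..
      have "((\<lambda>s. feynman_kac (P x) ?Y ?U s (\<lambda>y. exp (g y) * \<phi> y)) has_real_derivative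
        feynman_kac (P x) ?Y ?U s (\<lambda>y. exp (g y) * (?U y - m))) (at_right s)"
        unfolding e[symmetric]
        by (rule feynman_kac_DERIV[where A = half_laplacian and Y = ?Y and f = "\<lambda>y. exp (g y) * \<phi> y",
            OF FK C2 half_laplacian_C0[OF C2] s])
      also have "feynman_kac (P x) ?Y ?U s (\<lambda>y. exp (g y) * (?U y - m)) = (LINT w|Q x. ?U (w s) - m)"
        by (rule fk[OF s, symmetric]) (intro C0_circle_intros U)
      also have "\<dots> = (LINT w|Q x. ?U (w s)) - m"
        using int[OF U s] by (simp add: prob_space)
      finally show ?thesis
        by (rule DERIV_at_right_cong) (use s in \<open>simp add: a_def fk[OF _ \<phi>0]\<close>)
    qed
    have acont: "continuous_on {0..T} a"
    proof -
      have "continuous_on {0..} (\<lambda>s. feynman_kac (P x) ?Y ?U s (\<lambda>y. exp (g y) * \<phi> y))"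
        by (rule feynman_kac_continuous[where Y = ?Y and f = "\<lambda>y. exp (g y) * \<phi> y", OF FK C2_circle_C0(1)[OF C2]])
      then have "continuous_on {0..} a" by (rule continuous_on_eq) (simp add: a_def fk[OF _ \<phi>0])
      then show ?thesis by (rule continuous_on_subset) auto
    qed
    note occ = expected_occupation_DERIV[OF DQ(2,3) U]
    \<comment> \<open>By the Poisson equation, the right derivative of \<open>a\<close> is that of
      \<open>c\<close> minus \<open>m\<close>, so this combination is constant; this is Dynkin's
      formula for \<open>\<phi>\<close>.\<close>
    have "\<bar>(a T - c T + m * T) - (a 0 - c 0 + m * 0)\<bar> \<le> 0 - 0"
    proof (rule right_derivative_abs_le[where c = "\<lambda>s. a s - c s + m * s" and c' = "\<lambda>_. 0"
          and d = "\<lambda>_. 0" and d' = "\<lambda>_. 0" and a = 0 and b = T])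
      show "continuous_on {0..T} (\<lambda>s. a s - c s + m * s)"
        unfolding c_def by (intro continuous_intros acont continuous_on_subset[OF occ(1)]) auto
      fix s :: real assume s: "0 \<le> s"
      show "((\<lambda>s. a s - c s + m * s) has_real_derivative 0) (at_right s)"
        unfolding c_def using a'[OF s] occ(2)[OF s] by (auto intro!: derivative_eq_intros)
    qed (use T in auto)
    then have ac: "c T = a T - a 0 + m * T" by (simp add: c_def)
    have "(LINT w|Q x. tilting_exponent g T w)
      = (LINT w|Q x. g (w T)) - (LINT w|Q x. g (w 0)) - c T"
      unfolding tilting_exponent_eq c_def
      using int[OF g0 T] int[OF g0 order_refl] occ(3)[OF T] by simp
    moreover have "\<bar>LINT w|Q x. g (w s)\<bar> \<le> N" "\<bar>a s\<bar> \<le> M" for s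
      unfolding a_def by (rule prob_space_abs_integral_le[OF DQ(2)]; rule N M)+
    then have "\<bar>LINT w|Q x. g (w T)\<bar> \<le> N" "\<bar>LINT w|Q x. g (w 0)\<bar> \<le> N" "\<bar>a T\<bar> \<le> M" "\<bar>a 0\<bar> \<le> M"
      by blast+
    ultimately show "\<bar>(LINT w|Q x. tilting_exponent g T w) + T * (LINT y|tilted_marginal g. ?U y)\<bar> \<le> 2 * N + 2 * M"
      unfolding m_def[symmetric] ac by (simp add: mult.commute)
  qed
qed

lemma tilted_marginal:
  assumes "C2_circle g"
  shows "prob_space (tilted_marginal g)" "sets (tilted_marginal g) = sets circle_borel"
    "space (tilted_marginal g) = circle"
    "C0_circle f \<Longrightarrow> (LINT x|tilted_marginal g. f x)
      = (LINT x|circle_lebesgue. exp (2 * g x) * f x) / (LINT x|circle_lebesgue. exp (2 * g x))"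
    "C0_circle f \<Longrightarrow> integrable (tilted_marginal g) f"
proof -
  have "C0_circle (\<lambda>x. exp (2 * g x))" "\<And>x. 0 < exp (2 * g x)"
    by (intro C0_circle_intros C2_circle_C0 assms) simp
  from normalized_density[OF this]
  show "prob_space (tilted_marginal g)" "sets (tilted_marginal g) = sets circle_borel"
    "space (tilted_marginal g) = circle"
    "C0_circle f \<Longrightarrow> (LINT x|tilted_marginal g. f x)
      = (LINT x|circle_lebesgue. exp (2 * g x) * f x) / (LINT x|circle_lebesgue. exp (2 * g x))"
    "C0_circle f \<Longrightarrow> integrable (tilted_marginal g) f"
    by (simp_all add: tilted_marginal_def)
qed

text \<open>The bound on the expected exponent survives averaging over starting points, so the
  entropy up to \<open>T\<close> differs from \<open>T * m\<close> by at most \<open>C\<close>, and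
  the rate by at most \<open>C / T\<close>.\<close>

lemma tilted_laws_relative_entropy:
  assumes P: "brownian_laws P" and Q: "tilted_laws P g Q"
  shows "relative_entropy P Q (tilted_marginal g) = (LINT y|tilted_marginal g. tilt_potential g y)"
proof -
  have P': "markov_laws half_laplacian P" using P by (simp add: brownian_laws_def)
  have g: "C2_circle g" using Q by (simp add: tilted_laws_def)
  let ?\<mu> = "tilted_marginal g"
  define m where "m = (LINT y|?\<mu>. tilt_potential g y)"
  note \<mu> = tilted_marginal[OF g]
  interpret prob_space ?\<mu> by fact
  obtain C where C: "\<And>Q x T. tilted_laws P g Q \<Longrightarrow> x \<in> circle \<Longrightarrow> 0 \<le> T \<Longrightarrow>
    \<bar>(LINT w|Q x. tilting_exponent g T w) + T * m\<bar> \<le> C"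
    using tilted_laws_expected_exponent[OF P g] unfolding m_def by blast
  have bound: "\<bar>relative_entropy_upto P Q ?\<mu> T - T * m\<bar> \<le> C" if T: "0 \<le> T" for T
  proof -
    let ?j = "\<lambda>x. LINT w|Q x. tilting_exponent g T w"
    \<comment> \<open>Measurability in \<open>x\<close> of the expected exponent comes from the
      Brownian kernel, after the density has been moved into the integrand.\<close>
    have "(\<lambda>x. LINT w|P x. exp (tilting_exponent g T w) * tilting_exponent g T w) \<in> borel_measurable circle_borel"
      using measurable_path_filtration_path_space[OF tilting_exponent_measurable[OF g T]]
      by (intro markov_laws_kernel_measurable[OF P']) measurable
    then have "(\<lambda>x. LINT w|P x. exp (tilting_exponent g T w) * tilting_exponent g T w) \<in> borel_measurable ?\<mu>"
      using \<mu>(2) by (simp cong: measurable_cong_sets)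
    then have jm: "?j \<in> borel_measurable ?\<mu>"
      by (rule measurable_cong[THEN iffD1, rotated])
        (use tilted_laws_LINT[OF P Q _ T tilting_exponent_measurable[OF g T]] \<mu>(3) in auto)
    have jb: "\<bar>?j x\<bar> \<le> C + \<bar>T * m\<bar>" if "x \<in> circle" for x
      using C[OF Q that T] by linarith
    have ji: "integrable ?\<mu> ?j"
      by (rule integrable_const_bound[where B = "C + \<bar>T * m\<bar>"]) (use jm jb \<mu>(3) in \<open>auto intro!: AE_I2\<close>)
    have "relative_entropy_upto P Q ?\<mu> T = - (LINT x|?\<mu>. ?j x)"
      unfolding relative_entropy_upto_def neg_equal_iff_equal
      by (rule Bochner_Integration.integral_cong[OF refl])
        (rule tilted_laws_log_density[OF P Q _ T], simp add: \<mu>(3))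
    then have "relative_entropy_upto P Q ?\<mu> T - T * m = - (LINT x|?\<mu>. ?j x + T * m)"
      using ji by (simp add: prob_space)
    moreover have "\<bar>LINT x|?\<mu>. ?j x + T * m\<bar> \<le> C"
      by (rule prob_space_abs_integral_le[OF \<mu>(1)]) (use C[OF Q _ T] \<mu>(3) in auto)
    ultimately show ?thesis by simp
  qed
  have "((\<lambda>T. 1 / T * relative_entropy_upto P Q ?\<mu> T - m) \<longlongrightarrow> 0) at_top"
  proof (rule Lim_null_comparison)
    show "((\<lambda>T. C / T) \<longlongrightarrow> 0) at_top"
      by (rule real_tendsto_divide_at_top[OF tendsto_const filterlim_ident])
    show "\<forall>\<^sub>F T in at_top. norm (1 / T * relative_entropy_upto P Q ?\<mu> T - m) \<le> C / T"
      using eventually_gt_at_top[of "0 :: real"]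
    proof eventually_elim
      case (elim T)
      have "1 / T * relative_entropy_upto P Q ?\<mu> T - m = (relative_entropy_upto P Q ?\<mu> T - T * m) / T"
        using elim by (simp add: field_simps)
      then show ?case using bound[of T] elim by (simp add: divide_right_mono)
    qed
  qed
  then have "((\<lambda>T. 1 / T * relative_entropy_upto P Q ?\<mu> T) \<longlongrightarrow> m) at_top"
    by (simp add: LIM_zero_iff)
  then show ?thesis
    unfolding relative_entropy_def m_def by (intro tendsto_Lim) auto
qed

section \<open>The variational principle\<close>

text \<open>
  The integrand \<open>tilt_potential g - tilt_potential G + (g' - G')\<^sup>2 / 2\<close>, multiplied by \<open>exp (2 * g)\<close>,
  is the derivative of \<open>(g' - G') * exp (2 * g) / 2\<close>.
\<close>

lemma tilted_marginal_tilt_potential_diff: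
  assumes g: "C2_circle g" and G: "C2_circle G"
  shows "(LINT x|tilted_marginal g. tilt_potential g x - tilt_potential G x)
    = - (LINT x|tilted_marginal g. (deriv g x - deriv G x)\<^sup>2) / 2"
proof -
  let ?\<mu> = "tilted_marginal g"
  note \<mu> = tilted_marginal[OF g]
  let ?f = "\<lambda>x. tilt_potential g x - tilt_potential G x + 1 / 2 * (deriv g x - deriv G x)\<^sup>2"
  have sq: "C0_circle (\<lambda>x. (deriv g x - deriv G x)\<^sup>2)"
    by (intro C0_circle_intros C2_circle_C0 g G)
  have d: "C0_circle (\<lambda>x. tilt_potential g x - tilt_potential G x)"
    by (intro C0_circle_intros tilt_potential_C0 g G)
  have f: "C0_circle ?f" by (intro C0_circle_intros(2) C0_circle_intros(4) C0_circle_intros(1) d sq)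
  have "C0_circle (\<lambda>x. exp (2 * g x) * ?f x)"
    by (intro C0_circle_intros(4)[OF _ f] C0_circle_intros(7) C0_circle_intros(4) C0_circle_intros(1) C2_circle_C0 g)
  then have "(LINT x|circle_lebesgue. exp (2 * g x) * ?f x)
    = 1 / 2 * ((deriv g 1 - deriv G 1) * exp (2 * g 1)) - 1 / 2 * ((deriv g 0 - deriv G 0) * exp (2 * g 0))"
  proof (rule circle_lebesgue_FTC)
    show "((\<lambda>x. 1 / 2 * ((deriv g x - deriv G x) * exp (2 * g x))) has_real_derivative exp (2 * g x) * ?f x) (at x)" for x
      using C2_circle_DERIV[OF g, of x] C2_circle_DERIV[OF G, of x]
      by (auto intro!: derivative_eq_intros simp: tilt_potential_def power2_eq_square field_simps)
  qed
  \<comment> \<open>The boundary terms at 0 and 1 cancel because \<open>g\<close>, \<open>g'\<close>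
    and \<open>G'\<close> are periodic.\<close>
  also have "\<dots> = 0"
    using C2_circle_C0[OF g] C2_circle_C0[OF G] by (simp add: C0_circle_def periodic1_def) (metis add_0)
  finally have "(LINT x|?\<mu>. ?f x) = 0" unfolding \<mu>(4)[OF f] by simp
  moreover have "(LINT x|?\<mu>. ?f x) = (LINT x|?\<mu>. tilt_potential g x - tilt_potential G x)
    + 1 / 2 * (LINT x|?\<mu>. (deriv g x - deriv G x)\<^sup>2)"
    unfolding integral_mult_right_zero[symmetric]
    by (rule Bochner_Integration.integral_add) (intro \<mu>(5) d sq C0_circle_intros(4) C0_circle_intros(1))+
  ultimately show ?thesis by simp
qed

lemma tilted_laws_free_energy:
  assumes P: "brownian_laws P" and Q: "tilted_laws P g Q" and G: "C2_circle G"
    and V: "\<And>x. V x = lam - tilt_potential G x"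
  shows "free_energy P V Q (tilted_marginal g)
    = lam - (LINT x|tilted_marginal g. (deriv g x - deriv G x)\<^sup>2) / 2"
proof -
  have g: "C2_circle g" using Q by (simp add: tilted_laws_def)
  let ?\<mu> = "tilted_marginal g"
  note \<mu> = tilted_marginal[OF g]
  interpret prob_space ?\<mu> by fact
  note i = \<mu>(5)[OF tilt_potential_C0[OF g]] \<mu>(5)[OF tilt_potential_C0[OF G]]
  have "(LINT x|?\<mu>. V x) = lam - (LINT x|?\<mu>. tilt_potential G x)"
    unfolding V using i by (simp add: prob_space)
  then have "free_energy P V Q ?\<mu> = lam + (LINT x|?\<mu>. tilt_potential g x - tilt_potential G x)"
    unfolding free_energy_def tilted_laws_relative_entropy[OF P Q] using i by simp
  then show ?thesis unfolding tilted_marginal_tilt_potential_diff[OF g G] by simp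
qed

lemma tilted_marginal_square_eq_0_imp:
  assumes g: "C2_circle g" and G: "C2_circle G"
    and 0: "(LINT x|tilted_marginal g. (deriv g x - deriv G x)\<^sup>2) = 0"
  shows "deriv g x = deriv G x"
proof -
  have sq: "C0_circle (\<lambda>x. (deriv g x - deriv G x)\<^sup>2)"
    by (intro C0_circle_intros C2_circle_C0 g G)
  have e: "C0_circle (\<lambda>x. exp (2 * g x))" by (intro C0_circle_intros C2_circle_C0 g)
  have "0 < (LINT x|circle_lebesgue. exp (2 * g x))"
    by (rule circle_lebesgue_integral_pos[OF e]) simp
  then have "(LINT x|circle_lebesgue. exp (2 * g x) * (deriv g x - deriv G x)\<^sup>2) = 0"
    using 0 by (simp add: tilted_marginal(4)[OF g sq])
  then have "exp (2 * g x) * (deriv g x - deriv G x)\<^sup>2 = 0"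
    by (rule circle_lebesgue_integral_eq_0_imp[OF C0_circle_intros(4)[OF e sq], rotated]) simp
  then show ?thesis by simp
qed

text \<open>The filtration is nested, so the union of its sigma-algebras is intersection-stable; it
  contains every coordinate event and therefore generates the path space.\<close>

lemma path_space_measure_eqI:
  assumes R: "prob_space R" "sets R = sets path_space" and S: "sets S = sets path_space"
    and eq: "\<And>T. 0 \<le> T \<Longrightarrow> restr_to_subalg R (path_filtration T) = restr_to_subalg S (path_filtration T)"
  shows "R = S"
proof -
  interpret prob_space R by fact
  let ?E = "\<Union>T\<in>{0..}. sets (path_filtration T)"
  have mono: "sets (path_filtration T) \<subseteq> sets (path_filtration T')" if "T \<le> T'" for T T'
    unfolding path_filtration_def sets_coordinate_algebra
    using that by (intro sigma_sets_mono') fastforce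
  have sub: "?E \<subseteq> sets path_space"
    using subalgebra_path_filtration by (auto simp: subalgebra_def)
  have gen: "sets path_space = sigma_sets circle_paths ?E"
  proof
    have "{(\<lambda>w. w t) -` B \<inter> circle_paths |t B. t \<in> {0..} \<and> B \<in> sets borel} \<subseteq> ?E"
    proof
      fix X assume "X \<in> {(\<lambda>w. w t) -` B \<inter> circle_paths |t B. t \<in> {0..} \<and> B \<in> sets (borel :: real measure)}"
      then obtain t B where X: "X = (\<lambda>w. w t) -` B \<inter> circle_paths" "0 \<le> t" "B \<in> sets (borel :: real measure)"
        by auto
      then have "X \<in> sets (path_filtration t)"
        unfolding path_filtration_def sets_coordinate_algebra by (intro sigma_sets.Basic) auto
      then show "X \<in> ?E" using X(2) by blast
    qed
    then show "sets path_space \<subseteq> sigma_sets circle_paths ?E"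
      unfolding path_space_def sets_coordinate_algebra by (rule sigma_sets_mono')
    show "sigma_sets circle_paths ?E \<subseteq> sets path_space"
      using sets.sigma_sets_subset[OF sub] by (simp add: path_space_def)
  qed
  show ?thesis
  proof (rule measure_eqI_generator_eq[where E = ?E and \<Omega> = circle_paths and A = "\<lambda>_. circle_paths"])
    show "Int_stable ?E"
    proof (rule Int_stableI)
      fix X Y assume "X \<in> ?E" "Y \<in> ?E"
      then obtain T T' where T: "0 \<le> T" "X \<in> sets (path_filtration T)" "0 \<le> T'" "Y \<in> sets (path_filtration T')"
        by auto
      then have "X \<inter> Y \<in> sets (path_filtration (max T T'))"
        using mono[of T "max T T'"] mono[of T' "max T T'"] by (intro sets.Int) auto
      then show "X \<inter> Y \<in> ?E" using T by (intro UN_I[of "max T T'"]) auto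
    qed
    show "?E \<subseteq> Pow circle_paths"
      using sub sets.sets_into_space[of _ path_space] by (auto simp: path_space_def)
    show "sets R = sigma_sets circle_paths ?E" "sets S = sigma_sets circle_paths ?E"
      using R(2) S gen by auto
    have "circle_paths \<in> sets (path_filtration 0)"
      using sets.top[of "path_filtration 0"] by (simp add: path_filtration_def)
    then show "range (\<lambda>_ :: nat. circle_paths) \<subseteq> ?E" by auto
    show "emeasure R circle_paths \<noteq> \<infinity>" for i :: nat by simp
    fix X assume "X \<in> ?E"
    then obtain T where T: "0 \<le> T" "X \<in> sets (path_filtration T)" by auto
    have "emeasure R X = emeasure (restr_to_subalg R (path_filtration T)) X"
      by (rule emeasure_restr_to_subalg[OF subalgebra_restr[OF R(2)] T(2), symmetric])
    also have "\<dots> = emeasure S X"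
      unfolding eq[OF T(1)] by (rule emeasure_restr_to_subalg[OF subalgebra_restr[OF S] T(2)])
    finally show "emeasure R X = emeasure S X" .
  qed auto
qed

text \<open>The constant cancels in the difference of the end values and in the normalization of the
  density.\<close>

lemma tilted_laws_add_const:
  assumes "\<And>x. g x = G x + c"
  shows "tilting_exponent g T w = tilting_exponent G T w" "tilted_marginal g = tilted_marginal G"
proof -
  have "deriv g = deriv G"
  proof
    fix x
    have "(g has_field_derivative D) (at x) \<longleftrightarrow> (G has_field_derivative D) (at x)" for D
    proof
      assume "(g has_field_derivative D) (at x)"
      then have "((\<lambda>x. g x - c) has_field_derivative D) (at x)" by (auto intro!: derivative_eq_intros)
      then show "(G has_field_derivative D) (at x)" by (simp add: assms)
    next
      assume "(G has_field_derivative D) (at x)"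
      then have "((\<lambda>x. G x + c) has_field_derivative D) (at x)" by (auto intro!: derivative_eq_intros)
      then show "(g has_field_derivative D) (at x)" by (simp add: assms[symmetric])
    qed
    then show "deriv g x = deriv G x" by (simp add: deriv_def)
  qed
  then show "tilting_exponent g T w = tilting_exponent G T w"
    by (simp add: tilting_exponent_def assms)
  have "exp (2 * g x) = exp (2 * c) * exp (2 * G x)" for x
    by (simp add: assms exp_add[symmetric] algebra_simps)
  then show "tilted_marginal g = tilted_marginal G"
    by (simp add: tilted_marginal_def normalized_density_def)
qed

text \<open>\<open>equilibrium_state\<close> speaks of one measure on path space, but uniqueness is
  obtained for the whole disintegration: a maximizing pair has the Gibbs marginal, and its laws
  coincide with \<open>PV\<close> at every point of the circle.\<close>

theorem proposition2p4:
  fixes V F :: "real \<Rightarrow> real" and lam :: real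
    and P PV :: "real \<Rightarrow> (real \<Rightarrow> real) measure"
  assumes "lipschitz_circle V"
    and "brownian_laws P"
    and "largest_eigenvalue V lam"
    and "eigenfunction V lam F" and "\<forall>x. F x > 0"
    and "markov_laws (gibbs_generator F) PV"
  shows "pressure P V
           = ereal (relative_entropy P PV (gibbs_marginal F) + (LINT x|gibbs_marginal F. V x))
       \<and> relative_entropy P PV (gibbs_marginal F) + (LINT x|gibbs_marginal F. V x) = lam
       \<and> (\<forall>R. equilibrium_state P V R \<longleftrightarrow> R = mixture (gibbs_marginal F) PV)"
proof -
  note P = \<open>brownian_laws P\<close>
  have Fpos: "0 < F x" for x using assms(5) by blast
  have F: "C2_circle F" and eig: "half_laplacian F x + V x * F x = lam * F x" for x
    using assms(4) by (auto simp: eigenfunction_def)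
  define G where "G x = ln (F x)" for x
  have G: "C2_circle G" unfolding G_def by (rule C2_circle_ln[OF F Fpos])
  have expG: "exp (G x) = F x" for x using Fpos by (simp add: G_def)
  \<comment> \<open>The eigenvalue equation divided by the positive function
    \<open>F = exp G\<close>.\<close>
  have V: "V x = lam - tilt_potential G x" for x
  proof -
    have "half_laplacian F x = F x * tilt_potential G x"
      using C2_circle_exp(3)[OF G, of x] by (simp add: expG tilt_potential_def)
    then have "F x * (tilt_potential G x + V x) = F x * lam"
      using eig[of x] by (simp add: algebra_simps)
    then show ?thesis using Fpos[of x] by simp
  qed
  have "gibbs_generator F = drift_generator G"
    by (intro ext) (simp add: gibbs_generator_def drift_generator_def G_def[abs_def])
  with assms(6) have PV: "markov_laws (drift_generator G) PV" by simp
  have "exp (2 * G x) = (F x)\<^sup>2" for x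
    by (simp add: expG[symmetric] exp_double)
  then have marg: "gibbs_marginal F = tilted_marginal G"
    by (simp add: gibbs_marginal_def tilted_marginal_def)
  \<comment> \<open>Here the Gibbs process, specified by its generator, is recognized as a
    competitor in the supremum.\<close>
  have tilt: "tilted_laws P G PV"
    using drift_laws_density[OF P PV G] markov_lawsD[OF PV] G by (auto simp: tilted_laws_def)
  have adm: "admissible_pair P PV (gibbs_marginal F)"
    unfolding admissible_pair_def marg using tilt by blast
  have gibbs: "free_energy P V PV (gibbs_marginal F) = lam"
    unfolding marg tilted_laws_free_energy[OF P tilt G V] by simp
  have le: "free_energy P V Q \<mu> \<le> lam" if "admissible_pair P Q \<mu>" for Q \<mu>
  proof -
    obtain g where g: "tilted_laws P g Q" "\<mu> = tilted_marginal g"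
      using \<open>admissible_pair P Q \<mu>\<close> by (auto simp: admissible_pair_def)
    have "0 \<le> (LINT x|tilted_marginal g. (deriv g x - deriv G x)\<^sup>2)"
      by (rule Bochner_Integration.integral_nonneg) simp
    then show ?thesis unfolding g(2) tilted_laws_free_energy[OF P g(1) G V] by simp
  qed
  have pressure: "pressure P V = ereal lam"
    unfolding pressure_def
  proof (rule Sup_eqI)
    fix y assume "\<And>z. z \<in> {ereal (free_energy P V Q \<mu>) |Q \<mu>. admissible_pair P Q \<mu>} \<Longrightarrow> z \<le> y"
    then show "ereal lam \<le> y" using adm gibbs by blast
  qed (use le in auto)
  have "R = mixture (gibbs_marginal F) PV" if "equilibrium_state P V R" for R
  proof -
    obtain Q \<mu> where Q\<mu>: "admissible_pair P Q \<mu>" "R = mixture \<mu> Q" "ereal (free_energy P V Q \<mu>) = pressure P V"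
      using \<open>equilibrium_state P V R\<close> by (auto simp: equilibrium_state_def)
    then obtain g where g: "tilted_laws P g Q" "\<mu> = tilted_marginal g"
      by (auto simp: admissible_pair_def)
    have g2: "C2_circle g" using g(1) by (simp add: tilted_laws_def)
    \<comment> \<open>The deficit of the free energy from \<open>lam\<close> is half of this
      integral, so attaining the supremum forces it to vanish.\<close>
    have "(LINT x|tilted_marginal g. (deriv g x - deriv G x)\<^sup>2) = 0"
      using Q\<mu>(3) tilted_laws_free_energy[OF P g(1) G V] by (simp add: pressure g(2))
    then have d: "deriv g x = deriv G x" for x
      by (rule tilted_marginal_square_eq_0_imp[OF g2 G])
    have "((\<lambda>x. g x - G x) has_real_derivative 0) (at x)" for x
      using DERIV_diff[OF C2_circle_DERIV(1)[OF g2, of x] C2_circle_DERIV(1)[OF G, of x]] by (simp add: d)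
    then have "g x - G x = g 0 - G 0" for x
      using DERIV_isconst_all[of "\<lambda>x. g x - G x" x 0] by simp
    then have c: "g x = G x + (g 0 - G 0)" for x by (simp add: algebra_simps)
    \<comment> \<open>\<open>g\<close> and \<open>G\<close> differ by a constant, so both laws have
      the same density with respect to \<open>P x\<close> on every
      \<open>path_filtration T\<close>.\<close>
    have "Q x = PV x" if x: "x \<in> circle" for x
    proof (rule path_space_measure_eqI)
      show "restr_to_subalg (Q x) (path_filtration T) = restr_to_subalg (PV x) (path_filtration T)" if "0 \<le> T" for T
        using tilted_lawsD(5)[OF g(1) x that] tilted_lawsD(5)[OF tilt x that]
        by (simp add: tilted_laws_add_const(1)[OF c])
    qed (use tilted_lawsD[OF g(1) x] tilted_lawsD[OF tilt x] in auto)
    then show ?thesis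
      unfolding Q\<mu>(2) g(2) marg mixture_def tilted_laws_add_const(2)[OF c]
      \<comment> \<open>The mixture uses the laws only on the space of the marginal, which is the
        circle.\<close>
      by (intro bind_cong refl) (simp add: tilted_marginal(3)[OF G])
  qed
  moreover have "equilibrium_state P V (mixture (gibbs_marginal F) PV)"
    unfolding equilibrium_state_def pressure using adm gibbs by blast
  ultimately have "\<forall>R. equilibrium_state P V R \<longleftrightarrow> R = mixture (gibbs_marginal F) PV"
    by blast
  moreover have "relative_entropy P PV (gibbs_marginal F) + (LINT x|gibbs_marginal F. V x) = lam"
    using gibbs by (simp add: free_energy_def)
  ultimately show ?thesis using pressure by (intro conjI) (simp_all only: simp_thms)
qed

end
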